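(* Let $-\infty<a<b<\infty$ and let $X=(X_t:t\in\mathbb R)$ be a real-valued centered Gaussian process with continuous sample paths and covariance function $R(s,t)=\mathrm E(X_sX_t)$. Assume that at least one of the following holds. (a) (i) There are real numbers $(r_{mn}:m,n\ge 0)$ with $R(s,t)=\sum_{m=0}^\infty\sum_{n=0}^\infty r_{mn}s^mt^n$ for all $s,t\in\mathbb R$; (ii) for every compact interval $[c,d]$ and every Borel probability measure $\nu$ on $[c,d]$, $\int_c^d\int_c^dR(s,t)\,\nu(ds)\,\nu(dt)>0$; (iii) the sample paths of $X$ are infinitely differentiable, and for any finitely many distinct pairs $(s_1,n_1),\ldots,(s_p,n_p)\in\mathbb R\times\{0,1,2,\ldots\}$ the covariance matrix of $(X^{(n_1)}_{s_1},\ldots,X^{(n_p)}_{s_p})$ is non-singular; (iv) $\limsup_{t\to\infty}R(s,t)\le 0$ for every $s\in[a,b]$. (b) $X$ is stationary, and its spectral measure $F_X$ satisfies $\int_{-\infty}^\infty e^{tx}F_X(dx)<\infty$ for all $t\in\mathbb R$, and the support of $F_X$ has at least one accumulation point. Let $S$, $V_*$ and $\mu$ be as defined in the context, and assume also that $\mu^{(2)}(t)>0$ for all $t\in S\cap(a,b)$. Then, as $u\to\infty$, the conditional distribution of $u\big(\min_{t\in[a,b]}X_t-u\big)$ given $\min_{t\in[a,b]}X_t>u$ converges weakly to an exponential distribution with mean $V_*$.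
   Context: Notation: $f^{(n)}$ is the $n$-th derivative, $f^{(0)}=f$. The spectral measure of a stationary process $X$ is the finite symmetric Borel measure $F_X$ on $\mathbb R$ with $R(s,t)=\int_{-\infty}^\infty e^{i(t-s)x}F_X(dx)$. In case (b), a version of $X$ with infinitely differentiable sample paths is used. $M_1[a,b]$ is the set of Borel probability measures on $[a,b]$. Under (a) or (b) the problem $\min_{\nu\in M_1[a,b]}\int_a^b\int_a^bR(s,t)\,\nu(ds)\,\nu(dt)$ has a unique minimizer $\nu_*$, whose support $S=\{t_1,\ldots,t_k\}$ is finite, and the minimum value $V_*$ is strictly positive. The covariance matrix of $(X_{t_1},\ldots,X_{t_k})$ is invertible. For $t\in\mathbb R$, $\mu(t)=\mathrm E(X_t\mid X_s=1\text{ for all }s\in S)$; that is, if $\mathrm E(X_t\mid X_{t_1},\ldots,X_{t_k})=\sum_{j=1}^k a_j(t)X_{t_j}$ then $\mu(t)=\sum_{j=1}^k a_j(t)$. The function $\mu$ is infinitely differentiable. *)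

theory Defs
  imports "HOL-Probability.Probability" "Jordan_Normal_Form.Matrix"
begin

section \<open>Gaussian processes\<close>

text \<open>The standard deviation 0 is allowed and gives a point mass.\<close>
definition gaussian_measure :: "real \<Rightarrow> real \<Rightarrow> real measure" where
  "gaussian_measure m \<sigma> =
     (if \<sigma> = 0 then return borel m else density lborel (\<lambda>x. ennreal (normal_density m \<sigma> x)))"

text \<open>All finite-dimensional distributions are (possibly degenerate) multivariate normal, that is,
  every finite linear combination is a normal random variable.\<close>
definition gaussian_process :: "'w measure \<Rightarrow> (real \<Rightarrow> 'w \<Rightarrow> real) \<Rightarrow> bool" where
  "gaussian_process M X \<longleftrightarrow>
     prob_space M \<and> (\<forall>t. X t \<in> borel_measurable M) \<and>
     (\<forall>T c. finite T \<longrightarrow>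
        (\<exists>m \<sigma>. \<sigma> \<ge> 0 \<and> distr M borel (\<lambda>\<omega>. \<Sum>t\<in>T. c t * X t \<omega>) = gaussian_measure m \<sigma>))"

definition centered :: "'w measure \<Rightarrow> (real \<Rightarrow> 'w \<Rightarrow> real) \<Rightarrow> bool" where
  "centered M X \<longleftrightarrow> (\<forall>t. (\<integral>\<omega>. X t \<omega> \<partial>M) = 0)"

text \<open>\<open>E(X\<^sub>s X\<^sub>t)\<close>, the covariance function of a centered process.\<close>
definition cov_fun :: "'w measure \<Rightarrow> (real \<Rightarrow> 'w \<Rightarrow> real) \<Rightarrow> real \<Rightarrow> real \<Rightarrow> real" where
  "cov_fun M X s t = (\<integral>\<omega>. X s \<omega> * X t \<omega> \<partial>M)"

definition covariance :: "'w measure \<Rightarrow> ('w \<Rightarrow> real) \<Rightarrow> ('w \<Rightarrow> real) \<Rightarrow> real" where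
  "covariance M Y Z =
     (\<integral>\<omega>. (Y \<omega> - (\<integral>\<omega>'. Y \<omega>' \<partial>M)) * (Z \<omega> - (\<integral>\<omega>'. Z \<omega>' \<partial>M)) \<partial>M)"

definition covariance_matrix :: "'w measure \<Rightarrow> ('w \<Rightarrow> real) list \<Rightarrow> real mat" where
  "covariance_matrix M Ys =
     mat (length Ys) (length Ys) (\<lambda>(i, j). covariance M (Ys ! i) (Ys ! j))"

definition continuous_paths :: "'w measure \<Rightarrow> (real \<Rightarrow> 'w \<Rightarrow> real) \<Rightarrow> bool" where
  "continuous_paths M X \<longleftrightarrow> (\<forall>\<omega>\<in>space M. continuous_on UNIV (\<lambda>t. X t \<omega>))"

definition smooth_paths :: "'w measure \<Rightarrow> (real \<Rightarrow> 'w \<Rightarrow> real) \<Rightarrow> bool" where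
  "smooth_paths M X \<longleftrightarrow>
     (\<forall>\<omega>\<in>space M. \<forall>n. (deriv ^^ n) (\<lambda>t. X t \<omega>) differentiable_on UNIV)"

definition path_deriv :: "(real \<Rightarrow> 'w \<Rightarrow> real) \<Rightarrow> nat \<Rightarrow> real \<Rightarrow> 'w \<Rightarrow> real" where
  "path_deriv X n s \<omega> = (deriv ^^ n) (\<lambda>t. X t \<omega>) s"

text \<open>Strict stationarity: the law of the process on \<open>\<real>\<^sup>\<real>\<close> is invariant under time shifts.\<close>
definition stationary :: "'w measure \<Rightarrow> (real \<Rightarrow> 'w \<Rightarrow> real) \<Rightarrow> bool" where
  "stationary M X \<longleftrightarrow>
     (\<forall>h. distr M (\<Pi>\<^sub>M t\<in>UNIV. borel) (\<lambda>\<omega> t. X (t + h) \<omega>)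
        = distr M (\<Pi>\<^sub>M t\<in>UNIV. borel) (\<lambda>\<omega> t. X t \<omega>))"

definition is_spectral_measure ::
    "'w measure \<Rightarrow> (real \<Rightarrow> 'w \<Rightarrow> real) \<Rightarrow> real measure \<Rightarrow> bool" where
  "is_spectral_measure M X F \<longleftrightarrow>
     finite_borel_measure F \<and> distr F borel uminus = F \<and>
     (\<forall>s t. complex_of_real (cov_fun M X s t)
              = (\<integral>x. exp (\<i> * complex_of_real ((t - s) * x)) \<partial>F))"

section \<open>Supports and the energy problem\<close>

definition measure_support :: "real measure \<Rightarrow> real set" where
  "measure_support F = {x. \<forall>U. open U \<longrightarrow> x \<in> U \<longrightarrow> emeasure F U > 0}"

text \<open>Borel probability measures on \<open>[a,b]\<close>, represented as Borel probability measures
  on \<open>\<real>\<close> that give mass 1 to \<open>[a,b]\<close>.\<close>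
definition prob_on :: "real \<Rightarrow> real \<Rightarrow> real measure set" where
  "prob_on a b = {\<nu>. real_distribution \<nu> \<and> measure \<nu> {a..b} = 1}"

definition energy :: "(real \<Rightarrow> real \<Rightarrow> real) \<Rightarrow> real \<Rightarrow> real \<Rightarrow> real measure \<Rightarrow> real" where
  "energy R a b \<nu> = (LINT s:{a..b}|\<nu>. (LINT t:{a..b}|\<nu>. R s t))"

definition is_energy_minimizer ::
    "(real \<Rightarrow> real \<Rightarrow> real) \<Rightarrow> real \<Rightarrow> real \<Rightarrow> real measure \<Rightarrow> bool" where
  "is_energy_minimizer R a b \<nu> \<longleftrightarrow> is_arg_min (energy R a b) (\<lambda>\<nu>. \<nu> \<in> prob_on a b) \<nu>"

section \<open>Conditioning on the values over a set\<close>

definition sigma_of :: "'w measure \<Rightarrow> (real \<Rightarrow> 'w \<Rightarrow> real) \<Rightarrow> real set \<Rightarrow> 'w measure" where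
  "sigma_of M X S = vimage_algebra (space M) (\<lambda>\<omega>. \<lambda>s\<in>S. X s \<omega>) (\<Pi>\<^sub>M s\<in>S. borel)"

text \<open>\<open>\<mu>(t) = E(X\<^sub>t | X\<^sub>s = 1 for all s \<in> S)\<close>, read off from the linear form of
  \<open>E(X\<^sub>t | X\<^sub>s, s \<in> S)\<close> by substituting 1 for every \<open>X\<^sub>s\<close>.
  The sum makes sense for finite \<open>S\<close> only: for infinite \<open>S\<close> it is 0, and the predicate then fails
  as soon as some \<open>X\<^sub>t\<close> with \<open>t \<in> S\<close> has positive variance.\<close>
definition is_cond_mean_at_one ::
    "'w measure \<Rightarrow> (real \<Rightarrow> 'w \<Rightarrow> real) \<Rightarrow> real set \<Rightarrow> (real \<Rightarrow> real) \<Rightarrow> bool" where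
  "is_cond_mean_at_one M X S \<mu> \<longleftrightarrow>
     (\<forall>t. \<exists>\<alpha>. (AE \<omega> in M. real_cond_exp M (sigma_of M X S) (X t) \<omega> = (\<Sum>s\<in>S. \<alpha> s * X s \<omega>)) \<and>
              \<mu> t = (\<Sum>s\<in>S. \<alpha> s))"

section \<open>The two sets of assumptions\<close>

text \<open>The double power series is read as an iterated series, without assuming absolute
  convergence.\<close>
definition entire_case :: "'w measure \<Rightarrow> (real \<Rightarrow> 'w \<Rightarrow> real) \<Rightarrow> real \<Rightarrow> real \<Rightarrow> bool" where
  "entire_case M X a b \<longleftrightarrow>
     (\<exists>r :: nat \<Rightarrow> nat \<Rightarrow> real. \<forall>s t.
        (\<forall>m. summable (\<lambda>n. r m n * s ^ m * t ^ n)) \<and>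
        (\<lambda>m. \<Sum>n. r m n * s ^ m * t ^ n) sums cov_fun M X s t) \<and>
     (\<forall>c d. \<forall>\<nu>\<in>prob_on c d. energy (cov_fun M X) c d \<nu> > 0) \<and>
     smooth_paths M X \<and>
     (\<forall>ps :: (real \<times> nat) list. distinct ps \<longrightarrow>
        invertible_mat (covariance_matrix M (map (\<lambda>(s, n). path_deriv X n s) ps))) \<and>
     (\<forall>s\<in>{a..b}. Limsup at_top (\<lambda>t. ereal (cov_fun M X s t)) \<le> 0)"

text \<open>Smoothness of the paths is the convention that a version of the process with infinitely
  differentiable sample paths is used in this case.\<close>
definition stationary_case :: "'w measure \<Rightarrow> (real \<Rightarrow> 'w \<Rightarrow> real) \<Rightarrow> bool" where
  "stationary_case M X \<longleftrightarrow>
     stationary M X \<and> smooth_paths M X \<and>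
     (\<exists>F. is_spectral_measure M X F \<and>
          (\<forall>t. (\<integral>\<^sup>+x. ennreal (exp (t * x)) \<partial>F) < \<infinity>) \<and>
          (\<exists>x. x islimpt measure_support F))"

section \<open>Conditional law and weak convergence\<close>

text \<open>For continuous paths the infimum is attained.\<close>
definition path_min :: "(real \<Rightarrow> 'w \<Rightarrow> real) \<Rightarrow> real \<Rightarrow> real \<Rightarrow> 'w \<Rightarrow> real" where
  "path_min X a b \<omega> = (INF t\<in>{a..b}. X t \<omega>)"

definition cond_law :: "'w measure \<Rightarrow> ('w \<Rightarrow> bool) \<Rightarrow> ('w \<Rightarrow> real) \<Rightarrow> real measure" where
  "cond_law M P Y = distr (uniform_measure M {\<omega>\<in>space M. P \<omega>}) borel Y"

text \<open>The library's \<open>weak_conv_m\<close>, with a general filter instead of a sequence.\<close>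
definition weak_conv_along :: "('i \<Rightarrow> real measure) \<Rightarrow> real measure \<Rightarrow> 'i filter \<Rightarrow> bool" where
  "weak_conv_along L Q \<F> \<longleftrightarrow>
     (\<forall>x. isCont (cdf Q) x \<longrightarrow> ((\<lambda>u. cdf (L u) x) \<longlongrightarrow> cdf Q x) \<F>)"

lemma weak_conv_along_sequentially: "weak_conv_along L Q sequentially \<longleftrightarrow> weak_conv_m L Q"
  by (simp add: weak_conv_along_def weak_conv_m_def weak_conv_def)

definition exponential_measure_of_mean :: "real \<Rightarrow> real measure" where
  "exponential_measure_of_mean v = density lborel (\<lambda>x. ennreal (exponential_density (1 / v) x))"

end

theory Submission
  imports Defs "HOL-Complex_Analysis.Conformal_Mappings" "HOL-Real_Asymp.Real_Asymp"
begin

text \<open>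
  Let \<open>\<nu>\<close> be the energy minimizer, \<open>W = \<integral> X\<^sub>t \<nu>(dt)\<close> and \<open>V = E W\<^sup>2\<close> the minimal energy. First-order
  optimality says that \<open>m(t) = E(W X\<^sub>t) / V \<ge> 1\<close> on \<open>[a,b]\<close>. Hence \<open>X\<^sub>t = m(t) W + Y\<^sub>t\<close>, where the Gaussian
  process \<open>Y\<close> is independent of \<open>W\<close>, and \<open>min X > u\<close> implies \<open>W > u\<close>. Let \<open>h = x / u\<close>. Given \<open>Y\<close>,
  translating \<open>W\<close> by \<open>h\<close> maps the event \<open>min X > u\<close> into \<open>min X > u + h\<close>. Conversely, as long as \<open>\<bar>Y\<bar> \<le> \<delta> u\<close>,
  translating \<open>W\<close> by \<open>- h / (1 + 2 \<delta>)\<close> maps \<open>min X > u + h\<close> into \<open>min X > u\<close>: only points with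
  \<open>m(t) \<le> 1 + 2 \<delta>\<close> can be critical. Near \<open>W = u\<close> such a translation changes the normal density by a factor
  tending to \<open>exp(x / V)\<close>. The exceptional events \<open>W > (1 + \<eta>) u\<close> and \<open>sup \<bar>Y\<bar> > \<delta> u, W > u\<close> are negligible
  because \<open>P(min X > u) \<ge> exp(- (1 + o(1)) u\<^sup>2 / (2 V))\<close> and \<open>sup \<bar>Y\<bar>\<close> has a Gaussian tail. So
  \<open>P(min X > u + x / u) / P(min X > u) \<rightarrow> exp(- x / V)\<close>.
\<close>

section \<open>Normal random variables\<close>

text \<open>The obstacle is that P(min X > u) is controlled from below only up to exponential order:
  \<open>g_lower\<close> loses a factor that is itself exponential in \<epsilon> u^2. So neither
  probability is ever expanded. The two events are compared directly by a translation, an unknown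
  prefactor cancels in the ratio, and an error only has to decay with an exponent strictly above
  1/(2V). Moving W alone at fixed Y requires independence of W from the whole residual process. It
  follows from zero correlation through characteristic functions; the uniqueness theorem is applied
  on the line only, hence the treatment of one coordinate at a time. The residual is observed on the
  countable set of dyadic points of [a,b], where countable intersections remain measurable, and
  continuity of the paths carries the events back to [a,b]. The support of \<nu> is shown to be
  finite, so that W is a finite linear combination of the process; these are the variables whose
  laws the Gaussian hypothesis describes.\<close>

lemma prob_space_std_normal [simp]: "prob_space std_normal_distribution"
  by (rule prob_space_normal_density) simp

text \<open>Writing the law as an affine image of one standard normal variable treats the point mass
  \<sigma> = 0 together with the nondegenerate case, so later integrals need no case split.\<close>

lemma gaussian_measure_eq_distr:
  assumes "\<sigma> \<ge> 0"
  shows "gaussian_measure m \<sigma> = distr std_normal_distribution borel (\<lambda>x. m + \<sigma> * x)"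
proof (cases "\<sigma> = 0")
  case True
  then show ?thesis
    by (simp add: gaussian_measure_def prob_space.distr_const)
next
  case False
  interpret prob_space std_normal_distribution by simp
  have "distributed std_normal_distribution lborel (\<lambda>x. x) std_normal_density"
    by (simp add: distributed_def distr_id2)
  then have "distributed std_normal_distribution lborel (\<lambda>x. m + \<sigma> * x) (normal_density m \<sigma>)"
    using normal_density_affine[of "\<lambda>x. x" 0 1 \<sigma> m] False assms by simp
  then have "distr std_normal_distribution lborel (\<lambda>x. m + \<sigma> * x) = density lborel (normal_density m \<sigma>)"
    by (simp add: distributed_def)
  moreover have "distr std_normal_distribution lborel (\<lambda>x. m + \<sigma> * x) = distr std_normal_distribution borel (\<lambda>x. m + \<sigma> * x)"
    by (rule distr_cong) auto
  ultimately show ?thesis using False by (simp add: gaussian_measure_def)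
qed

lemma std_normal_integrable_id: "integrable std_normal_distribution (\<lambda>x. x)"
  using integrable_std_normal_moment[of 1]
  by (subst integrable_density) (auto simp: normal_density_nonneg)

lemma std_normal_integral_id: "(\<integral>x. x \<partial>std_normal_distribution) = 0"
  using integral_std_normal_moment_odd[of 0]
  by (subst integral_density) (auto simp: normal_density_nonneg)

lemma std_normal_integrable_square: "integrable std_normal_distribution (\<lambda>x. x\<^sup>2)"
  using integrable_std_normal_moment[of 2]
  by (subst integrable_density) (auto simp: normal_density_nonneg)

lemma std_normal_integral_square: "(\<integral>x. x\<^sup>2 \<partial>std_normal_distribution) = 1"
  using integral_std_normal_moment_even[of 1]
  by (subst integral_density) (auto simp: normal_density_nonneg)

lemma std_normal_integrable_cos: "integrable std_normal_distribution (\<lambda>x. cos (t * x) :: real)"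
proof -
  interpret prob_space std_normal_distribution by simp
  show ?thesis by (rule integrable_const_bound[where B = 1]) auto
qed

lemma std_normal_integrable_sin: "integrable std_normal_distribution (\<lambda>x. sin (t * x) :: real)"
proof -
  interpret prob_space std_normal_distribution by simp
  show ?thesis by (rule integrable_const_bound[where B = 1]) auto
qed

text \<open>Real and imaginary parts of the characteristic function; the split lets the independence
  argument work with real integrands.\<close>

lemma std_normal_cos_sin:
  "(\<integral>x. cos (t * x) \<partial>std_normal_distribution) = exp (- t\<^sup>2 / 2)"
  "(\<integral>x. sin (t * x) \<partial>std_normal_distribution) = 0"
proof -
  have "(CLINT x|std_normal_distribution. iexp (t * x)) = complex_of_real (exp (- t\<^sup>2 / 2))"
    using char_std_normal_distribution unfolding char_def by metis
  moreover have "(CLINT x|std_normal_distribution. iexp (t * x)) =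
      (CLINT x|std_normal_distribution. complex_of_real (cos (t * x)) + \<i> * complex_of_real (sin (t * x)))"
    by (intro Bochner_Integration.integral_cong) (auto simp: exp_Euler cos_of_real sin_of_real mult.assoc[symmetric] simp flip: of_real_mult)
  moreover have "\<dots> = complex_of_real (\<integral>x. cos (t * x) \<partial>std_normal_distribution)
      + \<i> * complex_of_real (\<integral>x. sin (t * x) \<partial>std_normal_distribution)"
    using std_normal_integrable_cos[of t] std_normal_integrable_sin[of t]
    by (simp add: integral_complex_of_real)
  ultimately have *: "complex_of_real (\<integral>x. cos (t * x) \<partial>std_normal_distribution)
      + \<i> * complex_of_real (\<integral>x. sin (t * x) \<partial>std_normal_distribution) = complex_of_real (exp (- t\<^sup>2 / 2))"
    by simp
  show "(\<integral>x. cos (t * x) \<partial>std_normal_distribution) = exp (- t\<^sup>2 / 2)"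
    using arg_cong[OF *, of Re] by simp
  show "(\<integral>x. sin (t * x) \<partial>std_normal_distribution) = 0"
    using arg_cong[OF *, of Im] by simp
qed

text \<open>Since c \<sigma>^2 \<le> 1/4, the new factor consumes at most half of the exponent
  x^2/2. What is left is exp(-x^2/4), the normal density of variance 2 up to constants, and the
  total factor is sqrt 2 \<le> 2.\<close>

lemma std_normal_exp_square_le:
  assumes "4 * c * \<sigma>\<^sup>2 \<le> 1"
  shows "(\<integral>\<^sup>+x. ennreal (exp (c * (\<sigma> * x)\<^sup>2)) \<partial>std_normal_distribution) \<le> 2"
proof -
  have le: "std_normal_density x * exp (c * (\<sigma> * x)\<^sup>2) \<le> 2 * normal_density 0 (sqrt 2) x" for x
  proof -
    have "c * (\<sigma> * x)\<^sup>2 \<le> x\<^sup>2 / 4"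
      using mult_right_mono[OF assms, of "x\<^sup>2 / 4"] by (simp add: power_mult_distrib field_simps)
    then have "exp (- x\<^sup>2 / 2) * exp (c * (\<sigma> * x)\<^sup>2) \<le> exp (- x\<^sup>2 / 4)"
      by (simp flip: exp_add)
    then have "std_normal_density x * exp (c * (\<sigma> * x)\<^sup>2) \<le> exp (- x\<^sup>2 / 4) / sqrt (2 * pi)"
      by (simp add: normal_density_def divide_right_mono)
    also have "\<dots> = sqrt 2 * normal_density 0 (sqrt 2) x"
      by (simp add: normal_density_def real_sqrt_mult field_simps)
    also have "\<dots> \<le> 2 * normal_density 0 (sqrt 2) x"
      using real_sqrt_le_mono[of 2 4]
      by (intro mult_right_mono) (auto simp: normal_density_nonneg)
    finally show ?thesis .
  qed
  have "(\<integral>\<^sup>+x. ennreal (exp (c * (\<sigma> * x)\<^sup>2)) \<partial>std_normal_distribution) =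
      (\<integral>\<^sup>+x. ennreal (std_normal_density x * exp (c * (\<sigma> * x)\<^sup>2)) \<partial>lborel)"
    by (subst nn_integral_density) (auto simp: ennreal_mult' normal_density_nonneg)
  also have "\<dots> \<le> (\<integral>\<^sup>+x. ennreal (2 * normal_density 0 (sqrt 2) x) \<partial>lborel)"
    by (intro nn_integral_mono ennreal_leI le)
  also have "\<dots> = 2 * emeasure (density lborel (normal_density 0 (sqrt 2))) UNIV"
    by (subst emeasure_density) (auto simp: ennreal_mult' nn_integral_cmult normal_density_nonneg)
  also have "\<dots> = 2"
    using prob_space.emeasure_space_1[OF prob_space_normal_density[of "sqrt 2" 0]] by simp
  finally show ?thesis .
qed

definition normal_rv :: "'w measure \<Rightarrow> real \<Rightarrow> ('w \<Rightarrow> real) \<Rightarrow> bool" where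
  "normal_rv M \<sigma> Z \<longleftrightarrow> Z \<in> borel_measurable M \<and>
     distr M borel Z = distr std_normal_distribution borel (\<lambda>x. \<sigma> * x)"

context
  fixes M :: "'w measure" and Z :: "'w \<Rightarrow> real" and \<sigma> :: real
  assumes Z: "normal_rv M \<sigma> Z"
begin

lemma normal_rv_measurable: "Z \<in> borel_measurable M"
  using Z by (simp add: normal_rv_def)

lemma normal_rv_integrable:
  fixes f :: "real \<Rightarrow> real"
  assumes "f \<in> borel_measurable borel" "integrable std_normal_distribution (\<lambda>x. f (\<sigma> * x))"
  shows "integrable M (\<lambda>\<omega>. f (Z \<omega>))"
proof -
  have "integrable (distr std_normal_distribution borel (\<lambda>x. \<sigma> * x)) f"
    by (subst integrable_distr_eq) (use assms in auto)
  then have "integrable (distr M borel Z) f" using Z by (simp add: normal_rv_def)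
  then show ?thesis
    by (subst (asm) integrable_distr_eq) (use assms normal_rv_measurable in auto)
qed

lemma normal_rv_integral:
  fixes f :: "real \<Rightarrow> real"
  assumes f: "f \<in> borel_measurable borel"
  shows "(\<integral>\<omega>. f (Z \<omega>) \<partial>M) = (\<integral>x. f (\<sigma> * x) \<partial>std_normal_distribution)"
proof -
  have "(\<integral>\<omega>. f (Z \<omega>) \<partial>M) = integral\<^sup>L (distr M borel Z) f"
    by (subst integral_distr) (use f normal_rv_measurable in auto)
  also have "\<dots> = integral\<^sup>L (distr std_normal_distribution borel (\<lambda>x. \<sigma> * x)) f"
    using Z by (simp add: normal_rv_def)
  also have "\<dots> = (\<integral>x. f (\<sigma> * x) \<partial>std_normal_distribution)"
    by (subst integral_distr) (use f in auto)
  finally show ?thesis .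
qed

lemma normal_rv_nn_integral:
  assumes f: "f \<in> borel_measurable borel"
  shows "(\<integral>\<^sup>+\<omega>. f (Z \<omega>) \<partial>M) = (\<integral>\<^sup>+x. f (\<sigma> * x) \<partial>std_normal_distribution)"
proof -
  have "(\<integral>\<^sup>+\<omega>. f (Z \<omega>) \<partial>M) = integral\<^sup>N (distr M borel Z) f"
    by (subst nn_integral_distr) (use f normal_rv_measurable in auto)
  also have "\<dots> = integral\<^sup>N (distr std_normal_distribution borel (\<lambda>x. \<sigma> * x)) f"
    using Z by (simp add: normal_rv_def)
  also have "\<dots> = (\<integral>\<^sup>+x. f (\<sigma> * x) \<partial>std_normal_distribution)"
    by (subst nn_integral_distr) (use f in auto)
  finally show ?thesis .
qed

lemma normal_rv_emeasure:
  assumes "A \<in> sets borel"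
  shows "emeasure M {\<omega>\<in>space M. Z \<omega> \<in> A} = emeasure std_normal_distribution {x. \<sigma> * x \<in> A}"
proof -
  have "emeasure M {\<omega>\<in>space M. Z \<omega> \<in> A} = emeasure (distr M borel Z) A"
    using assms normal_rv_measurable by (subst emeasure_distr) (auto intro!: arg_cong2[where f = emeasure])
  also have "\<dots> = emeasure (distr std_normal_distribution borel (\<lambda>x. \<sigma> * x)) A"
    using Z by (simp add: normal_rv_def)
  also have "\<dots> = emeasure std_normal_distribution {x. \<sigma> * x \<in> A}"
    using assms by (subst emeasure_distr) (auto intro!: arg_cong2[where f = emeasure])
  finally show ?thesis .
qed

lemma normal_rv_moments:
  "integrable M Z" "(\<integral>\<omega>. Z \<omega> \<partial>M) = 0"
  "integrable M (\<lambda>\<omega>. (Z \<omega>)\<^sup>2)" "(\<integral>\<omega>. (Z \<omega>)\<^sup>2 \<partial>M) = \<sigma>\<^sup>2"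
proof -
  show "integrable M Z"
    using normal_rv_integrable[of "\<lambda>x. x", OF _ integrable_mult_right[OF std_normal_integrable_id]] by simp
  show "(\<integral>\<omega>. Z \<omega> \<partial>M) = 0"
    using normal_rv_integral[of "\<lambda>x. x"] std_normal_integral_id by simp
  have "integrable std_normal_distribution (\<lambda>x. (\<sigma> * x)\<^sup>2)"
    unfolding power_mult_distrib by (rule integrable_mult_right[OF std_normal_integrable_square])
  then show "integrable M (\<lambda>\<omega>. (Z \<omega>)\<^sup>2)"
    by (intro normal_rv_integrable[of "\<lambda>x. x\<^sup>2"]) auto
  have "(\<integral>\<omega>. (Z \<omega>)\<^sup>2 \<partial>M) = (\<integral>x. \<sigma>\<^sup>2 * x\<^sup>2 \<partial>std_normal_distribution)"
    by (subst normal_rv_integral[of "\<lambda>x. x\<^sup>2"]) (auto simp: power_mult_distrib)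
  also have "\<dots> = \<sigma>\<^sup>2"
    using std_normal_integral_square by simp
  finally show "(\<integral>\<omega>. (Z \<omega>)\<^sup>2 \<partial>M) = \<sigma>\<^sup>2" .
qed

lemma normal_rv_cos_sin:
  "(\<integral>\<omega>. cos (Z \<omega>) \<partial>M) = exp (- \<sigma>\<^sup>2 / 2)" "(\<integral>\<omega>. sin (Z \<omega>) \<partial>M) = 0"
  by (simp_all add: normal_rv_integral[of cos] normal_rv_integral[of sin] std_normal_cos_sin)

lemma normal_rv_exp_square_le:
  assumes "4 * c * \<sigma>\<^sup>2 \<le> 1"
  shows "(\<integral>\<^sup>+\<omega>. ennreal (exp (c * (Z \<omega>)\<^sup>2)) \<partial>M) \<le> 2"
  by (subst normal_rv_nn_integral[of "\<lambda>x. ennreal (exp (c * x\<^sup>2))"])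
    (auto intro: std_normal_exp_square_le[OF assms])

end

text \<open>Markov's inequality for exp(c Z^2). \<open>Z\<close> is not assumed normal: the bound
  also serves for the variation of a path along a grid.\<close>

lemma nn_exp_square_tail:
  assumes [measurable]: "Z \<in> borel_measurable M"
    and le: "(\<integral>\<^sup>+\<omega>. ennreal (exp (c * (Z \<omega>)\<^sup>2)) \<partial>M) \<le> 2" and "c > 0" "z \<ge> 0"
  shows "emeasure M {\<omega>\<in>space M. \<bar>Z \<omega>\<bar> > z} \<le> ennreal (2 * exp (- c * z\<^sup>2))"
proof -
  have "emeasure M {\<omega>\<in>space M. \<bar>Z \<omega>\<bar> > z} = (\<integral>\<^sup>+\<omega>. indicator {\<omega>\<in>space M. \<bar>Z \<omega>\<bar> > z} \<omega> \<partial>M)"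
    by simp
  also have "\<dots> \<le> (\<integral>\<^sup>+\<omega>. ennreal (exp (- c * z\<^sup>2)) * ennreal (exp (c * (Z \<omega>)\<^sup>2)) \<partial>M)"
  proof (intro nn_integral_mono)
    fix \<omega> 
    show "indicator {\<omega>\<in>space M. \<bar>Z \<omega>\<bar> > z} \<omega> \<le> ennreal (exp (- c * z\<^sup>2)) * ennreal (exp (c * (Z \<omega>)\<^sup>2))"
    proof (cases "\<bar>Z \<omega>\<bar> > z")
      case True
      then have "z\<^sup>2 \<le> (Z \<omega>)\<^sup>2"
        using assms(4) by (metis abs_le_square_iff abs_of_nonneg less_imp_le)
      then have "1 \<le> exp (- c * z\<^sup>2) * exp (c * (Z \<omega>)\<^sup>2)"
        using \<open>c > 0\<close> by (simp flip: exp_add)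
      then show ?thesis
        by (simp add: indicator_def flip: ennreal_mult')
    qed (simp add: indicator_def)
  qed
  also have "\<dots> = ennreal (exp (- c * z\<^sup>2)) * (\<integral>\<^sup>+\<omega>. ennreal (exp (c * (Z \<omega>)\<^sup>2)) \<partial>M)"
    by (rule nn_integral_cmult) simp
  also have "\<dots> \<le> ennreal (exp (- c * z\<^sup>2)) * 2"
    by (intro mult_left_mono le) simp
  also have "\<dots> = ennreal (2 * exp (- c * z\<^sup>2))"
    by (simp add: ennreal_mult' mult.commute)
  finally show ?thesis .
qed

section \<open>Uniqueness of characteristic functions\<close>

text \<open>Adding a constant to \<open>K\<close> and rescaling gives a probability density, so Levy's theorem applies.\<close>
lemma (in prob_space) char_zero_imp_indicator_zero:
  fixes K Y :: "'a \<Rightarrow> real"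
  assumes [measurable]: "K \<in> borel_measurable M" "Y \<in> borel_measurable M"
    and K: "\<And>\<omega>. \<bar>K \<omega>\<bar> \<le> C"
    and cos0: "\<And>c. expectation (\<lambda>\<omega>. K \<omega> * cos (c * Y \<omega>)) = 0"
    and sin0: "\<And>c. expectation (\<lambda>\<omega>. K \<omega> * sin (c * Y \<omega>)) = 0"
    and B[measurable]: "B \<in> sets borel"
  shows "expectation (\<lambda>\<omega>. K \<omega> * indicator B (Y \<omega>)) = 0"
proof -
  \<comment> \<open>The summand 1 makes \<open>D\<close> positive, so one may divide by it, and
    \<bar>K\<bar> \<le> D puts \<open>f\<close> between 0 and 2.\<close>
  define D where "D = C + 1"
  have K': "\<bar>K \<omega>\<bar> \<le> D" and D: "D > 0" for \<omega>
    using K[of \<omega>] by (auto simp: D_def)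
  define f where "f = (\<lambda>\<omega>. (K \<omega> + D) / D)"
  have [measurable]: "f \<in> borel_measurable M" by (simp add: f_def)
  have f_nonneg: "f \<omega> \<ge> 0" and f_le: "f \<omega> \<le> 2" for \<omega>
    using K'[of \<omega>] D by (auto simp: f_def field_simps)
  have intK: "integrable M (\<lambda>\<omega>. K \<omega> * g \<omega>)"
    if [measurable]: "g \<in> borel_measurable M" and "\<And>\<omega>. \<bar>g \<omega>\<bar> \<le> 1" for g :: "'a \<Rightarrow> real"
  proof (rule integrable_const_bound[where B = "D * 1"])
    show "AE \<omega> in M. norm (K \<omega> * g \<omega>) \<le> D * 1"
      unfolding real_norm_def abs_mult
      by (intro AE_I2 mult_mono K' that) (use D in auto)
  qed simp
  have intg: "integrable M g"
    if [measurable]: "g \<in> borel_measurable M" and "\<And>\<omega>. \<bar>g \<omega>\<bar> \<le> 1" for g :: "'a \<Rightarrow> real"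
    by (rule integrable_const_bound[where B = 1]) (use that in auto)
  \<comment> \<open>A test function with E(K g) = 0 does not see the density \<open>f\<close>. The
    case g = 1, which is cos(0 Y), normalizes \<open>f\<close>; the cosines and sines give equal
    characteristic functions.\<close>
  have fg: "expectation (\<lambda>\<omega>. f \<omega> * g \<omega>) = expectation g"
    if "g \<in> borel_measurable M" "\<And>\<omega>. \<bar>g \<omega>\<bar> \<le> 1" "expectation (\<lambda>\<omega>. K \<omega> * g \<omega>) = 0"
    for g :: "'a \<Rightarrow> real"
  proof -
    have "(\<lambda>\<omega>. f \<omega> * g \<omega>) = (\<lambda>\<omega>. (1 / D) * (K \<omega> * g \<omega>) + g \<omega>)"
      using D by (auto simp: f_def field_simps)
    then show ?thesis
      using intK[of g] intg[of g] that by simp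
  qed
  define N where "N = density M f"
  have "expectation f = 1"
    using fg[of "\<lambda>_. 1"] cos0[of 0] by (simp add: prob_space)
  moreover have "integrable M f"
    by (rule integrable_const_bound[where B = 2]) (use f_nonneg f_le in auto)
  ultimately have "emeasure N (space N) = 1"
    using f_nonneg by (simp add: N_def emeasure_density nn_integral_eq_integral cong: nn_integral_cong)
  then interpret N: prob_space N by (rule prob_spaceI)
  have [measurable]: "Y \<in> borel_measurable N" by (simp add: N_def)
  have int_N: "integral\<^sup>L N g = expectation g"
    if [measurable]: "g \<in> borel_measurable M" and "\<And>\<omega>. \<bar>g \<omega>\<bar> \<le> 1" "expectation (\<lambda>\<omega>. K \<omega> * g \<omega>) = 0"
    for g :: "'a \<Rightarrow> real"
    using fg[of g] that f_nonneg by (simp add: N_def integral_density)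
  have char_eq: "char (distr N borel Y) t = char (distr M borel Y) t" for t
  proof -
    have *: "char (distr L borel Y) t =
        complex_of_real (\<integral>\<omega>. cos (t * Y \<omega>) \<partial>L) + \<i> * complex_of_real (\<integral>\<omega>. sin (t * Y \<omega>) \<partial>L)"
      if "prob_space L" and [measurable]: "Y \<in> borel_measurable L" for L
    proof -
      interpret L: prob_space L by fact
      have c: "integrable L (\<lambda>\<omega>. cos (t * Y \<omega>))" and s: "integrable L (\<lambda>\<omega>. sin (t * Y \<omega>))"
        by (rule L.integrable_const_bound[where B = 1]; simp)+
      have "char (distr L borel Y) t =
        (CLINT \<omega>|L. complex_of_real (cos (t * Y \<omega>)) + \<i> * complex_of_real (sin (t * Y \<omega>)))"
        unfolding char_def
        by (subst integral_distr)
          (auto simp: exp_Euler cos_of_real sin_of_real mult.assoc[symmetric] simp flip: of_real_mult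
            intro!: Bochner_Integration.integral_cong)
      then show ?thesis using c s by (simp add: integral_complex_of_real)
    qed
    show ?thesis
      using *[OF N.prob_space_axioms] *[OF prob_space_axioms]
        int_N[of "\<lambda>\<omega>. cos (t * Y \<omega>)"] int_N[of "\<lambda>\<omega>. sin (t * Y \<omega>)"] cos0[of t] sin0[of t]
      by simp
  qed
  have "distr N borel Y = distr M borel Y"
    by (rule Levy_uniqueness) (auto simp: char_eq)
  then have "measure (distr N borel Y) B = measure (distr M borel Y) B" by simp
  then have "integral\<^sup>L N (\<lambda>\<omega>. indicator B (Y \<omega>)) = expectation (\<lambda>\<omega>. indicator B (Y \<omega>) :: real)"
    by (simp add: measure_distr indicator_vimage[symmetric] N_def) 
  moreover have "integral\<^sup>L N (\<lambda>\<omega>. indicator B (Y \<omega>)) = expectation (\<lambda>\<omega>. f \<omega> * indicator B (Y \<omega>))"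
    using f_nonneg by (simp add: N_def integral_density)
  moreover have "expectation (\<lambda>\<omega>. f \<omega> * indicator B (Y \<omega>)) =
      (1 / D) * expectation (\<lambda>\<omega>. K \<omega> * indicator B (Y \<omega>)) + expectation (\<lambda>\<omega>. indicator B (Y \<omega>))"
  proof -
    have "(\<lambda>\<omega>. f \<omega> * indicator B (Y \<omega>)) =
        (\<lambda>\<omega>. (1 / D) * (K \<omega> * indicator B (Y \<omega>)) + indicator B (Y \<omega>))"
      using D by (auto simp: f_def field_simps)
    then show ?thesis
      using intK[of "\<lambda>\<omega>. indicator B (Y \<omega>)"] intg[of "\<lambda>\<omega>. indicator B (Y \<omega>)"]
      by (simp add: indicator_def)
  qed
  ultimately show ?thesis using D by simp
qed

text \<open>Coordinates are inverted one by one: once the characters of coordinate \<open>i\<close>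
  are replaced by an indicator, that indicator is absorbed into the weight \<open>H\<close>, which
  keeps the bound \<open>C\<close>, and the induction continues with the remaining
  coordinates.\<close>

lemma (in prob_space) char_zero_imp_prod_indicator_zero:
  fixes H :: "'a \<Rightarrow> real" and Y :: "'i \<Rightarrow> 'a \<Rightarrow> real"
  assumes "finite J"
    and "H \<in> borel_measurable M" and "\<And>\<omega>. \<bar>H \<omega>\<bar> \<le> C"
    and "\<And>j. j \<in> J \<Longrightarrow> Y j \<in> borel_measurable M"
    and "\<And>c. expectation (\<lambda>\<omega>. H \<omega> * cos (\<Sum>j\<in>J. c j * Y j \<omega>)) = 0"
    and "\<And>c. expectation (\<lambda>\<omega>. H \<omega> * sin (\<Sum>j\<in>J. c j * Y j \<omega>)) = 0"
    and "\<And>j. j \<in> J \<Longrightarrow> B j \<in> sets borel"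
  shows "expectation (\<lambda>\<omega>. H \<omega> * (\<Prod>j\<in>J. indicator (B j) (Y j \<omega>))) = 0"
  using assms
proof (induction J arbitrary: H rule: finite_induct)
  case empty
  \<comment> \<open>The empty combination is 0, so the cosine hypothesis already reads E H =
    0.\<close>
  then show ?case by (simp add: empty.prems(4)[of "\<lambda>_. 0", simplified])
next
  case (insert i J)
  have [measurable]: "H \<in> borel_measurable M" "Y i \<in> borel_measurable M" "B i \<in> sets borel"
    and [measurable]: "j \<in> J \<Longrightarrow> Y j \<in> borel_measurable M" for j
    using insert.prems by auto
  have intH: "integrable M (\<lambda>\<omega>. H \<omega> * g \<omega>)"
    if [measurable]: "g \<in> borel_measurable M" and "\<And>\<omega>. \<bar>g \<omega>\<bar> \<le> 1" for g :: "'a \<Rightarrow> real"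
  proof (rule integrable_const_bound[where B = "C * 1"])
    have "C \<ge> 0" using insert.prems(2)[of undefined] by linarith
    then show "AE \<omega> in M. norm (H \<omega> * g \<omega>) \<le> C * 1"
      unfolding real_norm_def abs_mult
      by (intro AE_I2 mult_mono insert.prems that) auto
  qed simp
  have ins: "(\<Sum>j\<in>insert i J. (c(i := x)) j * Y j \<omega>) = x * Y i \<omega> + (\<Sum>j\<in>J. c j * Y j \<omega>)" for c x \<omega>
    using insert.hyps by (auto intro!: sum.cong)
  define S where "S = (\<lambda>c \<omega>. \<Sum>j\<in>J. c j * Y j \<omega>)"
  have [measurable]: "S c \<in> borel_measurable M" for c
    by (simp add: S_def)
  have cos0: "expectation (\<lambda>\<omega>. H \<omega> * cos (x * Y i \<omega> + S c \<omega>)) = 0"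
    and sin0: "expectation (\<lambda>\<omega>. H \<omega> * sin (x * Y i \<omega> + S c \<omega>)) = 0" for x c
    using insert.prems(4)[of "c(i := x)"] insert.prems(5)[of "c(i := x)"] by (simp_all only: ins S_def)
  have int4: "integrable M (\<lambda>\<omega>. H \<omega> * cos (x * Y i \<omega> + S c \<omega>))"
      "integrable M (\<lambda>\<omega>. H \<omega> * sin (x * Y i \<omega> + S c \<omega>))" for x c
    by (intro intH; simp)+
  have combine: "expectation f = 0"
    if "\<And>\<omega>. f \<omega> = u * (H \<omega> * p \<omega>) + v * (H \<omega> * q \<omega>)"
      "expectation (\<lambda>\<omega>. H \<omega> * p \<omega>) = 0" "expectation (\<lambda>\<omega>. H \<omega> * q \<omega>) = 0"
      "integrable M (\<lambda>\<omega>. H \<omega> * p \<omega>)" "integrable M (\<lambda>\<omega>. H \<omega> * q \<omega>)"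
    for f p q :: "'a \<Rightarrow> real" and u v
  proof -
    have "f = (\<lambda>\<omega>. u * (H \<omega> * p \<omega>) + v * (H \<omega> * q \<omega>))" using that(1) by auto
    then show ?thesis using that(2-5) by simp
  qed
  \<comment> \<open>Replacing x by -x and adding or subtracting, the addition formulas turn the
    joint hypotheses into statements about the four products of a trigonometric function of
    \<open>Y i\<close> with one of the rest.\<close>
  have cc: "expectation (\<lambda>\<omega>. (H \<omega> * cos (S c \<omega>)) * cos (x * Y i \<omega>)) = 0" for c x
    by (rule combine[OF _ cos0 cos0 int4(1) int4(1), of _ "1/2" x c "1/2" "- x" c])
      (simp add: cos_add cos_diff field_simps)
  have cs: "expectation (\<lambda>\<omega>. (H \<omega> * cos (S c \<omega>)) * sin (x * Y i \<omega>)) = 0" for c x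
    by (rule combine[OF _ sin0 sin0 int4(2) int4(2), of _ "1/2" x c "-1/2" "- x" c])
      (simp add: sin_add sin_diff field_simps)
  have sc: "expectation (\<lambda>\<omega>. (H \<omega> * sin (S c \<omega>)) * cos (x * Y i \<omega>)) = 0" for c x
    by (rule combine[OF _ sin0 sin0 int4(2) int4(2), of _ "1/2" x c "1/2" "- x" c])
      (simp add: sin_add sin_diff field_simps)
  have ss: "expectation (\<lambda>\<omega>. (H \<omega> * sin (S c \<omega>)) * sin (x * Y i \<omega>)) = 0" for c x
    by (rule combine[OF _ cos0 cos0 int4(1) int4(1), of _ "-1/2" x c "1/2" "- x" c])
      (simp add: cos_add cos_diff field_simps)
  have bd: "\<bar>H \<omega> * g \<omega>\<bar> \<le> C" if "\<And>\<omega>. \<bar>g \<omega>\<bar> \<le> 1" for \<omega> and g :: "'a \<Rightarrow> real"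
    using mult_mono[OF insert.prems(2)[of \<omega>] that[of \<omega>]] insert.prems(2)[of \<omega>]
    by (simp add: abs_mult)
  have "expectation (\<lambda>\<omega>. (H \<omega> * indicator (B i) (Y i \<omega>)) * (\<Prod>j\<in>J. indicator (B j) (Y j \<omega>))) = 0"
  proof (rule insert.IH)
    show "expectation (\<lambda>\<omega>. H \<omega> * indicator (B i) (Y i \<omega>) * cos (\<Sum>j\<in>J. c j * Y j \<omega>)) = 0" for c
      using char_zero_imp_indicator_zero[of "\<lambda>\<omega>. H \<omega> * cos (S c \<omega>)" "Y i" C "B i"] cc cs
        bd[of "\<lambda>\<omega>. cos (S c \<omega>)"] by (simp add: S_def ac_simps)
    show "expectation (\<lambda>\<omega>. H \<omega> * indicator (B i) (Y i \<omega>) * sin (\<Sum>j\<in>J. c j * Y j \<omega>)) = 0" for c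
      using char_zero_imp_indicator_zero[of "\<lambda>\<omega>. H \<omega> * sin (S c \<omega>)" "Y i" C "B i"] sc ss
        bd[of "\<lambda>\<omega>. sin (S c \<omega>)"] by (simp add: S_def ac_simps)
    show "\<bar>H \<omega> * indicator (B i) (Y i \<omega>)\<bar> \<le> C" for \<omega>
      using bd[of "\<lambda>\<omega>. indicator (B i) (Y i \<omega>)"] by (simp add: indicator_def)
  qed (use insert.prems in auto)
  then show ?case
    using insert.hyps by (simp add: ac_simps)
qed

section \<open>Uncorrelated Gaussian families\<close>

locale centered_gaussian =
  fixes M :: "'w measure" and X :: "real \<Rightarrow> 'w \<Rightarrow> real"
  assumes gaussian: "gaussian_process M X" and centered: "centered M X"

sublocale centered_gaussian \<subseteq> prob_space M
  using gaussian by (simp add: gaussian_process_def)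

context centered_gaussian
begin

text \<open>Only finite combinations, with no closure in mean square: once the support of \<nu> is
  known to be finite, \<open>W\<close> and all residuals X_t - m(t) W belong to it.\<close>

definition lin_span :: "('w \<Rightarrow> real) set" where
  "lin_span = {Z. \<exists>T c. finite T \<and> Z = (\<lambda>\<omega>. \<Sum>t\<in>T. c t * X t \<omega>)}"

lemma X_measurable [measurable]: "X t \<in> borel_measurable M"
  using gaussian by (simp add: gaussian_process_def)

lemma lin_span_sum:
  assumes "finite T"
  shows "(\<lambda>\<omega>. \<Sum>t\<in>T. c t * X t \<omega>) \<in> lin_span"
  using assms by (auto simp: lin_span_def)

lemma X_in_lin_span: "X t \<in> lin_span"
  using lin_span_sum[of "{t}" "\<lambda>_. 1"] by simp

lemma lin_span_combine:
  assumes "Z \<in> lin_span" "Z' \<in> lin_span"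
  shows "(\<lambda>\<omega>. x * Z \<omega> + y * Z' \<omega>) \<in> lin_span"
proof -
  obtain T c T' c' where T: "finite T" "Z = (\<lambda>\<omega>. \<Sum>t\<in>T. c t * X t \<omega>)"
      "finite T'" "Z' = (\<lambda>\<omega>. \<Sum>t\<in>T'. c' t * X t \<omega>)"
    using assms by (auto simp: lin_span_def)
  define d where "d = (\<lambda>t. x * (if t \<in> T then c t else 0) + y * (if t \<in> T' then c' t else 0))"
  have "x * Z \<omega> + y * Z' \<omega> = (\<Sum>t\<in>T \<union> T'. d t * X t \<omega>)" for \<omega>
  proof -
    have "(\<Sum>t\<in>T. c t * X t \<omega>) = (\<Sum>t\<in>T \<union> T'. (if t \<in> T then c t else 0) * X t \<omega>)"
      and "(\<Sum>t\<in>T'. c' t * X t \<omega>) = (\<Sum>t\<in>T \<union> T'. (if t \<in> T' then c' t else 0) * X t \<omega>)"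
      using T by (auto intro!: sum.mono_neutral_cong_left)
    then show ?thesis
      by (simp add: T d_def sum_distrib_left algebra_simps sum.distrib)
  qed
  then have "(\<lambda>\<omega>. x * Z \<omega> + y * Z' \<omega>) = (\<lambda>\<omega>. \<Sum>t\<in>T \<union> T'. d t * X t \<omega>)" by auto
  then show ?thesis using lin_span_sum[of "T \<union> T'" d] T by simp
qed

lemma lin_span_diff: "Z \<in> lin_span \<Longrightarrow> Z' \<in> lin_span \<Longrightarrow> (\<lambda>\<omega>. Z \<omega> - Z' \<omega>) \<in> lin_span"
  using lin_span_combine[of Z Z' 1 "-1"] by simp

lemma lin_span_scale: "Z \<in> lin_span \<Longrightarrow> (\<lambda>\<omega>. x * Z \<omega>) \<in> lin_span"
  using lin_span_combine[of Z Z x 0] by simp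

lemma lin_span_zero: "(\<lambda>\<omega>. 0) \<in> lin_span"
  using lin_span_sum[of "{}"] by simp

lemma lin_span_sum_fun:
  assumes "finite J" "\<And>j. j \<in> J \<Longrightarrow> Y j \<in> lin_span"
  shows "(\<lambda>\<omega>. \<Sum>j\<in>J. c j * Y j \<omega>) \<in> lin_span"
  using assms
proof (induction J rule: finite_induct)
  case (insert i J)
  then show ?case
    using lin_span_combine[of "Y i" "\<lambda>\<omega>. \<Sum>j\<in>J. c j * Y j \<omega>" "c i" 1] by simp
qed (simp add: lin_span_zero)

lemma lin_span_measurable: "Z \<in> lin_span \<Longrightarrow> Z \<in> borel_measurable M"
  by (auto simp: lin_span_def)

lemma lin_span_affine_law:
  assumes "Z \<in> lin_span"
  obtains m \<sigma> where "\<sigma> \<ge> 0" "distr M borel Z = distr std_normal_distribution borel (\<lambda>x. m + \<sigma> * x)"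
proof -
  obtain T c where T: "finite T" "Z = (\<lambda>\<omega>. \<Sum>t\<in>T. c t * X t \<omega>)"
    using assms by (auto simp: lin_span_def)
  then obtain m \<sigma> where "\<sigma> \<ge> 0" "distr M borel Z = gaussian_measure m \<sigma>"
    using gaussian unfolding gaussian_process_def by metis
  then show ?thesis using that gaussian_measure_eq_distr by metis
qed

lemma lin_span_integrable:
  assumes "Z \<in> lin_span"
  shows "integrable M Z"
proof -
  obtain m \<sigma> where "distr M borel Z = distr std_normal_distribution borel (\<lambda>x. m + \<sigma> * x)"
    using lin_span_affine_law[OF assms] .
  moreover have "integrable (distr std_normal_distribution borel (\<lambda>x. m + \<sigma> * x)) (\<lambda>x. x)"
  proof (subst integrable_distr_eq)
    interpret N: prob_space std_normal_distribution by simp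
    show "integrable std_normal_distribution (\<lambda>x. m + \<sigma> * x)"
      by (intro Bochner_Integration.integrable_add integrable_mult_right std_normal_integrable_id) simp
  qed auto
  ultimately have "integrable (distr M borel Z) (\<lambda>x. x)" by simp
  then show ?thesis
    by (subst (asm) integrable_distr_eq) (use lin_span_measurable[OF assms] in auto)
qed

lemma lin_span_mean:
  assumes "Z \<in> lin_span"
  shows "expectation Z = 0"
proof -
  obtain T c where T: "finite T" "Z = (\<lambda>\<omega>. \<Sum>t\<in>T. c t * X t \<omega>)"
    using assms by (auto simp: lin_span_def)
  have "expectation (X t) = 0" for t
    using centered by (simp add: centered_def)
  then show ?thesis
    using T lin_span_integrable[OF X_in_lin_span] by simp
qed

text \<open>Centering forces the affine law to have mean 0, and its scale is then the root of the
  second moment. So the law of an element of the span depends on its second moment alone.\<close>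

lemma lin_span_normal_rv:
  assumes "Z \<in> lin_span"
  shows "normal_rv M (sqrt (expectation (\<lambda>\<omega>. (Z \<omega>)\<^sup>2))) Z"
proof -
  obtain m \<sigma> where s: "\<sigma> \<ge> 0" and
    Z: "distr M borel Z = distr std_normal_distribution borel (\<lambda>x. m + \<sigma> * x)"
    using lin_span_affine_law[OF assms] .
  note [measurable] = lin_span_measurable[OF assms]
  interpret N: prob_space std_normal_distribution by simp
  have "expectation Z = integral\<^sup>L (distr M borel Z) (\<lambda>x. x)"
    by (subst integral_distr) auto
  also have "\<dots> = (\<integral>x. m + \<sigma> * x \<partial>std_normal_distribution)"
    unfolding Z by (subst integral_distr) auto
  also have "\<dots> = m"
    using std_normal_integrable_id std_normal_integral_id N.prob_space by simp
  finally have "m = 0" using lin_span_mean[OF assms] by simp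
  then have n: "normal_rv M \<sigma> Z" using Z by (simp add: normal_rv_def)
  then show ?thesis using normal_rv_moments(4)[OF n] s by simp
qed

lemma lin_span_square_integrable: "Z \<in> lin_span \<Longrightarrow> integrable M (\<lambda>\<omega>. (Z \<omega>)\<^sup>2)"
  by (rule normal_rv_moments(3)[OF lin_span_normal_rv])

lemma lin_span_mult_integrable:
  assumes "Z \<in> lin_span" "Z' \<in> lin_span"
  shows "integrable M (\<lambda>\<omega>. Z \<omega> * Z' \<omega>)"
proof -
  have "(\<lambda>\<omega>. Z \<omega> * Z' \<omega>) = (\<lambda>\<omega>. (1/4) * ((1 * Z \<omega> + 1 * Z' \<omega>)\<^sup>2 - (Z \<omega> - Z' \<omega>)\<^sup>2))"
    by (auto simp: power2_eq_square algebra_simps)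
  then show ?thesis
    using lin_span_square_integrable[OF lin_span_combine[OF assms, of 1 1]]
      lin_span_square_integrable[OF lin_span_diff[OF assms]] by simp
qed

lemma lin_span_cos_sin:
  assumes "Z \<in> lin_span"
  shows "expectation (\<lambda>\<omega>. cos (Z \<omega>)) = exp (- expectation (\<lambda>\<omega>. (Z \<omega>)\<^sup>2) / 2)"
    "expectation (\<lambda>\<omega>. sin (Z \<omega>)) = 0"
  using normal_rv_cos_sin[OF lin_span_normal_rv[OF assms]] by simp_all

lemma lin_span_second_moment:
  assumes "Z \<in> lin_span" "Z' \<in> lin_span"
  shows "expectation (\<lambda>\<omega>. (x * Z \<omega> + y * Z' \<omega>)\<^sup>2) =
    x\<^sup>2 * expectation (\<lambda>\<omega>. (Z \<omega>)\<^sup>2) + 2 * x * y * expectation (\<lambda>\<omega>. Z \<omega> * Z' \<omega>)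
      + y\<^sup>2 * expectation (\<lambda>\<omega>. (Z' \<omega>)\<^sup>2)"
proof -
  have "(\<lambda>\<omega>. (x * Z \<omega> + y * Z' \<omega>)\<^sup>2) =
      (\<lambda>\<omega>. x\<^sup>2 * (Z \<omega>)\<^sup>2 + 2 * x * y * (Z \<omega> * Z' \<omega>) + y\<^sup>2 * (Z' \<omega>)\<^sup>2)"
    by (auto simp: power2_eq_square algebra_simps)
  then show ?thesis
    using lin_span_square_integrable[OF assms(1)] lin_span_square_integrable[OF assms(2)]
      lin_span_mult_integrable[OF assms] by simp
qed

text \<open>Zero correlation gives Z + x W and Z - x W the same second moment v + w. The products of
  cosines and sines are half sums or differences of characters of these two, hence factor or
  vanish.\<close>

lemma uncorrelated_imp_indep_cos:
  assumes Z: "Z \<in> lin_span" and W: "W \<in> lin_span" and orth: "expectation (\<lambda>\<omega>. Z \<omega> * W \<omega>) = 0"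
  shows "expectation (\<lambda>\<omega>. cos (Z \<omega>) * cos (x * W \<omega>)) =
      expectation (\<lambda>\<omega>. cos (Z \<omega>)) * expectation (\<lambda>\<omega>. cos (x * W \<omega>))"
    "expectation (\<lambda>\<omega>. cos (Z \<omega>) * sin (x * W \<omega>)) = 0"
    "expectation (\<lambda>\<omega>. sin (Z \<omega>) * cos (x * W \<omega>)) = 0"
    "expectation (\<lambda>\<omega>. sin (Z \<omega>) * sin (x * W \<omega>)) = 0"
proof -
  note [measurable] = lin_span_measurable[OF Z] lin_span_measurable[OF W]
  define p where "p = (\<lambda>\<omega>. 1 * Z \<omega> + x * W \<omega>)"
  define q where "q = (\<lambda>\<omega>. 1 * Z \<omega> + (- x) * W \<omega>)"
  have pq: "p \<in> lin_span" "q \<in> lin_span"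
    unfolding p_def q_def by (intro lin_span_combine Z W)+
  note [measurable] = lin_span_measurable[OF pq(1)] lin_span_measurable[OF pq(2)]
  define v where "v = expectation (\<lambda>\<omega>. (Z \<omega>)\<^sup>2)"
  define w where "w = expectation (\<lambda>\<omega>. (x * W \<omega>)\<^sup>2)"
  have w: "w = x\<^sup>2 * expectation (\<lambda>\<omega>. (W \<omega>)\<^sup>2)"
    by (simp add: w_def power_mult_distrib)
  have "expectation (\<lambda>\<omega>. (p \<omega>)\<^sup>2) = v + w" "expectation (\<lambda>\<omega>. (q \<omega>)\<^sup>2) = v + w"
    unfolding p_def q_def lin_span_second_moment[OF Z W] using orth by (simp_all add: w v_def)
  then have e: "expectation (\<lambda>\<omega>. cos (p \<omega>)) = exp (- v / 2) * exp (- w / 2)"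
      "expectation (\<lambda>\<omega>. cos (q \<omega>)) = exp (- v / 2) * exp (- w / 2)"
      "expectation (\<lambda>\<omega>. sin (p \<omega>)) = 0" "expectation (\<lambda>\<omega>. sin (q \<omega>)) = 0"
    using lin_span_cos_sin[OF pq(1)] lin_span_cos_sin[OF pq(2)]
    by (simp_all add: exp_add[symmetric] add_divide_distrib)
  have i: "integrable M (\<lambda>\<omega>. cos (p \<omega>))" "integrable M (\<lambda>\<omega>. cos (q \<omega>))"
      "integrable M (\<lambda>\<omega>. sin (p \<omega>))" "integrable M (\<lambda>\<omega>. sin (q \<omega>))"
    by (rule integrable_const_bound[where B = 1]; simp)+
  have cc: "(\<lambda>\<omega>. cos (Z \<omega>) * cos (x * W \<omega>)) = (\<lambda>\<omega>. 1/2 * cos (p \<omega>) + 1/2 * cos (q \<omega>))"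
    and cs: "(\<lambda>\<omega>. cos (Z \<omega>) * sin (x * W \<omega>)) = (\<lambda>\<omega>. 1/2 * sin (p \<omega>) - 1/2 * sin (q \<omega>))"
    and sc: "(\<lambda>\<omega>. sin (Z \<omega>) * cos (x * W \<omega>)) = (\<lambda>\<omega>. 1/2 * sin (p \<omega>) + 1/2 * sin (q \<omega>))"
    and ss: "(\<lambda>\<omega>. sin (Z \<omega>) * sin (x * W \<omega>)) = (\<lambda>\<omega>. 1/2 * cos (q \<omega>) - 1/2 * cos (p \<omega>))"
    by (auto simp: p_def q_def cos_add cos_diff sin_add sin_diff field_simps)
  show "expectation (\<lambda>\<omega>. cos (Z \<omega>) * cos (x * W \<omega>)) =
      expectation (\<lambda>\<omega>. cos (Z \<omega>)) * expectation (\<lambda>\<omega>. cos (x * W \<omega>))"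
    using lin_span_cos_sin(1)[OF Z] lin_span_cos_sin(1)[OF lin_span_scale[OF W, of x]] i e
    unfolding cc by (simp add: v_def w_def)
  show "expectation (\<lambda>\<omega>. cos (Z \<omega>) * sin (x * W \<omega>)) = 0"
    "expectation (\<lambda>\<omega>. sin (Z \<omega>) * cos (x * W \<omega>)) = 0"
    "expectation (\<lambda>\<omega>. sin (Z \<omega>) * sin (x * W \<omega>)) = 0"
    unfolding cs sc ss using i e by simp_all
qed

text \<open>Inversion is done twice. With a cosine or sine of a combination of the
  \<open>Y j\<close> held fixed, the factorization passes from characters of \<open>W\<close> to the
  indicator of \<open>A\<close>; with the centered indicator \<open>H\<close> of W \<in> A held
  fixed, it then passes from characters of the combinations to indicators of boxes.\<close>

lemma uncorrelated_imp_indep_finite: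
  assumes W: "W \<in> lin_span" and J: "finite J" and Y: "\<And>j. j \<in> J \<Longrightarrow> Y j \<in> lin_span"
    and orth: "\<And>j. j \<in> J \<Longrightarrow> expectation (\<lambda>\<omega>. Y j \<omega> * W \<omega>) = 0"
    and A: "A \<in> sets borel" and B: "\<And>j. j \<in> J \<Longrightarrow> B j \<in> sets borel"
  shows "prob {\<omega>\<in>space M. W \<omega> \<in> A \<and> (\<forall>j\<in>J. Y j \<omega> \<in> B j)} =
    prob {\<omega>\<in>space M. W \<omega> \<in> A} * prob {\<omega>\<in>space M. \<forall>j\<in>J. Y j \<omega> \<in> B j}"
proof -
  note [measurable] = lin_span_measurable[OF W] lin_span_measurable[OF Y] A B
  define S where "S = (\<lambda>c \<omega>. \<Sum>j\<in>J. c j * Y j \<omega>)"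
  have S: "S c \<in> lin_span" for c
    unfolding S_def by (rule lin_span_sum_fun[OF J Y])
  note [measurable] = lin_span_measurable[OF S]
  have orthS: "expectation (\<lambda>\<omega>. S c \<omega> * W \<omega>) = 0" for c
  proof -
    have "(\<lambda>\<omega>. S c \<omega> * W \<omega>) = (\<lambda>\<omega>. \<Sum>j\<in>J. c j * (Y j \<omega> * W \<omega>))"
      by (auto simp: S_def sum_distrib_right mult.assoc)
    then show ?thesis
      using orth lin_span_mult_integrable[OF Y W] by simp
  qed
  define H where "H = (\<lambda>\<omega>. indicator A (W \<omega>) - prob {\<omega>\<in>space M. W \<omega> \<in> A})"
  have [measurable]: "H \<in> borel_measurable M" by (simp add: H_def)
  have bnd: "integrable M f" if [measurable]: "f \<in> borel_measurable M" and "\<And>\<omega>. \<bar>f \<omega>\<bar> \<le> 1" for f :: "'w \<Rightarrow> real"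
    by (rule integrable_const_bound[where B = 1]) (use that in auto)
  have EA: "expectation (\<lambda>\<omega>. indicator A (W \<omega>) :: real) = prob {\<omega>\<in>space M. W \<omega> \<in> A}"
  proof -
    have "expectation (\<lambda>\<omega>. indicator A (W \<omega>) :: real) = expectation (indicator {\<omega>\<in>space M. W \<omega> \<in> A})"
      by (intro Bochner_Integration.integral_cong) (auto simp: indicator_def)
    then show ?thesis by simp
  qed
  have key: "expectation (\<lambda>\<omega>. H \<omega> * f \<omega>) = 0"
    if [measurable]: "f \<in> borel_measurable M" and f1: "\<And>\<omega>. \<bar>f \<omega>\<bar> \<le> 1"
      and c: "\<And>x. expectation (\<lambda>\<omega>. f \<omega> * cos (x * W \<omega>)) = expectation f * expectation (\<lambda>\<omega>. cos (x * W \<omega>))"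
      and s: "\<And>x. expectation (\<lambda>\<omega>. f \<omega> * sin (x * W \<omega>)) = 0" for f :: "'w \<Rightarrow> real"
  proof -
    \<comment> \<open>Subtracting its mean from \<open>f\<close> turns the factorization into
      vanishing integrals against the characters of \<open>W\<close>; for the sines this uses that
      sin(c W) has mean 0.\<close>
    define K where "K = (\<lambda>\<omega>. f \<omega> - expectation f)"
    have Ef: "\<bar>expectation f\<bar> \<le> 1"
    proof -
      have "\<bar>expectation f\<bar> \<le> expectation (\<lambda>\<omega>. \<bar>f \<omega>\<bar>)" by (rule integral_abs_bound)
      also have "\<dots> \<le> expectation (\<lambda>_. 1)"
        by (intro integral_mono integrable_abs bnd f1) auto
      finally show ?thesis by (simp add: prob_space)
    qed
    have fm: "integrable M (\<lambda>\<omega>. f \<omega> * g \<omega>)"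
      if [measurable]: "g \<in> borel_measurable M" and g: "\<And>\<omega>. \<bar>g \<omega>\<bar> \<le> 1" for g :: "'w \<Rightarrow> real"
    proof (rule bnd)
      show "\<bar>f \<omega> * g \<omega>\<bar> \<le> 1" for \<omega>
        using mult_mono[OF f1 g, of \<omega> \<omega>] by (simp add: abs_mult)
    qed simp
    have EK: "expectation (\<lambda>\<omega>. K \<omega> * g \<omega>) = expectation (\<lambda>\<omega>. f \<omega> * g \<omega>) - expectation f * expectation g"
      if "g \<in> borel_measurable M" and "\<And>\<omega>. \<bar>g \<omega>\<bar> \<le> 1" for g :: "'w \<Rightarrow> real"
      using fm[OF that] bnd[OF that] by (simp add: K_def left_diff_distrib)
    have "expectation (\<lambda>\<omega>. K \<omega> * indicator A (W \<omega>)) = 0"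
    proof (rule char_zero_imp_indicator_zero[where C = 2])
      show "\<bar>K \<omega>\<bar> \<le> 2" for \<omega> using f1[of \<omega>] Ef by (auto simp: K_def abs_le_iff)
      show "expectation (\<lambda>\<omega>. K \<omega> * cos (c * W \<omega>)) = 0" for c
        by (subst EK) (auto simp: c)
      show "expectation (\<lambda>\<omega>. K \<omega> * sin (c * W \<omega>)) = 0" for c
        using lin_span_cos_sin(2)[OF lin_span_scale[OF W, of c]] by (subst EK) (auto simp: s)
    qed (simp_all add: K_def)
    then have "expectation (\<lambda>\<omega>. f \<omega> * indicator A (W \<omega>)) = expectation f * prob {\<omega>\<in>space M. W \<omega> \<in> A}"
      using EK[of "\<lambda>\<omega>. indicator A (W \<omega>)"] EA by (simp add: indicator_def)
    moreover have "expectation (\<lambda>\<omega>. H \<omega> * f \<omega>) =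
        expectation (\<lambda>\<omega>. f \<omega> * indicator A (W \<omega>)) - prob {\<omega>\<in>space M. W \<omega> \<in> A} * expectation f"
      using fm[of "\<lambda>\<omega>. indicator A (W \<omega>)"] bnd[of f] f1
      by (simp add: H_def left_diff_distrib mult.commute[of "indicator _ _"])
    ultimately show ?thesis by simp
  qed
  have "expectation (\<lambda>\<omega>. H \<omega> * (\<Prod>j\<in>J. indicator (B j) (Y j \<omega>))) = 0"
  proof (rule char_zero_imp_prod_indicator_zero[OF J, where C = 1])
    show "\<bar>H \<omega>\<bar> \<le> 1" for \<omega>
      by (auto simp: H_def indicator_def)
    show "expectation (\<lambda>\<omega>. H \<omega> * cos (\<Sum>j\<in>J. c j * Y j \<omega>)) = 0" for c
      using key[of "\<lambda>\<omega>. cos (S c \<omega>)"] uncorrelated_imp_indep_cos(1,2)[OF S[of c] W orthS] by (simp add: S_def)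
    show "expectation (\<lambda>\<omega>. H \<omega> * sin (\<Sum>j\<in>J. c j * Y j \<omega>)) = 0" for c
      using key[of "\<lambda>\<omega>. sin (S c \<omega>)"] uncorrelated_imp_indep_cos(3,4)[OF S[of c] W orthS]
        lin_span_cos_sin(2)[OF S[of c]] by (simp add: S_def)
  qed simp_all
  moreover have "(\<Prod>j\<in>J. indicator (B j) (Y j \<omega>) :: real) = indicator {\<omega>\<in>space M. \<forall>j\<in>J. Y j \<omega> \<in> B j} \<omega>"
    if "\<omega> \<in> space M" for \<omega>
    using that J by (cases "\<forall>j\<in>J. Y j \<omega> \<in> B j") (auto simp: indicator_def intro!: prod_zero)
  ultimately have *: "expectation (\<lambda>\<omega>. H \<omega> * indicator {\<omega>\<in>space M. \<forall>j\<in>J. Y j \<omega> \<in> B j} \<omega>) = 0"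
    by (simp cong: Bochner_Integration.integral_cong)
  have [measurable]: "{\<omega>\<in>space M. \<forall>j\<in>J. Y j \<omega> \<in> B j} \<in> sets M" "{\<omega>\<in>space M. W \<omega> \<in> A} \<in> sets M"
      "{\<omega>\<in>space M. W \<omega> \<in> A \<and> (\<forall>j\<in>J. Y j \<omega> \<in> B j)} \<in> sets M"
    using J by measurable
  have "expectation (\<lambda>\<omega>. H \<omega> * indicator {\<omega>\<in>space M. \<forall>j\<in>J. Y j \<omega> \<in> B j} \<omega>) =
    expectation (\<lambda>\<omega>. indicator {\<omega>\<in>space M. W \<omega> \<in> A \<and> (\<forall>j\<in>J. Y j \<omega> \<in> B j)} \<omega>
       - prob {\<omega>\<in>space M. W \<omega> \<in> A} * indicator {\<omega>\<in>space M. \<forall>j\<in>J. Y j \<omega> \<in> B j} \<omega>)"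
    by (intro Bochner_Integration.integral_cong) (auto simp: H_def indicator_def)
  also have "\<dots> = prob {\<omega>\<in>space M. W \<omega> \<in> A \<and> (\<forall>j\<in>J. Y j \<omega> \<in> B j)} -
    prob {\<omega>\<in>space M. W \<omega> \<in> A} * prob {\<omega>\<in>space M. \<forall>j\<in>J. Y j \<omega> \<in> B j}"
    by (subst Bochner_Integration.integral_diff) (auto simp: bnd)
  finally show ?thesis using * by simp
qed

text \<open>\<open>I\<close> may be infinite. A finite measure on the product is determined by
  cylinders over finitely many indices, so the finite case suffices, first for a fixed set
  \<open>A\<close> of values of \<open>W\<close>, then on rectangles.\<close>

lemma uncorrelated_joint_law:
  assumes W: "W \<in> lin_span" and Y: "\<And>j. j \<in> I \<Longrightarrow> Y j \<in> lin_span"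
    and orth: "\<And>j. j \<in> I \<Longrightarrow> expectation (\<lambda>\<omega>. Y j \<omega> * W \<omega>) = 0"
  shows "distr M (borel \<Otimes>\<^sub>M (\<Pi>\<^sub>M i\<in>I. borel)) (\<lambda>\<omega>. (W \<omega>, \<lambda>i\<in>I. Y i \<omega>)) =
    distr M borel W \<Otimes>\<^sub>M distr M (\<Pi>\<^sub>M i\<in>I. borel) (\<lambda>\<omega>. \<lambda>i\<in>I. Y i \<omega>)"
proof -
  note [measurable] = lin_span_measurable[OF W] lin_span_measurable[OF Y]
  define P where "P = (\<Pi>\<^sub>M i\<in>I. borel :: real measure)"
  define V where "V = (\<lambda>\<omega>. \<lambda>i\<in>I. Y i \<omega>)"
  have V[measurable]: "V \<in> measurable M P"
    unfolding V_def P_def by measurable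
  have rect: "emeasure M {\<omega>\<in>space M. W \<omega> \<in> A \<and> V \<omega> \<in> C} =
      emeasure M {\<omega>\<in>space M. W \<omega> \<in> A} * emeasure M {\<omega>\<in>space M. V \<omega> \<in> C}"
    if A[measurable]: "A \<in> sets borel" and C: "C \<in> sets P" for A C
  proof -
    \<comment> \<open>\<open>N1\<close> is the law of \<open>V\<close> restricted to the event W
      \<in> A, \<open>N2\<close> is the law of \<open>V\<close> scaled by the probability of that
      event. Independence is their equality, tested on cylinders.\<close>
    define N1 where "N1 = distr (density M (\<lambda>\<omega>. indicator A (W \<omega>))) P V"
    define N2 where "N2 = distr (density M (\<lambda>\<omega>. ennreal (prob {\<omega>\<in>space M. W \<omega> \<in> A}))) P V"
    have N1: "emeasure N1 C = emeasure M {\<omega>\<in>space M. W \<omega> \<in> A \<and> V \<omega> \<in> C}" if [measurable]: "C \<in> sets P" for C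
    proof -
      have "emeasure N1 C = (\<integral>\<^sup>+\<omega>. indicator A (W \<omega>) * indicator (V -` C \<inter> space M) \<omega> \<partial>M)"
        unfolding N1_def by (subst emeasure_distr) (auto simp: emeasure_density)
      also have "\<dots> = (\<integral>\<^sup>+\<omega>. indicator {\<omega>\<in>space M. W \<omega> \<in> A \<and> V \<omega> \<in> C} \<omega> \<partial>M)"
        by (intro nn_integral_cong) (auto simp: indicator_def)
      finally show ?thesis by simp
    qed
    have N2: "emeasure N2 C = emeasure M {\<omega>\<in>space M. W \<omega> \<in> A} * emeasure M {\<omega>\<in>space M. V \<omega> \<in> C}"
      if [measurable]: "C \<in> sets P" for C
    proof -
      have "emeasure N2 C = (\<integral>\<^sup>+\<omega>. ennreal (prob {\<omega>\<in>space M. W \<omega> \<in> A}) * indicator (V -` C \<inter> space M) \<omega> \<partial>M)"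
        unfolding N2_def by (subst emeasure_distr) (auto simp: emeasure_density)
      also have "\<dots> = ennreal (prob {\<omega>\<in>space M. W \<omega> \<in> A}) * emeasure M (V -` C \<inter> space M)"
        by (simp add: nn_integral_cmult_indicator)
      finally show ?thesis by (simp add: emeasure_eq_measure vimage_def Int_def conj_commute)
    qed
    have "N1 = N2"
    proof (rule measure_eqI_PiM_infinite)
      show "sets N1 = sets (\<Pi>\<^sub>M i\<in>I. borel)" "sets N2 = sets (\<Pi>\<^sub>M i\<in>I. borel)"
        by (simp_all add: N1_def N2_def P_def)
      show "finite_measure N1"
      proof
        have "space P \<in> sets P" by simp
        then have "emeasure N1 (space P) \<noteq> \<infinity>" by (simp only: N1) (simp add: emeasure_eq_measure)
        then show "emeasure N1 (space N1) \<noteq> \<infinity>" by (simp add: N1_def)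
      qed
    next
      fix J B assume J: "finite J" "J \<subseteq> I" and B: "\<And>i. i \<in> J \<Longrightarrow> B i \<in> sets (borel :: real measure)"
      let ?C = "prod_emb I (\<lambda>_. borel :: real measure) J (Pi\<^sub>E J B)"
      have C: "?C \<in> sets P"
        unfolding P_def using J B by (intro sets_PiM_I) auto
      have "V \<omega> \<in> ?C \<longleftrightarrow> (\<forall>j\<in>J. Y j \<omega> \<in> B j)" for \<omega>
        using J by (auto simp: V_def prod_emb_iff restrict_def PiE_iff extensional_def) 
      then show "emeasure N1 ?C = emeasure N2 ?C"
        unfolding N1[OF C] N2[OF C] emeasure_eq_measure
        using uncorrelated_imp_indep_finite[OF W J(1) Y orth A B] J
        by (simp add: subset_eq flip: ennreal_mult)
    qed
    then show ?thesis using N1[OF C] N2[OF C] by simp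
  qed
  interpret DW: prob_space "distr M borel W" by (rule prob_space_distr) simp
  interpret DV: prob_space "distr M P V" by (rule prob_space_distr) simp
  have "distr M borel W \<Otimes>\<^sub>M distr M P V = distr M (borel \<Otimes>\<^sub>M P) (\<lambda>\<omega>. (W \<omega>, V \<omega>))"
  proof (rule pair_measure_eqI)
    show "sigma_finite_measure (distr M borel W)" "sigma_finite_measure (distr M P V)" by unfold_locales
    fix A C assume "A \<in> sets (distr M borel W)" "C \<in> sets (distr M P V)"
    then have [measurable]: "A \<in> sets borel" "C \<in> sets P" by simp_all
    show "emeasure (distr M borel W) A * emeasure (distr M P V) C =
        emeasure (distr M (borel \<Otimes>\<^sub>M P) (\<lambda>\<omega>. (W \<omega>, V \<omega>))) (A \<times> C)"
      using rect[of A C]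
      by (simp add: emeasure_distr vimage_def Int_def conj_commute)
  qed (simp cong: sets_pair_measure_cong)
  then show ?thesis by (simp add: P_def V_def)
qed

end

section \<open>Translation of the normal law\<close>

text \<open>The Cameron-Martin formula on the line: the density factor of a translation has an
  exponent that is affine in w.\<close>

lemma normal_density_shift:
  assumes "V > 0"
  shows "normal_density 0 (sqrt V) w =
    normal_density 0 (sqrt V) (w + c) * exp ((2 * w * c + c\<^sup>2) / (2 * V))"
proof -
  have "- (w\<^sup>2) / (2 * V) = - ((w + c)\<^sup>2) / (2 * V) + (2 * w * c + c\<^sup>2) / (2 * V)"
    using assms by (simp add: power2_eq_square field_simps)
  then have "exp (- (w\<^sup>2) / (2 * V)) = exp (- ((w + c)\<^sup>2) / (2 * V)) * exp ((2 * w * c + c\<^sup>2) / (2 * V))"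
    by (simp only: exp_add)
  then show ?thesis using assms by (simp add: normal_density_def)
qed

text \<open>Ensures that the constants \<open>p\<close> in \<open>lin_span_tail_ge\<close> and
  \<open>increments_L2_Lipschitz\<close> are positive.\<close>

lemma normal_interval_nonzero:
  fixes \<sigma> x y :: real
  assumes "\<sigma> > 0" "x < y"
  shows "emeasure (density lborel (normal_density \<mu> \<sigma>)) {x<..<y} \<noteq> 0"
proof
  assume "emeasure (density lborel (normal_density \<mu> \<sigma>)) {x<..<y} = 0"
  then have "(\<integral>\<^sup>+z. ennreal (normal_density \<mu> \<sigma> z) * indicator {x<..<y} z \<partial>lborel) = 0"
    by (simp add: emeasure_density)
  then have "AE z in lborel. ennreal (normal_density \<mu> \<sigma> z) * indicator {x<..<y} z = 0"
    by (subst (asm) nn_integral_0_iff_AE) auto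
  then have "AE z in lborel. z \<notin> {x<..<y}"
    by eventually_elim (use normal_density_pos[of \<sigma> \<mu>] assms in
      \<open>auto simp: indicator_def not_le[symmetric] ennreal_eq_0_iff split: if_splits\<close>)
  then have "emeasure lborel {x<..<y} = 0"
    by (subst (asm) AE_iff_measurable[where N = "{x<..<y}"]) auto
  then show False using assms by simp
qed

text \<open>After the substitution of w + c for w the densities differ by exp((2wc + c^2)/(2V)). An
  upper bound of this exponent on \<open>A\<close> alone is enough, so one inequality yields upper
  tails, lower tails and both comparisons of high minima.\<close>

lemma normal_shift_le:
  assumes V: "V > 0" and [measurable]: "A \<in> sets borel" "A' \<in> sets borel"
    and AA': "\<And>w. w \<in> A \<Longrightarrow> w + c \<in> A'"
    and k: "\<And>w. w \<in> A \<Longrightarrow> (2 * w * c + c\<^sup>2) / (2 * V) \<le> k"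
  shows "emeasure (density lborel (normal_density 0 (sqrt V))) A \<le>
    ennreal (exp k) * emeasure (density lborel (normal_density 0 (sqrt V))) A'"
proof -
  let ?\<phi> = "normal_density 0 (sqrt V)"
  have "emeasure (density lborel ?\<phi>) A = (\<integral>\<^sup>+w. ennreal (?\<phi> w) * indicator A w \<partial>lborel)"
    by (rule emeasure_density) auto
  also have "\<dots> \<le> (\<integral>\<^sup>+w. ennreal (exp k) * (ennreal (?\<phi> (c + w)) * indicator A' (c + w)) \<partial>lborel)"
  proof (intro nn_integral_mono)
    fix w
    show "ennreal (?\<phi> w) * indicator A w \<le> ennreal (exp k) * (ennreal (?\<phi> (c + w)) * indicator A' (c + w))"
    proof (cases "w \<in> A")
      case True
      have "?\<phi> w \<le> ?\<phi> (c + w) * exp k"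
        unfolding normal_density_shift[OF V, of w c]
        using k[OF True] by (intro mult_mono) (auto simp: add.commute normal_density_nonneg)
      then show ?thesis
        using True AA'[OF True]
        by (simp add: add.commute mult.commute normal_density_nonneg ennreal_mult'[symmetric] ennreal_leI)
    qed simp
  qed
  also have "\<dots> = ennreal (exp k) * (\<integral>\<^sup>+w. (ennreal (?\<phi> (c + w)) * indicator A' (c + w)) \<partial>lborel)"
    by (rule nn_integral_cmult) simp
  also have "(\<integral>\<^sup>+w. (ennreal (?\<phi> (c + w)) * indicator A' (c + w)) \<partial>lborel)
      = (\<integral>\<^sup>+w. (ennreal (?\<phi> w) * indicator A' w) \<partial>distr lborel borel ((+) c))"
    by (subst nn_integral_distr) auto
  also have "\<dots> = emeasure (density lborel ?\<phi>) A'"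
    by (simp add: lborel_distr_plus emeasure_density)
  finally show ?thesis .
qed

section \<open>Translating one variable of the span, and its tails\<close>

context centered_gaussian
begin

lemma lin_span_density:
  assumes "W \<in> lin_span" and V: "expectation (\<lambda>\<omega>. (W \<omega>)\<^sup>2) = V" "V > 0"
  shows "distr M borel W = density lborel (normal_density 0 (sqrt V))"
proof -
  have "distr M borel W = distr std_normal_distribution borel (\<lambda>x. 0 + sqrt V * x)"
    using lin_span_normal_rv[OF assms(1)] V by (simp add: normal_rv_def)
  also have "\<dots> = gaussian_measure 0 (sqrt V)"
    using V by (subst gaussian_measure_eq_distr) auto
  finally show ?thesis using V by (simp add: gaussian_measure_def)
qed

text \<open>The joint law is a product, so the translation inequality holds on the section at each
  fixed y and can be integrated against whatever law \<open>Y\<close> has.\<close>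

lemma joint_shift_le:
  assumes W: "W \<in> lin_span" and V: "expectation (\<lambda>\<omega>. (W \<omega>)\<^sup>2) = V" "V > 0"
    and Y: "\<And>j. j \<in> I \<Longrightarrow> Y j \<in> lin_span"
    and orth: "\<And>j. j \<in> I \<Longrightarrow> expectation (\<lambda>\<omega>. Y j \<omega> * W \<omega>) = 0"
    and A: "A \<in> sets (borel \<Otimes>\<^sub>M (\<Pi>\<^sub>M i\<in>I. borel))" and A': "A' \<in> sets (borel \<Otimes>\<^sub>M (\<Pi>\<^sub>M i\<in>I. borel))"
    and AA': "\<And>w y. (w, y) \<in> A \<Longrightarrow> (w + c, y) \<in> A'"
    and k: "\<And>w y. (w, y) \<in> A \<Longrightarrow> (2 * w * c + c\<^sup>2) / (2 * V) \<le> k"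
  shows "prob {\<omega>\<in>space M. (W \<omega>, \<lambda>i\<in>I. Y i \<omega>) \<in> A} \<le> exp k * prob {\<omega>\<in>space M. (W \<omega>, \<lambda>i\<in>I. Y i \<omega>) \<in> A'}"
proof -
  define P where "P = (\<Pi>\<^sub>M i\<in>I. borel :: real measure)"
  define T where "T = (\<lambda>\<omega>. \<lambda>i\<in>I. Y i \<omega>)"
  note [measurable] = lin_span_measurable[OF W] lin_span_measurable[OF Y]
  have T[measurable]: "T \<in> measurable M P"
    unfolding T_def P_def by measurable
  define N where "N = density lborel (normal_density 0 (sqrt V))"
  define Q where "Q = distr M P T"
  have DW: "distr M borel W = N" using lin_span_density[OF W V] by (simp add: N_def)
  have law: "distr M (borel \<Otimes>\<^sub>M P) (\<lambda>\<omega>. (W \<omega>, T \<omega>)) = N \<Otimes>\<^sub>M Q"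
    using uncorrelated_joint_law[OF W Y orth] by (simp add: P_def T_def Q_def DW)
  interpret Q: prob_space Q unfolding Q_def by (rule prob_space_distr) simp
  interpret N: prob_space N unfolding N_def using V by (intro prob_space_normal_density) simp
  interpret NQ: pair_sigma_finite N Q by unfold_locales
  have setsN: "sets N = sets borel" and setsQ: "sets Q = sets P"
    by (simp_all add: N_def Q_def)
  have setsNQ: "sets (N \<Otimes>\<^sub>M Q) = sets (borel \<Otimes>\<^sub>M P)"
    by (intro sets_pair_measure_cong setsN setsQ)
  have em: "emeasure M {\<omega>\<in>space M. (W \<omega>, T \<omega>) \<in> E} = (\<integral>\<^sup>+y. emeasure N ((\<lambda>w. (w, y)) -` E) \<partial>Q)"
    if E[measurable]: "E \<in> sets (borel \<Otimes>\<^sub>M P)" for E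
  proof -
    have "emeasure M {\<omega>\<in>space M. (W \<omega>, T \<omega>) \<in> E} = emeasure (distr M (borel \<Otimes>\<^sub>M P) (\<lambda>\<omega>. (W \<omega>, T \<omega>))) E"
      by (subst emeasure_distr) (auto intro!: arg_cong2[where f = emeasure])
    also have "\<dots> = (\<integral>\<^sup>+y. emeasure N ((\<lambda>w. (w, y)) -` E) \<partial>Q)"
      unfolding law using E setsNQ by (intro NQ.emeasure_pair_measure_alt2) simp
    finally show ?thesis .
  qed
  have AP: "A \<in> sets (borel \<Otimes>\<^sub>M P)" "A' \<in> sets (borel \<Otimes>\<^sub>M P)"
    using A A' by (simp_all add: P_def)
  have sec: "(\<lambda>w. (w, y)) -` E \<in> sets borel" if "E \<in> sets (borel \<Otimes>\<^sub>M P)" for E y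
    using sets_Pair2[OF that, of y] by simp
  have "emeasure M {\<omega>\<in>space M. (W \<omega>, T \<omega>) \<in> A} \<le>
      (\<integral>\<^sup>+y. ennreal (exp k) * emeasure N ((\<lambda>w. (w, y)) -` A') \<partial>Q)"
    unfolding em[OF AP(1)]
  proof (intro nn_integral_mono)
    fix y
    show "emeasure N ((\<lambda>w. (w, y)) -` A) \<le> ennreal (exp k) * emeasure N ((\<lambda>w. (w, y)) -` A')"
      unfolding N_def
      by (rule normal_shift_le[OF V(2) sec sec, where c = c]) (use AP AA' k in auto)
  qed
  also have "\<dots> = ennreal (exp k) * (\<integral>\<^sup>+y. emeasure N ((\<lambda>w. (w, y)) -` A') \<partial>Q)"
    using AP setsNQ by (intro nn_integral_cmult NQ.measurable_emeasure_Pair2) simp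
  also have "\<dots> = ennreal (exp k) * emeasure M {\<omega>\<in>space M. (W \<omega>, T \<omega>) \<in> A'}"
    unfolding em[OF AP(2)] ..
  finally show ?thesis
    by (simp add: T_def emeasure_eq_measure flip: ennreal_mult')
qed

text \<open>Translation by -z carries w > z into the positive half-line, and w > z gives -2wz + z^2
  \<le> -z^2: the exact Gaussian rate.\<close>

lemma lin_span_tail_le:
  assumes W: "W \<in> lin_span" and V: "expectation (\<lambda>\<omega>. (W \<omega>)\<^sup>2) = V" "V > 0" and "z \<ge> 0"
  shows "prob {\<omega>\<in>space M. W \<omega> > z} \<le> exp (- z\<^sup>2 / (2 * V))"
proof -
  note [measurable] = lin_span_measurable[OF W]
  have "emeasure M {\<omega>\<in>space M. W \<omega> > z} = emeasure (distr M borel W) {z<..}"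
    by (subst emeasure_distr) (auto intro!: arg_cong2[where f = emeasure])
  also have "\<dots> \<le> ennreal (exp (- z\<^sup>2 / (2 * V))) * emeasure (distr M borel W) {0<..}"
    unfolding lin_span_density[OF W V]
  proof (rule normal_shift_le[OF V(2), where c = "- z"])
    fix w assume "w \<in> {z<..}"
    then have "2 * w * (- z) + (- z)\<^sup>2 \<le> - z\<^sup>2"
      using mult_left_mono[of z w z] \<open>z \<ge> 0\<close> by (simp add: power2_eq_square algebra_simps)
    then show "(2 * w * (- z) + (- z)\<^sup>2) / (2 * V) \<le> - z\<^sup>2 / (2 * V)"
      using V by (intro divide_right_mono) auto
  qed auto
  also have "\<dots> \<le> ennreal (exp (- z\<^sup>2 / (2 * V))) * 1"
    using prob_space.emeasure_le_1[OF prob_space_distr, of W borel "{0<..}"]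
    by (intro mult_left_mono) auto
  finally show ?thesis by (simp add: emeasure_eq_measure)
qed

text \<open>Translation by z carries (0,1) beyond z. Since w < 1 there, the cost has the additional
  linear term 2z, harmless against z^2. The constant is P(0 < W < 1).\<close>

lemma lin_span_tail_ge:
  assumes W: "W \<in> lin_span" and V: "expectation (\<lambda>\<omega>. (W \<omega>)\<^sup>2) = V" "V > 0"
  obtains p where "p > 0" "\<And>z. z \<ge> 0 \<Longrightarrow> p * exp (- (2 * z + z\<^sup>2) / (2 * V)) \<le> prob {\<omega>\<in>space M. W \<omega> > z}"
proof
  note [measurable] = lin_span_measurable[OF W]
  have prob_eq: "ennreal (prob {\<omega>\<in>space M. W \<omega> \<in> B}) = emeasure (distr M borel W) B" if "B \<in> sets borel" for B
    using that by (subst emeasure_distr) (auto simp: emeasure_eq_measure intro!: arg_cong[where f = prob])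
  let ?p = "prob {\<omega>\<in>space M. W \<omega> \<in> {0<..<1}}"
  have "emeasure (distr M borel W) {0<..<1} \<noteq> 0"
    unfolding lin_span_density[OF W V] using V by (intro normal_interval_nonzero) auto
  then have "?p \<noteq> 0" using prob_eq[of "{0<..<1}"] by (metis ennreal_0 greaterThanLessThan_borel)
  then show "?p > 0" using measure_nonneg[of M "{\<omega>\<in>space M. W \<omega> \<in> {0<..<1}}"] by linarith
  fix z :: real assume "z \<ge> 0"
  have "emeasure (distr M borel W) {0<..<1} \<le> ennreal (exp ((2 * z + z\<^sup>2) / (2 * V))) * emeasure (distr M borel W) {z<..}"
    unfolding lin_span_density[OF W V]
  proof (rule normal_shift_le[OF V(2), where c = z])
    fix w :: real assume "w \<in> {0<..<1}"
    then show "(2 * w * z + z\<^sup>2) / (2 * V) \<le> (2 * z + z\<^sup>2) / (2 * V)"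
      using V \<open>z \<ge> 0\<close> mult_right_mono[of w 1 z] by (intro divide_right_mono) auto
  qed auto
  then have "ennreal ?p \<le> ennreal (exp ((2 * z + z\<^sup>2) / (2 * V)) * prob {\<omega>\<in>space M. W \<omega> \<in> {z<..}})"
    by (simp add: prob_eq[symmetric] ennreal_mult)
  then have "?p \<le> exp ((2 * z + z\<^sup>2) / (2 * V)) * prob {\<omega>\<in>space M. W \<omega> > z}"
    by simp
  then show "?p * exp (- (2 * z + z\<^sup>2) / (2 * V)) \<le> prob {\<omega>\<in>space M. W \<omega> > z}"
    unfolding minus_divide_left[symmetric] exp_minus
    by (simp add: divide_inverse[symmetric] pos_divide_le_eq mult.commute)
qed

end

section \<open>High minima under an orthogonal decomposition\<close>

text \<open>Collects what the asymptotics take from the energy problem: m \<ge> 1 and the domination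
  of the minimum by \<open>W\<close>. \<open>D\<close> will be the dyadic points of [a,b]. The
  margin 1/(n+1) is there because an infimum over \<open>D\<close> can equal \<open>u\<close>
  although all values on \<open>D\<close> exceed \<open>u\<close>.\<close>

locale high_minimum = centered_gaussian M X
  for M :: "'w measure" and X :: "real \<Rightarrow> 'w \<Rightarrow> real" +
  fixes a b V :: real and W :: "'w \<Rightarrow> real" and D :: "real set" and m :: "real \<Rightarrow> real"
    and C\<^sub>0 c\<^sub>0 :: real
  assumes W: "W \<in> lin_span" and V: "expectation (\<lambda>\<omega>. (W \<omega>)\<^sup>2) = V" and V_pos: "V > 0"
    and D: "countable D" and m_ge_1: "\<And>t. t \<in> D \<Longrightarrow> m t \<ge> 1"
    and orth: "\<And>t. t \<in> D \<Longrightarrow> expectation (\<lambda>\<omega>. (X t \<omega> - m t * W \<omega>) * W \<omega>) = 0"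
    and path_min_iff: "\<And>\<omega> u. \<omega> \<in> space M \<Longrightarrow>
      path_min X a b \<omega> > u \<longleftrightarrow> (\<exists>n::nat. \<forall>t\<in>D. X t \<omega> \<ge> u + 1 / (real n + 1))"
    and path_min_imp_W: "\<And>\<omega> u. \<omega> \<in> space M \<Longrightarrow> path_min X a b \<omega> > u \<Longrightarrow> W \<omega> > u"
    and c\<^sub>0: "c\<^sub>0 > 0"
    and residual_tail: "\<And>z. z \<ge> 0 \<Longrightarrow>
      prob {\<omega>\<in>space M. \<exists>t\<in>D. \<bar>X t \<omega> - m t * W \<omega>\<bar> > z} \<le> C\<^sub>0 * exp (- c\<^sub>0 * z\<^sup>2)"
begin

section \<open>The pair of W and its residual\<close>

definition Y :: "real \<Rightarrow> 'w \<Rightarrow> real" where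
  "Y t \<omega> = X t \<omega> - m t * W \<omega>"

definition g :: "real \<Rightarrow> real" where
  "g u = prob {\<omega>\<in>space M. path_min X a b \<omega> > u}"

lemma Y_lin_span: "Y t \<in> lin_span"
  using lin_span_combine[OF X_in_lin_span[of t] W, of 1 "- m t"] by (simp add: Y_def[abs_def])

lemma Y_orth: "t \<in> D \<Longrightarrow> expectation (\<lambda>\<omega>. Y t \<omega> * W \<omega>) = 0"
  using orth by (simp add: Y_def)

lemma measurable_W [measurable]: "W \<in> borel_measurable M"
  by (rule lin_span_measurable[OF W])

lemma measurable_Y [measurable]: "Y t \<in> borel_measurable M"
  by (rule lin_span_measurable[OF Y_lin_span])

lemma X_eq: "X t \<omega> = m t * W \<omega> + Y t \<omega>"
  by (simp add: Y_def)

lemma pred_ball_D [measurable (raw)]: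
  assumes "\<And>t. t \<in> D \<Longrightarrow> Measurable.pred N (P t)"
  shows "Measurable.pred N (\<lambda>x. \<forall>t\<in>D. P t x)" and "Measurable.pred N (\<lambda>x. \<exists>t\<in>D. P t x)"
  using assms D unfolding pred_def
  by (auto intro!: sets.sets_Collect_countable_All' sets.sets_Collect_countable_Ex')

lemma pred_path_min [measurable]: "Measurable.pred M (\<lambda>\<omega>. path_min X a b \<omega> > u)"
proof -
  have "Measurable.pred M (\<lambda>\<omega>. \<exists>n::nat. \<forall>t\<in>D. X t \<omega> \<ge> u + 1 / (real n + 1))" by measurable
  then show ?thesis
    by (rule measurable_cong[THEN iffD2, rotated]) (simp add: path_min_iff)
qed

text \<open>The event min X > u in the coordinates (w, y), so that w can be translated while the
  residual y is kept.\<close>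

definition high :: "real \<Rightarrow> real \<times> (real \<Rightarrow> real) \<Rightarrow> bool" where
  "high u p \<longleftrightarrow> (\<exists>n::nat. \<forall>t\<in>D. m t * fst p + snd p t \<ge> u + 1 / (real n + 1))"

lemma high_iff:
  "\<omega> \<in> space M \<Longrightarrow> high u (W \<omega>, \<lambda>t\<in>D. Y t \<omega>) \<longleftrightarrow> path_min X a b \<omega> > u"
  by (simp add: high_def path_min_iff X_eq)

lemma pred_high [measurable]: "Measurable.pred (borel \<Otimes>\<^sub>M (\<Pi>\<^sub>M i\<in>D. borel)) (high u)"
  unfolding high_def[abs_def] by measurable

lemma highI:
  assumes "\<epsilon> > 0" "\<And>t. t \<in> D \<Longrightarrow> m t * w + y t \<ge> u + \<epsilon>"
  shows "high u (w, y)"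
proof -
  obtain n :: nat where "1 / (real n + 1) < \<epsilon>"
    using assms(1) nat_approx_posE[of \<epsilon>] by (auto simp: add.commute)
  then show ?thesis
    unfolding high_def fst_conv snd_conv using assms(2) by (intro exI[of _ n]) force
qed

lemma highE:
  assumes "high u (w, y)"
  obtains \<epsilon> where "\<epsilon> > 0" "\<And>t. t \<in> D \<Longrightarrow> m t * w + y t \<ge> u + \<epsilon>"
proof -
  obtain n :: nat where "\<forall>t\<in>D. m t * w + y t \<ge> u + 1 / (real n + 1)"
    using assms by (auto simp: high_def)
  then show ?thesis using that[of "1 / (real n + 1)"] by simp
qed

lemma shift:
  assumes A: "Measurable.pred (borel \<Otimes>\<^sub>M (\<Pi>\<^sub>M i\<in>D. borel)) A"
    and A': "Measurable.pred (borel \<Otimes>\<^sub>M (\<Pi>\<^sub>M i\<in>D. borel)) A'"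
    and AA': "\<And>w y. A (w, y) \<Longrightarrow> A' (w + c, y)"
    and k: "\<And>w y. A (w, y) \<Longrightarrow> (2 * w * c + c\<^sup>2) / (2 * V) \<le> k"
  shows "prob {\<omega>\<in>space M. A (W \<omega>, \<lambda>t\<in>D. Y t \<omega>)} \<le> exp k * prob {\<omega>\<in>space M. A' (W \<omega>, \<lambda>t\<in>D. Y t \<omega>)}"
proof -
  let ?L = "borel \<Otimes>\<^sub>M (\<Pi>\<^sub>M i\<in>D. borel) :: (real \<times> (real \<Rightarrow> real)) measure"
  have sp: "(w, y) \<in> space ?L \<longleftrightarrow> y \<in> extensional D" for w y
    by (simp add: space_pair_measure space_PiM PiE_UNIV_domain PiE_def)
  have "prob {\<omega>\<in>space M. (W \<omega>, \<lambda>t\<in>D. Y t \<omega>) \<in> {p \<in> space ?L. A p}}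
      \<le> exp k * prob {\<omega>\<in>space M. (W \<omega>, \<lambda>t\<in>D. Y t \<omega>) \<in> {p \<in> space ?L. A' p}}"
    by (rule joint_shift_le[OF W V V_pos Y_lin_span Y_orth, where c = c])
      (use A A' AA' k in \<open>auto simp: pred_def sp\<close>)
  then show ?thesis by (simp add: sp)
qed

lemma prob_W_residual:
  assumes "Measurable.pred borel P" "Measurable.pred (\<Pi>\<^sub>M i\<in>D. borel) R"
  shows "prob {\<omega>\<in>space M. P (W \<omega>) \<and> R (\<lambda>t\<in>D. Y t \<omega>)} =
    prob {\<omega>\<in>space M. P (W \<omega>)} * prob {\<omega>\<in>space M. R (\<lambda>t\<in>D. Y t \<omega>)}"
proof -
  let ?Pi = "\<Pi>\<^sub>M i\<in>D. borel :: real measure" and ?T = "\<lambda>\<omega>. \<lambda>t\<in>D. Y t \<omega>"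
  have T[measurable]: "?T \<in> measurable M ?Pi" by measurable
  have PR[measurable]: "{w. P w} \<in> sets borel" "{y \<in> space ?Pi. R y} \<in> sets ?Pi"
    using assms by (auto simp: pred_def)
  interpret DT: prob_space "distr M ?Pi ?T" by (rule prob_space_distr) simp
  have spT: "?T \<omega> \<in> space ?Pi" if "\<omega> \<in> space M" for \<omega>
    using measurable_space[OF T that] .
  have law: "distr M (borel \<Otimes>\<^sub>M ?Pi) (\<lambda>\<omega>. (W \<omega>, ?T \<omega>)) = distr M borel W \<Otimes>\<^sub>M distr M ?Pi ?T"
    by (rule uncorrelated_joint_law[OF W Y_lin_span Y_orth])
  have "emeasure (distr M (borel \<Otimes>\<^sub>M ?Pi) (\<lambda>\<omega>. (W \<omega>, ?T \<omega>))) ({w. P w} \<times> {y \<in> space ?Pi. R y}) =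
      emeasure (distr M borel W) {w. P w} * emeasure (distr M ?Pi ?T) {y \<in> space ?Pi. R y}"
    unfolding law
    by (subst DT.emeasure_pair_measure_Times) auto
  moreover have "emeasure (distr M (borel \<Otimes>\<^sub>M ?Pi) (\<lambda>\<omega>. (W \<omega>, ?T \<omega>))) ({w. P w} \<times> {y \<in> space ?Pi. R y}) =
      emeasure M {\<omega>\<in>space M. P (W \<omega>) \<and> R (?T \<omega>)}"
    by (subst emeasure_distr) (use spT in \<open>auto intro!: arg_cong2[where f = emeasure]\<close>)
  moreover have "emeasure (distr M borel W) {w. P w} = emeasure M {\<omega>\<in>space M. P (W \<omega>)}"
    by (subst emeasure_distr) (auto intro!: arg_cong2[where f = emeasure])
  moreover have "emeasure (distr M ?Pi ?T) {y \<in> space ?Pi. R y} = emeasure M {\<omega>\<in>space M. R (?T \<omega>)}"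
    by (subst emeasure_distr) (use spT in \<open>auto intro!: arg_cong2[where f = emeasure]\<close>)
  ultimately show ?thesis
    by (simp add: emeasure_eq_measure flip: ennreal_mult)
qed

text \<open>By independence the two tails multiply, and the residual adds
  \<open>c\<^sub>0 * \<delta>\<^sup>2\<close> to the exponent 1/(2V). This excess makes the event
  negligible against \<open>g u\<close>.\<close>

lemma prob_high_residual_large:
  assumes "u \<ge> 0" "\<delta> > 0"
  shows "prob {\<omega>\<in>space M. W \<omega> > u \<and> (\<exists>t\<in>D. \<bar>Y t \<omega>\<bar> > \<delta> * u)} \<le> C\<^sub>0 * exp (- (1 / (2 * V) + c\<^sub>0 * \<delta>\<^sup>2) * u\<^sup>2)"
proof -
  have "prob {\<omega>\<in>space M. W \<omega> > u \<and> (\<exists>t\<in>D. \<bar>Y t \<omega>\<bar> > \<delta> * u)} =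
      prob {\<omega>\<in>space M. W \<omega> > u} * prob {\<omega>\<in>space M. \<exists>t\<in>D. \<bar>Y t \<omega>\<bar> > \<delta> * u}"
    using prob_W_residual[of "\<lambda>w. w > u" "\<lambda>y. \<exists>t\<in>D. \<bar>y t\<bar> > \<delta> * u"] by simp
  also have "\<dots> \<le> exp (- u\<^sup>2 / (2 * V)) * (C\<^sub>0 * exp (- c\<^sub>0 * (\<delta> * u)\<^sup>2))"
    using lin_span_tail_le[OF W V V_pos \<open>u \<ge> 0\<close>] residual_tail[of "\<delta> * u"] assms
    by (intro mult_mono) (auto simp: Y_def)
  also have "\<dots> = C\<^sub>0 * exp (- u\<^sup>2 / (2 * V) + (- c\<^sub>0 * (\<delta> * u)\<^sup>2))"
    by (simp only: exp_add mult_ac)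
  also have "- u\<^sup>2 / (2 * V) + (- c\<^sub>0 * (\<delta> * u)\<^sup>2) = - (1 / (2 * V) + c\<^sub>0 * \<delta>\<^sup>2) * u\<^sup>2"
    by (simp add: power_mult_distrib algebra_simps)
  finally show ?thesis .
qed

text \<open>For large u the residual stays below (\<epsilon>/2) u with probability at least 1/2. On
  that event W > (1 + \<epsilon>) u and m \<ge> 1 leave the margin (\<epsilon>/2) u above u on all
  of \<open>D\<close>; independence multiplies the two probabilities.\<close>

lemma g_lower:
  assumes "\<epsilon> > 0"
  obtains p where "p > 0"
    "eventually (\<lambda>u. g u \<ge> p * exp (- (2 * ((1 + \<epsilon>) * u) + ((1 + \<epsilon>) * u)\<^sup>2) / (2 * V))) at_top"
proof -
  obtain p where p: "p > 0"
    "\<And>z. z \<ge> 0 \<Longrightarrow> p * exp (- (2 * z + z\<^sup>2) / (2 * V)) \<le> prob {\<omega>\<in>space M. W \<omega> > z}"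
    using lin_span_tail_ge[OF W V V_pos] by blast
  have "((\<lambda>u. C\<^sub>0 * exp (- c\<^sub>0 * (\<epsilon> / 2 * u)\<^sup>2)) \<longlongrightarrow> 0) at_top"
    using c\<^sub>0 assms by real_asymp
  then have "eventually (\<lambda>u. C\<^sub>0 * exp (- c\<^sub>0 * (\<epsilon> / 2 * u)\<^sup>2) < 1 / 2) at_top"
    by (rule order_tendstoD) simp
  then have "eventually (\<lambda>u. g u \<ge> (p / 2) * exp (- (2 * ((1 + \<epsilon>) * u) + ((1 + \<epsilon>) * u)\<^sup>2) / (2 * V))) at_top"
    using eventually_gt_at_top[of 0]
  proof eventually_elim
    fix u :: real assume small: "C\<^sub>0 * exp (- c\<^sub>0 * (\<epsilon> / 2 * u)\<^sup>2) < 1 / 2" and u: "u > 0"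
    let ?B = "{\<omega>\<in>space M. \<exists>t\<in>D. \<bar>Y t \<omega>\<bar> > \<epsilon> / 2 * u}"
    let ?G = "{\<omega>\<in>space M. \<forall>t\<in>D. \<bar>Y t \<omega>\<bar> \<le> \<epsilon> / 2 * u}"
    have "prob ?B < 1 / 2"
      using residual_tail[of "\<epsilon> / 2 * u"] small assms u by (simp add: Y_def)
    moreover have "?G = space M - ?B" by (auto simp: not_less)
    ultimately have G: "prob ?G \<ge> 1 / 2"
      by (simp add: prob_compl)
    have "p / 2 * exp (- (2 * ((1 + \<epsilon>) * u) + ((1 + \<epsilon>) * u)\<^sup>2) / (2 * V)) =
        p * exp (- (2 * ((1 + \<epsilon>) * u) + ((1 + \<epsilon>) * u)\<^sup>2) / (2 * V)) * (1 / 2)" by simp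
    also have "\<dots> \<le> prob {\<omega>\<in>space M. W \<omega> > (1 + \<epsilon>) * u} * prob ?G"
      using p(2)[of "(1 + \<epsilon>) * u"] G u assms by (intro mult_mono) auto
    also have "\<dots> = prob {\<omega>\<in>space M. W \<omega> > (1 + \<epsilon>) * u \<and> (\<forall>t\<in>D. \<bar>Y t \<omega>\<bar> \<le> \<epsilon> / 2 * u)}"
      using prob_W_residual[of "\<lambda>w. w > (1 + \<epsilon>) * u" "\<lambda>y. \<forall>t\<in>D. \<bar>y t\<bar> \<le> \<epsilon> / 2 * u"] by simp
    also have "\<dots> \<le> g u"
      unfolding g_def
    proof (intro finite_measure_mono)
      show "{\<omega>\<in>space M. W \<omega> > (1 + \<epsilon>) * u \<and> (\<forall>t\<in>D. \<bar>Y t \<omega>\<bar> \<le> \<epsilon> / 2 * u)} \<subseteq>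
          {\<omega>\<in>space M. path_min X a b \<omega> > u}"
      proof safe
        fix \<omega> assume \<omega>: "\<omega> \<in> space M" "W \<omega> > (1 + \<epsilon>) * u" and YG: "\<forall>t\<in>D. \<bar>Y t \<omega>\<bar> \<le> \<epsilon> / 2 * u"
        have "high u (W \<omega>, \<lambda>t\<in>D. Y t \<omega>)"
        proof (rule highI)
          show "\<epsilon> / 2 * u > 0" using assms u by simp
          fix t assume t: "t \<in> D"
          have "W \<omega> \<ge> 0" using \<omega>(2) u assms mult_nonneg_nonneg[of "1 + \<epsilon>" u] by linarith
          then have "m t * W \<omega> \<ge> W \<omega>" using m_ge_1[OF t] mult_right_mono[of 1 "m t" "W \<omega>"] by simp
          moreover have "Y t \<omega> \<ge> - (\<epsilon> / 2 * u)" using YG t by force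
          ultimately show "u + \<epsilon> / 2 * u \<le> m t * W \<omega> + (\<lambda>t\<in>D. Y t \<omega>) t"
            using \<omega>(2) t by (simp add: algebra_simps)
        qed
        then show "path_min X a b \<omega> > u" using high_iff \<omega> by simp
      qed
    qed measurable
    finally show "p / 2 * exp (- (2 * ((1 + \<epsilon>) * u) + ((1 + \<epsilon>) * u)\<^sup>2) / (2 * V)) \<le> g u" .
  qed
  then show thesis using that[of "p / 2"] p(1) by simp
qed

text \<open>Some \<epsilon> > 0 keeps (1 + \<epsilon>)^2/(2V) below \<kappa>; with this \<epsilon>
  the lower bound of \<open>g\<close> decays more slowly than the numerator.\<close>

lemma gaussian_negligible:
  assumes "\<kappa> > 1 / (2 * V)"
  shows "((\<lambda>u. exp (- \<kappa> * u\<^sup>2) / g u) \<longlongrightarrow> 0) at_top"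
proof -
  have "((\<lambda>\<epsilon>. (1 + \<epsilon>)\<^sup>2 / (2 * V)) \<longlongrightarrow> (1 + 0)\<^sup>2 / (2 * V)) (at_right (0::real))"
    using V_pos by (intro tendsto_intros) auto
  then have "eventually (\<lambda>\<epsilon>. (1 + \<epsilon>)\<^sup>2 / (2 * V) < \<kappa>) (at_right (0::real))"
    using assms by (intro order_tendstoD) auto
  then have "eventually (\<lambda>\<epsilon>. (1 + \<epsilon>)\<^sup>2 / (2 * V) < \<kappa> \<and> \<epsilon> > 0) (at_right (0::real))"
    using eventually_at_right_less by eventually_elim auto
  then obtain \<epsilon> :: real where \<epsilon>: "(1 + \<epsilon>)\<^sup>2 / (2 * V) < \<kappa>" "\<epsilon> > 0"
    using eventually_happens'[of "at_right (0::real)"] by auto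
  obtain p where p: "p > 0"
    "eventually (\<lambda>u. g u \<ge> p * exp (- (2 * ((1 + \<epsilon>) * u) + ((1 + \<epsilon>) * u)\<^sup>2) / (2 * V))) at_top"
    using g_lower[OF \<epsilon>(2)] .
  \<comment> \<open>\<alpha> u^2 is the surplus of the quadratic terms, \<beta> u comes from the
    linear term of \<open>lin_span_tail_ge\<close>.\<close>
  define \<alpha> where "\<alpha> = \<kappa> - (1 + \<epsilon>)\<^sup>2 / (2 * V)"
  define \<beta> where "\<beta> = (1 + \<epsilon>) / V"
  have \<alpha>: "\<alpha> > 0" using \<epsilon> by (simp add: \<alpha>_def)
  show ?thesis
  proof (rule tendsto_sandwich)
    show "((\<lambda>_. 0) \<longlongrightarrow> (0::real)) (at_top :: real filter)" by simp
    show "eventually (\<lambda>u. 0 \<le> exp (- \<kappa> * u\<^sup>2) / g u) at_top"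
      by (simp add: g_def)
    show "((\<lambda>u. (1 / p) * exp (\<beta> * u - \<alpha> * u\<^sup>2)) \<longlongrightarrow> 0) at_top"
      using \<alpha> by real_asymp
    show "eventually (\<lambda>u. exp (- \<kappa> * u\<^sup>2) / g u \<le> (1 / p) * exp (\<beta> * u - \<alpha> * u\<^sup>2)) at_top"
      using p(2)
    proof eventually_elim
      fix u assume le: "p * exp (- (2 * ((1 + \<epsilon>) * u) + ((1 + \<epsilon>) * u)\<^sup>2) / (2 * V)) \<le> g u"
      have "exp (- \<kappa> * u\<^sup>2) / g u \<le>
          exp (- \<kappa> * u\<^sup>2) / (p * exp (- (2 * ((1 + \<epsilon>) * u) + ((1 + \<epsilon>) * u)\<^sup>2) / (2 * V)))"
        using p(1) le by (intro divide_left_mono mult_pos_pos) (auto intro: less_le_trans[OF _ le])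
      also have "\<dots> = (1 / p) * exp (- \<kappa> * u\<^sup>2 - (- (2 * ((1 + \<epsilon>) * u) + ((1 + \<epsilon>) * u)\<^sup>2) / (2 * V)))"
        by (simp add: exp_diff)
      also have "- \<kappa> * u\<^sup>2 - (- (2 * ((1 + \<epsilon>) * u) + ((1 + \<epsilon>) * u)\<^sup>2) / (2 * V)) = \<beta> * u - \<alpha> * u\<^sup>2"
        using V_pos by (simp add: \<alpha>_def \<beta>_def power2_eq_square field_simps)
      finally show "exp (- \<kappa> * u\<^sup>2) / g u \<le> (1 / p) * exp (\<beta> * u - \<alpha> * u\<^sup>2)" .
    qed
  qed
qed

lemma g_pos: "eventually (\<lambda>u. g u > 0) at_top"
proof -
  obtain p where p: "p > 0"
    "eventually (\<lambda>u. g u \<ge> p * exp (- (2 * ((1 + 1) * u) + ((1 + 1) * u)\<^sup>2) / (2 * V))) at_top"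
    using g_lower[of 1] by auto
  from p(2) show ?thesis
    by eventually_elim (use p(1) in \<open>auto intro: less_le_trans[rotated]\<close>)
qed

lemma g_upper:
  assumes "x \<ge> 0" "\<delta> > 0" "u > 0"
  shows "g (u + x / u) \<le> exp (- x / ((1 + 2 * \<delta>) * V)) * g u + C\<^sub>0 * exp (- (1 / (2 * V) + c\<^sub>0 * \<delta>\<^sup>2) * u\<^sup>2)"
proof -
  define h where "h = x / u"
  \<comment> \<open>Shortened so that m(t) h' \<le> h wherever m(t) \<le> 1 + 2 \<delta>: lowering w
    by h' then costs at most the h by which the level drops.\<close>
  define h' where "h' = h / (1 + 2 * \<delta>)"
  have h: "h \<ge> 0" "u * h = x" using assms by (auto simp: h_def)
  have h': "h' \<ge> 0" "h' \<le> h" "h = (1 + 2 * \<delta>) * h'"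
    using h assms by (auto simp: h'_def field_simps)
  \<comment> \<open>The conjunct on \<open>fst p\<close> follows from the domination of the minimum
    by \<open>W\<close>. It yields both the gain in the density and w - h' \<ge> u at points where m
    is large.\<close>
  define good where "good = (\<lambda>p::real \<times> (real \<Rightarrow> real). fst p > u + h \<and> high (u + h) p \<and> (\<forall>t\<in>D. \<bar>snd p t\<bar> \<le> \<delta> * u))"
  have good: "Measurable.pred (borel \<Otimes>\<^sub>M (\<Pi>\<^sub>M i\<in>D. borel)) good"
    unfolding good_def by measurable
  have sub: "{\<omega>\<in>space M. path_min X a b \<omega> > u + h} \<subseteq>
      {\<omega>\<in>space M. good (W \<omega>, \<lambda>t\<in>D. Y t \<omega>)} \<union> {\<omega>\<in>space M. W \<omega> > u \<and> (\<exists>t\<in>D. \<bar>Y t \<omega>\<bar> > \<delta> * u)}"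
  proof
    fix \<omega> assume "\<omega> \<in> {\<omega>\<in>space M. path_min X a b \<omega> > u + h}"
    then have \<omega>: "\<omega> \<in> space M" "path_min X a b \<omega> > u + h" by auto
    with path_min_imp_W have "W \<omega> > u + h" by auto
    with \<omega> high_iff[OF \<omega>(1)] h show "\<omega> \<in> {\<omega>\<in>space M. good (W \<omega>, \<lambda>t\<in>D. Y t \<omega>)} \<union>
        {\<omega>\<in>space M. W \<omega> > u \<and> (\<exists>t\<in>D. \<bar>Y t \<omega>\<bar> > \<delta> * u)}"
      by (auto simp: good_def not_less)
  qed
  have [measurable]: "{\<omega>\<in>space M. good (W \<omega>, \<lambda>t\<in>D. Y t \<omega>)} \<in> sets M"
    unfolding good_def by measurable
  have "g (u + h) \<le> prob ({\<omega>\<in>space M. good (W \<omega>, \<lambda>t\<in>D. Y t \<omega>)} \<union>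
      {\<omega>\<in>space M. W \<omega> > u \<and> (\<exists>t\<in>D. \<bar>Y t \<omega>\<bar> > \<delta> * u)})"
    unfolding g_def by (intro finite_measure_mono sub) measurable
  also have "\<dots> \<le> prob {\<omega>\<in>space M. good (W \<omega>, \<lambda>t\<in>D. Y t \<omega>)} +
      prob {\<omega>\<in>space M. W \<omega> > u \<and> (\<exists>t\<in>D. \<bar>Y t \<omega>\<bar> > \<delta> * u)}"
    by (intro measure_Un_le) measurable
  also have "prob {\<omega>\<in>space M. good (W \<omega>, \<lambda>t\<in>D. Y t \<omega>)} \<le>
      exp (- x / ((1 + 2 * \<delta>) * V)) * prob {\<omega>\<in>space M. high u (W \<omega>, \<lambda>t\<in>D. Y t \<omega>)}"
  proof (rule shift[OF good pred_high, where c = "- h'"])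
    fix w y assume wy: "good (w, y)"
    then have w: "w > u + h" and y: "\<And>t. t \<in> D \<Longrightarrow> \<bar>y t\<bar> \<le> \<delta> * u" and "high (u + h) (w, y)"
      by (auto simp: good_def)
    from this(3) obtain \<epsilon> where \<epsilon>: "\<epsilon> > 0" "\<And>t. t \<in> D \<Longrightarrow> m t * w + y t \<ge> u + h + \<epsilon>"
      by (rule highE) auto
    show "high u (w + - h', y)"
    proof (rule highI)
      show "min \<epsilon> (\<delta> * u) > 0" using \<epsilon> assms by simp
      fix t assume t: "t \<in> D"
      show "u + min \<epsilon> (\<delta> * u) \<le> m t * (w + - h') + y t"
      proof (cases "m t \<le> 1 + 2 * \<delta>")
        case True
        then have "m t * h' \<le> h" using h' by (metis mult_right_mono)
        then show ?thesis using \<epsilon>(2)[OF t] by (simp add: algebra_simps)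
      next
        case False
        \<comment> \<open>Here the mean part is at least (1 + 2 \<delta>) u, and a residual of at
          least -\<delta> u still leaves the margin \<delta> u; hence the 2 in the constant.\<close>
        have "u * (1 + 2 * \<delta>) \<le> (w - h') * m t"
          using False w h' assms by (intro mult_mono) auto
        then have "u + 2 * (\<delta> * u) \<le> m t * (w + - h')" by (simp add: algebra_simps)
        then show ?thesis using abs_le_D2[OF y[OF t]] min.cobounded2[of \<epsilon> "\<delta> * u"] by linarith
      qed
    qed
    \<comment> \<open>The square h'^2 is absorbed because w > u + h and h' \<le> h, so the full gain
      2 u h' remains.\<close>
    have "2 * w * (- h') + (- h')\<^sup>2 \<le> - 2 * u * h'"
    proof -
      have "(u + h) * h' \<le> w * h'" using w h' by (intro mult_right_mono) auto
      moreover have "h' * h' \<le> h * h'" using h' by (intro mult_right_mono) auto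
      moreover have "0 \<le> h * h'" using h h' by simp
      ultimately show ?thesis by (simp add: power2_eq_square algebra_simps)
    qed
    then have "(2 * w * (- h') + (- h')\<^sup>2) / (2 * V) \<le> (- 2 * u * h') / (2 * V)"
      using V_pos by (intro divide_right_mono) auto
    also have "(- 2 * u * h') / (2 * V) = - x / ((1 + 2 * \<delta>) * V)"
      unfolding h(2)[symmetric] h'_def by simp
    finally show "(2 * w * (- h') + (- h')\<^sup>2) / (2 * V) \<le> - x / ((1 + 2 * \<delta>) * V)" .
  qed
  also have "prob {\<omega>\<in>space M. high u (W \<omega>, \<lambda>t\<in>D. Y t \<omega>)} = g u"
    unfolding g_def by (intro arg_cong[where f = prob]) (auto simp: high_iff)
  finally show ?thesis
    using prob_high_residual_large[of u \<delta>] assms by (simp add: h_def)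
qed

text \<open>Because m \<ge> 1, raising w by h raises every value by at least h. The price of the
  translation grows with w, so \<open>W\<close> is cut at (1 + \<eta>) u; beyond the cut its tail
  exponent (1 + \<eta>)^2/(2V) exceeds 1/(2V).\<close>

lemma g_lower_shift:
  assumes "x \<ge> 0" "\<eta> > 0" "u > 0"
  shows "g u \<le> exp (((1 + \<eta>) * x + (x / u)\<^sup>2 / 2) / V) * g (u + x / u) + exp (- ((1 + \<eta>)\<^sup>2 / (2 * V)) * u\<^sup>2)"
proof -
  define h where "h = x / u"
  have h: "h \<ge> 0" "u * h = x" using assms by (auto simp: h_def)
  define low where "low = (\<lambda>p::real \<times> (real \<Rightarrow> real). fst p \<le> (1 + \<eta>) * u \<and> high u p)"
  have low: "Measurable.pred (borel \<Otimes>\<^sub>M (\<Pi>\<^sub>M i\<in>D. borel)) low"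
    unfolding low_def by measurable
  have sub: "{\<omega>\<in>space M. path_min X a b \<omega> > u} \<subseteq>
      {\<omega>\<in>space M. low (W \<omega>, \<lambda>t\<in>D. Y t \<omega>)} \<union> {\<omega>\<in>space M. W \<omega> > (1 + \<eta>) * u}"
    using high_iff by (auto simp: low_def not_less)
  have [measurable]: "{\<omega>\<in>space M. low (W \<omega>, \<lambda>t\<in>D. Y t \<omega>)} \<in> sets M"
    unfolding low_def by measurable
  have "g u \<le> prob ({\<omega>\<in>space M. low (W \<omega>, \<lambda>t\<in>D. Y t \<omega>)} \<union> {\<omega>\<in>space M. W \<omega> > (1 + \<eta>) * u})"
    unfolding g_def by (intro finite_measure_mono sub) measurable
  also have "\<dots> \<le> prob {\<omega>\<in>space M. low (W \<omega>, \<lambda>t\<in>D. Y t \<omega>)} + prob {\<omega>\<in>space M. W \<omega> > (1 + \<eta>) * u}"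
    by (intro measure_Un_le) measurable
  also have "prob {\<omega>\<in>space M. low (W \<omega>, \<lambda>t\<in>D. Y t \<omega>)} \<le>
      exp (((1 + \<eta>) * x + h\<^sup>2 / 2) / V) * prob {\<omega>\<in>space M. high (u + h) (W \<omega>, \<lambda>t\<in>D. Y t \<omega>)}"
  proof (rule shift[OF low pred_high, where c = h])
    fix w y assume wy: "low (w, y)"
    then have w: "w \<le> (1 + \<eta>) * u" and "high u (w, y)" by (auto simp: low_def)
    from this(2) obtain \<epsilon> where \<epsilon>: "\<epsilon> > 0" "\<And>t. t \<in> D \<Longrightarrow> m t * w + y t \<ge> u + \<epsilon>"
      by (rule highE) auto
    show "high (u + h) (w + h, y)"
    proof (rule highI[OF \<epsilon>(1)])
      fix t assume t: "t \<in> D"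
      have "1 * h \<le> m t * h" using m_ge_1[OF t] h by (intro mult_right_mono)
      then show "u + h + \<epsilon> \<le> m t * (w + h) + y t" using \<epsilon>(2)[OF t] by (simp add: algebra_simps)
    qed
    have "w * h \<le> (1 + \<eta>) * u * h" using w h by (intro mult_right_mono)
    also have "\<dots> = (1 + \<eta>) * x" using h by simp
    finally have "(2 * w * h + h\<^sup>2) / (2 * V) \<le> (2 * ((1 + \<eta>) * x) + h\<^sup>2) / (2 * V)"
      using V_pos by (intro divide_right_mono) auto
    also have "\<dots> = ((1 + \<eta>) * x + h\<^sup>2 / 2) / V" using V_pos by (simp add: field_simps)
    finally show "(2 * w * h + h\<^sup>2) / (2 * V) \<le> ((1 + \<eta>) * x + h\<^sup>2 / 2) / V" .
  qed
  also have "prob {\<omega>\<in>space M. high (u + h) (W \<omega>, \<lambda>t\<in>D. Y t \<omega>)} = g (u + h)"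
    unfolding g_def by (intro arg_cong[where f = prob]) (auto simp: high_iff)
  finally show ?thesis
    using lin_span_tail_le[OF W V V_pos, of "(1 + \<eta>) * u"] assms
    by (simp add: h_def power_mult_distrib)
qed

theorem g_ratio_tendsto:
  assumes x: "x \<ge> 0"
  shows "((\<lambda>u. g (u + x / u) / g u) \<longlongrightarrow> exp (- x / V)) at_top"
proof (rule order_tendstoI)
  fix l assume l: "exp (- x / V) < l"
  \<comment> \<open>\<delta> is fixed before u tends to infinity: the factor is below
    \<open>l\<close> for small \<delta>, and the error is negligible for each fixed \<delta> > 0.
    The lower bound treats \<eta> in the same way.\<close>
  have "((\<lambda>\<delta>. exp (- x / ((1 + 2 * \<delta>) * V))) \<longlongrightarrow> exp (- x / ((1 + 2 * 0) * V))) (at_right 0)"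
    using V_pos by (intro tendsto_intros) auto
  then have "eventually (\<lambda>\<delta>. exp (- x / ((1 + 2 * \<delta>) * V)) < l) (at_right 0)"
    using l by (intro order_tendstoD) auto
  then have "eventually (\<lambda>\<delta>. exp (- x / ((1 + 2 * \<delta>) * V)) < l \<and> \<delta> > 0) (at_right 0)"
    using eventually_at_right_less by eventually_elim auto
  then obtain \<delta> where \<delta>: "exp (- x / ((1 + 2 * \<delta>) * V)) < l" "\<delta> > 0"
    using eventually_happens'[of "at_right (0::real)"] by auto
  define \<kappa> where "\<kappa> = 1 / (2 * V) + c\<^sub>0 * \<delta>\<^sup>2"
  have "\<kappa> > 1 / (2 * V)" using c\<^sub>0 \<delta> by (simp add: \<kappa>_def)
  from gaussian_negligible[OF this]
  have "((\<lambda>u. exp (- x / ((1 + 2 * \<delta>) * V)) + C\<^sub>0 * (exp (- \<kappa> * u\<^sup>2) / g u)) \<longlongrightarrow>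
      exp (- x / ((1 + 2 * \<delta>) * V)) + C\<^sub>0 * 0) at_top"
    by (intro tendsto_intros)
  then have "eventually (\<lambda>u. exp (- x / ((1 + 2 * \<delta>) * V)) + C\<^sub>0 * (exp (- \<kappa> * u\<^sup>2) / g u) < l) at_top"
    using \<delta> by (intro order_tendstoD) auto
  then show "eventually (\<lambda>u. g (u + x / u) / g u < l) at_top"
    using g_pos eventually_gt_at_top[of 0]
  proof eventually_elim
    fix u assume u: "exp (- x / ((1 + 2 * \<delta>) * V)) + C\<^sub>0 * (exp (- \<kappa> * u\<^sup>2) / g u) < l" "0 < g u" "0 < u"
    have "g (u + x / u) / g u \<le>
        (exp (- x / ((1 + 2 * \<delta>) * V)) * g u + C\<^sub>0 * exp (- \<kappa> * u\<^sup>2)) / g u"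
      using g_upper[OF x \<delta>(2) u(3)] u(2) unfolding \<kappa>_def by (intro divide_right_mono) auto
    also have "\<dots> = exp (- x / ((1 + 2 * \<delta>) * V)) + C\<^sub>0 * (exp (- \<kappa> * u\<^sup>2) / g u)"
      using u(2) by (simp add: add_divide_distrib)
    finally show "g (u + x / u) / g u < l" using u(1) by simp
  qed
next
  fix l assume l: "l < exp (- x / V)"
  have "((\<lambda>\<eta>. exp (- ((1 + \<eta>) * x) / V)) \<longlongrightarrow> exp (- ((1 + 0) * x) / V)) (at_right 0)"
    using V_pos by (intro tendsto_intros) auto
  then have "eventually (\<lambda>\<eta>. exp (- ((1 + \<eta>) * x) / V) > l) (at_right 0)"
    using l by (intro order_tendstoD) auto
  then have "eventually (\<lambda>\<eta>. exp (- ((1 + \<eta>) * x) / V) > l \<and> \<eta> > 0) (at_right 0)"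
    using eventually_at_right_less by eventually_elim auto
  then obtain \<eta> where \<eta>: "exp (- ((1 + \<eta>) * x) / V) > l" "\<eta> > 0"
    using eventually_happens'[of "at_right (0::real)"] by auto
  define \<kappa> where "\<kappa> = (1 + \<eta>)\<^sup>2 / (2 * V)"
  have "(1 + \<eta>)\<^sup>2 > 1" using \<eta> by (simp add: power2_eq_square algebra_simps add_pos_pos)
  then have "\<kappa> > 1 / (2 * V)" using V_pos by (simp add: \<kappa>_def divide_strict_right_mono)
  note neg = gaussian_negligible[OF this]
  have xu: "((\<lambda>u::real. x / u) \<longlongrightarrow> 0) at_top" by real_asymp
  have "((\<lambda>u. exp (- (((1 + \<eta>) * x + (x / u)\<^sup>2 / 2) / V)) * (1 - exp (- \<kappa> * u\<^sup>2) / g u)) \<longlongrightarrow>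
      exp (- (((1 + \<eta>) * x + 0\<^sup>2 / 2) / V)) * (1 - 0)) at_top"
    using V_pos by (intro tendsto_intros neg xu) auto
  then have "eventually (\<lambda>u. exp (- (((1 + \<eta>) * x + (x / u)\<^sup>2 / 2) / V)) * (1 - exp (- \<kappa> * u\<^sup>2) / g u) > l) at_top"
    using \<eta> by (intro order_tendstoD) auto
  then show "eventually (\<lambda>u. l < g (u + x / u) / g u) at_top"
    using g_pos eventually_gt_at_top[of 0]
  proof eventually_elim
    fix u assume u: "l < exp (- (((1 + \<eta>) * x + (x / u)\<^sup>2 / 2) / V)) * (1 - exp (- \<kappa> * u\<^sup>2) / g u)"
      "0 < g u" "0 < u"
    let ?q = "((1 + \<eta>) * x + (x / u)\<^sup>2 / 2) / V"
    have "1 - exp (- \<kappa> * u\<^sup>2) / g u = (g u - exp (- \<kappa> * u\<^sup>2)) / g u"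
      using u(2) by (simp add: diff_divide_distrib)
    also have "\<dots> \<le> (exp ?q * g (u + x / u)) / g u"
      using g_lower_shift[OF x \<eta>(2) u(3)] u(2) unfolding \<kappa>_def by (intro divide_right_mono) auto
    finally have "exp (- ?q) * (1 - exp (- \<kappa> * u\<^sup>2) / g u) \<le> exp (- ?q) * ((exp ?q * g (u + x / u)) / g u)"
      by (intro mult_left_mono) auto
    also have "\<dots> = g (u + x / u) / g u"
      by (simp add: exp_minus)
    finally show "l < g (u + x / u) / g u" using u(1) by simp
  qed
qed

end

section \<open>Gaussian tail of the supremum\<close>

definition dyadic :: "real \<Rightarrow> real \<Rightarrow> nat \<Rightarrow> nat \<Rightarrow> real" where
  "dyadic a b n k = a + (b - a) * real k / 2 ^ n"

definition dyadics :: "real \<Rightarrow> real \<Rightarrow> real set" where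
  "dyadics a b = (\<Union>n. dyadic a b n ` {..2 ^ n})"

lemma countable_dyadics: "countable (dyadics a b)"
  by (auto simp: dyadics_def)

lemma dyadic_Suc: "dyadic a b (Suc n) (2 * k) = dyadic a b n k"
  by (simp add: dyadic_def)

lemma dyadic_diff: "dyadic a b n (Suc k) - dyadic a b n k = (b - a) / 2 ^ n"
  by (simp add: dyadic_def field_simps)

lemma dyadic_in_dyadics: "k \<le> 2 ^ n \<Longrightarrow> dyadic a b n k \<in> dyadics a b"
  by (auto simp: dyadics_def)

lemma dyadics_subset:
  assumes "a \<le> b"
  shows "dyadics a b \<subseteq> {a..b}"
proof
  fix t assume "t \<in> dyadics a b"
  then obtain n k where k: "k \<le> 2 ^ n" and t: "t = dyadic a b n k" by (auto simp: dyadics_def)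
  have "real k \<le> real (2 ^ n)" using k by (simp only: of_nat_le_iff)
  then have "(b - a) * (real k / 2 ^ n) \<le> (b - a) * 1"
    using assms by (intro mult_left_mono) auto
  then show "t \<in> {a..b}"
    using assms by (simp add: t dyadic_def)
qed

lemma subset_closure_dyadics:
  assumes "a < b"
  shows "{a..b} \<subseteq> closure (dyadics a b)"
proof
  fix t assume t: "t \<in> {a..b}"
  show "t \<in> closure (dyadics a b)"
    unfolding closure_approachable
  proof (intro allI impI)
    fix e :: real assume e: "e > 0"
    obtain n where n: "(1 / 2) ^ n < e / (b - a)"
      using real_arch_pow_inv[of "e / (b - a)" "1 / 2"] e assms by auto
    \<comment> \<open>Position of \<open>t\<close> in units of the grid step; its floor indexes the
      grid point just to the left, at distance at most (b - a)/2^n.\<close>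
    define r where "r = (t - a) / (b - a) * 2 ^ n"
    define k where "k = nat \<lfloor>r\<rfloor>"
    have r: "r \<ge> 0" "r \<le> 2 ^ n"
      using t assms by (auto simp: r_def divide_le_eq)
    have k: "real k \<le> r" "r < real k + 1"
      using r by (auto simp: k_def)
    have "real k \<le> 2 ^ n" using k r by linarith
    then have k2: "k \<le> 2 ^ n" by simp
    have "t - dyadic a b n k = (r - real k) * ((b - a) / 2 ^ n)"
      using assms by (simp add: dyadic_def r_def field_simps)
    also have "\<bar>\<dots>\<bar> \<le> 1 * ((b - a) / 2 ^ n)"
      unfolding abs_mult using k assms by (intro mult_mono) auto
    also have "\<dots> < e" using n assms by (simp add: field_simps power_divide)
    finally show "\<exists>y\<in>dyadics a b. dist y t < e"
      using dyadic_in_dyadics[OF k2] by (intro bexI[of _ "dyadic a b n k"]) (auto simp: dist_real_def abs_minus_commute)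
  qed
qed

text \<open>The minimum is attained, so min X > u leaves a gap that exceeds some 1/(n+1).
  Conversely, a non-strict bound with such a gap passes from a dense set to its closure.\<close>

lemma path_min_gt_iff:
  assumes "a < b" and cont: "continuous_on UNIV (\<lambda>t. X t \<omega>)"
  shows "path_min X a b \<omega> > u \<longleftrightarrow> (\<exists>n::nat. \<forall>t\<in>dyadics a b. X t \<omega> \<ge> u + 1 / (real n + 1))"
proof -
  have c: "continuous_on S (\<lambda>t. X t \<omega>)" for S
    using cont continuous_on_subset by blast
  obtain t0 where t0: "t0 \<in> {a..b}" "\<And>t. t \<in> {a..b} \<Longrightarrow> X t0 \<omega> \<le> X t \<omega>"
    using continuous_attains_inf[OF _ _ c, of "{a..b}"] assms by auto
  have min: "path_min X a b \<omega> = X t0 \<omega>"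
    unfolding path_min_def using t0 by (intro cInf_eq_minimum) auto
  show ?thesis
  proof
    assume "u < path_min X a b \<omega>"
    then have "X t0 \<omega> - u > 0" by (simp add: min)
    then obtain n :: nat where "1 / (real n + 1) < X t0 \<omega> - u"
      using nat_approx_posE by (metis add.commute of_nat_Suc)
    then have "u + 1 / (real n + 1) \<le> X t \<omega>" if "t \<in> dyadics a b" for t
      using t0(2)[of t] that dyadics_subset[of a b] assms by fastforce
    then show "\<exists>n::nat. \<forall>t\<in>dyadics a b. X t \<omega> \<ge> u + 1 / (real n + 1)" by blast
  next
    assume "\<exists>n::nat. \<forall>t\<in>dyadics a b. X t \<omega> \<ge> u + 1 / (real n + 1)"
    then obtain n :: nat where n: "\<And>t. t \<in> dyadics a b \<Longrightarrow> X t \<omega> \<ge> u + 1 / (real n + 1)" by blast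
    have "X t0 \<omega> \<ge> u + 1 / (real n + 1)"
      by (rule continuous_ge_on_closure[OF c _ n]) (use t0 subset_closure_dyadics[OF \<open>a < b\<close>] in auto)
    moreover have "1 / (real n + 1) > 0" by simp
    ultimately show "u < path_min X a b \<omega>" unfolding min by linarith
  qed
qed

text \<open>Cauchy-Schwarz bounds the squared sum by N times the sum of squares, which is the
  average of the (N d_k)^2; Jensen's inequality for exp does the rest. The factor N suits increments
  of size 1/N.\<close>

lemma exp_square_sum_le:
  fixes d :: "nat \<Rightarrow> real"
  assumes "c \<ge> 0" "N > 0"
  shows "exp (c * (\<Sum>k<N. \<bar>d k\<bar>)\<^sup>2) \<le> (\<Sum>k<N. (1 / real N) * exp (c * (real N * d k)\<^sup>2))"
proof -
  have "(\<Sum>k<N. \<bar>d k\<bar>)\<^sup>2 \<le> (\<Sum>k<N. (d k)\<^sup>2) * real N"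
    using sum_squared_le_sum_of_squares[of "\<lambda>k. \<bar>d k\<bar>" "{..<N}"] by simp
  then have "c * (\<Sum>k<N. \<bar>d k\<bar>)\<^sup>2 \<le> c * ((\<Sum>k<N. (d k)\<^sup>2) * real N)"
    using assms by (intro mult_left_mono)
  also have "\<dots> = (\<Sum>k<N. (1 / real N) *\<^sub>R (c * (real N * d k)\<^sup>2))"
    using assms by (simp add: sum_distrib_left sum_distrib_right power2_eq_square field_simps)
  finally have "exp (c * (\<Sum>k<N. \<bar>d k\<bar>)\<^sup>2) \<le> exp (\<Sum>k<N. (1 / real N) *\<^sub>R (c * (real N * d k)\<^sup>2))" by simp
  also have "\<dots> \<le> (\<Sum>k<N. (1 / real N) * exp (c * (real N * d k)\<^sup>2))"
    using assms by (intro convex_on_sum[OF _ _ exp_convex]) (auto simp: lessThan_empty_iff)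
  finally show ?thesis .
qed

section \<open>Regularity in mean square and the tail on the dyadic points\<close>

context centered_gaussian
begin

text \<open>The random Lipschitz constant of the paths is finite, hence below some \<open>n\<close> with probability
  close to 1. A normal variable that is at most \<open>n\<close> with probability close to 1 has a standard deviation
  of at most \<open>n\<close>.\<close>
lemma increments_L2_Lipschitz:
  assumes D: "countable D"
    and lip: "\<And>\<omega>. \<omega> \<in> space M \<Longrightarrow> \<exists>L. \<forall>s\<in>D. \<forall>t\<in>D. \<bar>X s \<omega> - X t \<omega>\<bar> \<le> L * \<bar>s - t\<bar>"
  obtains K where "K \<ge> 0"
    "\<And>s t. s \<in> D \<Longrightarrow> t \<in> D \<Longrightarrow> expectation (\<lambda>\<omega>. (X s \<omega> - X t \<omega>)\<^sup>2) \<le> K\<^sup>2 * (s - t)\<^sup>2"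
proof -
  define E where "E = (\<lambda>n::nat. {\<omega>\<in>space M. \<forall>s\<in>D. \<forall>t\<in>D. \<bar>X s \<omega> - X t \<omega>\<bar> \<le> real n * \<bar>s - t\<bar>})"
  have E: "E n \<in> sets M" for n
    unfolding E_def by (intro sets.sets_Collect_countable_All' D) measurable
  have weaken: "x \<le> l' * \<bar>s - t\<bar>" if "x \<le> l * \<bar>s - t\<bar>" "l \<le> l'" for x l l' s t :: real
    using that by (meson abs_ge_zero mult_right_mono order_trans)
  have "incseq E"
  proof (rule incseq_SucI)
    fix n show "E n \<subseteq> E (Suc n)"
      unfolding E_def using weaken[of _ "real n" _ _ "real (Suc n)"] by auto
  qed
  then have "(\<lambda>n. prob (E n)) \<longlonglongrightarrow> prob (\<Union>n. E n)"
    using E by (intro finite_Lim_measure_incseq) auto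
  moreover have "(\<Union>n. E n) = space M"
  proof -
    have "\<exists>n. \<omega> \<in> E n" if \<omega>: "\<omega> \<in> space M" for \<omega>
    proof -
      obtain L where L: "\<And>s t. s \<in> D \<Longrightarrow> t \<in> D \<Longrightarrow> \<bar>X s \<omega> - X t \<omega>\<bar> \<le> L * \<bar>s - t\<bar>"
        using lip[OF \<omega>] by blast
      obtain n :: nat where "L \<le> real n" using real_arch_simple by blast
      then have "\<omega> \<in> E n"
        using \<omega> L weaken[of _ L _ _ "real n"] by (auto simp: E_def)
      then show ?thesis ..
    qed
    then show ?thesis by (auto simp: E_def)
  qed
  ultimately have lim: "(\<lambda>n. prob (E n)) \<longlonglongrightarrow> 1" by (simp add: prob_space)
  interpret N: prob_space std_normal_distribution by simp
  \<comment> \<open>The probability that a nondegenerate centered normal variable exceeds its own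
    standard deviation.\<close>
  define p where "p = N.prob {1<..}"
  have "p > 0"
  proof -
    have "emeasure std_normal_distribution {1<..<2} \<le> emeasure std_normal_distribution {1<..}"
      by (rule emeasure_mono) auto
    then have "emeasure std_normal_distribution {1<..} \<noteq> 0"
      using normal_interval_nonzero[of 1 1 2 0] by auto
    then have "p \<noteq> 0" by (simp add: p_def N.emeasure_eq_measure)
    then show ?thesis by (simp add: p_def zero_less_measure_iff)
  qed
  then have "eventually (\<lambda>n. prob (E n) > 1 - p) sequentially"
    using lim by (intro order_tendstoD) auto
  then obtain n where n: "prob (E n) > 1 - p"
    by (auto simp: eventually_sequentially)
  show thesis
  proof (rule that[of "real n"])
    fix s t assume st: "s \<in> D" "t \<in> D"
    define Z where "Z = (\<lambda>\<omega>. X s \<omega> - X t \<omega>)"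
    have Z: "Z \<in> lin_span"
      unfolding Z_def by (intro lin_span_diff X_in_lin_span)
    note [measurable] = lin_span_measurable[OF Z]
    define \<sigma> where "\<sigma> = sqrt (expectation (\<lambda>\<omega>. (Z \<omega>)\<^sup>2))"
    have Zn: "normal_rv M \<sigma> Z" unfolding \<sigma>_def by (rule lin_span_normal_rv[OF Z])
    have "\<sigma> \<le> real n * \<bar>s - t\<bar>"
    proof (rule ccontr)
      assume "\<not> \<sigma> \<le> real n * \<bar>s - t\<bar>"
      then have \<sigma>: "\<sigma> > real n * \<bar>s - t\<bar>" by simp
      moreover have "real n * \<bar>s - t\<bar> \<ge> 0" by simp
      ultimately have "\<sigma> > 0" by linarith
      then have "{x. \<sigma> * x \<in> {\<sigma><..}} = {1<..}" by auto
      then have "prob {\<omega>\<in>space M. Z \<omega> \<in> {\<sigma><..}} = p"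
        using normal_rv_emeasure[OF Zn, of "{\<sigma><..}"]
        by (simp add: emeasure_eq_measure N.emeasure_eq_measure p_def)
      \<comment> \<open>Beyond its standard deviation \<open>Z\<close> violates the Lipschitz bound
        n, so mass \<open>p\<close> would lie outside \<open>E n\<close>, whose complement has mass
        below \<open>p\<close>.\<close>
      moreover have "prob {\<omega>\<in>space M. Z \<omega> \<in> {\<sigma><..}} \<le> prob (space M - E n)"
      proof (rule finite_measure_mono)
        show "{\<omega>\<in>space M. Z \<omega> \<in> {\<sigma><..}} \<subseteq> space M - E n"
          using \<sigma> st by (force simp: E_def Z_def)
      qed (use E in auto)
      ultimately show False using n prob_compl[OF E, of n] by simp
    qed
    moreover have "\<sigma> \<ge> 0" by (simp add: \<sigma>_def)
    ultimately have "\<sigma>\<^sup>2 \<le> (real n * \<bar>s - t\<bar>)\<^sup>2" by (rule power_mono)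
    then show "expectation (\<lambda>\<omega>. (X s \<omega> - X t \<omega>)\<^sup>2) \<le> (real n)\<^sup>2 * (s - t)\<^sup>2"
      by (simp add: \<sigma>_def Z_def power_mult_distrib)
  qed simp
qed

lemma lin_span_exp_square_le:
  assumes "Z \<in> lin_span" "4 * c * expectation (\<lambda>\<omega>. (Z \<omega>)\<^sup>2) \<le> 1"
  shows "(\<integral>\<^sup>+\<omega>. ennreal (exp (c * (Z \<omega>)\<^sup>2)) \<partial>M) \<le> 2"
  by (rule normal_rv_exp_square_le[OF lin_span_normal_rv[OF assms(1)]]) (use assms(2) in simp)

text \<open>The variation along the \<open>n\<close>-th dyadic grid has an exponential square moment that is bounded
  in \<open>n\<close>, by Jensen's inequality. It controls the oscillation on the grid.\<close>
lemma dyadic_sup_tail: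
  assumes "a < b" and Y: "\<And>t. Y t \<in> lin_span"
    and K: "K \<ge> 0" "\<And>s t. s \<in> dyadics a b \<Longrightarrow> t \<in> dyadics a b \<Longrightarrow>
      expectation (\<lambda>\<omega>. (Y s \<omega> - Y t \<omega>)\<^sup>2) \<le> K\<^sup>2 * (s - t)\<^sup>2"
  obtains c where "c > 0"
    "\<And>z. z \<ge> 0 \<Longrightarrow> prob {\<omega>\<in>space M. \<exists>t\<in>dyadics a b. \<bar>Y t \<omega>\<bar> > z} \<le> 4 * exp (- c * z\<^sup>2)"
proof -
  note [measurable] = lin_span_measurable[OF Y]
  define v where "v = expectation (\<lambda>\<omega>. (Y a \<omega>)\<^sup>2)"
  have v: "v \<ge> 0" by (simp add: v_def)
  \<comment> \<open>\<kappa> bounds the variance of Y_a and of each grid increment scaled by the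
    number of cells; the 1 keeps it positive. \<open>c\<close> is the largest constant that
    \<open>lin_span_exp_square_le\<close> admits for variance \<kappa>.\<close>
  define \<kappa> where "\<kappa> = (K * (b - a))\<^sup>2 + v + 1"
  define c where "c = 1 / (4 * \<kappa>)"
  have \<kappa>: "\<kappa> > 0" "\<kappa> \<ge> (K * (b - a))\<^sup>2" "\<kappa> \<ge> v" using v by (auto simp: \<kappa>_def add_nonneg_pos)
  have c: "c > 0" "4 * c * x \<le> 1" if "x \<le> \<kappa>" for x
    using \<kappa> that by (auto simp: c_def divide_le_eq)
  define d where "d = (\<lambda>n k \<omega>. Y (dyadic a b n (Suc k)) \<omega> - Y (dyadic a b n k) \<omega>)"
  have d: "d n k \<in> lin_span" for n k
    unfolding d_def by (intro lin_span_diff Y)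
  note [measurable] = lin_span_measurable[OF d]
  define TV where "TV = (\<lambda>n \<omega>. \<Sum>k<2^n. \<bar>d n k \<omega>\<bar>)"
  have [measurable]: "TV n \<in> borel_measurable M" for n
    unfolding TV_def by measurable
  have TV_exp: "(\<integral>\<^sup>+\<omega>. ennreal (exp (c * (TV n \<omega>)\<^sup>2)) \<partial>M) \<le> 2" for n
  proof -
    let ?N = "2 ^ n :: nat"
    have "(\<integral>\<^sup>+\<omega>. ennreal (exp (c * (TV n \<omega>)\<^sup>2)) \<partial>M) \<le>
        (\<integral>\<^sup>+\<omega>. (\<Sum>k<?N. ennreal (1 / real ?N) * ennreal (exp (c * (real ?N * d n k \<omega>)\<^sup>2))) \<partial>M)"
    proof (intro nn_integral_mono)
      fix \<omega>
      have "ennreal (exp (c * (TV n \<omega>)\<^sup>2)) \<le>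
          ennreal (\<Sum>k<?N. (1 / real ?N) * exp (c * (real ?N * d n k \<omega>)\<^sup>2))"
        unfolding TV_def using exp_square_sum_le[of c ?N "\<lambda>k. d n k \<omega>"] c(1)[OF order_refl]
        by (intro ennreal_leI) auto
      then show "ennreal (exp (c * (TV n \<omega>)\<^sup>2)) \<le>
          (\<Sum>k<?N. ennreal (1 / real ?N) * ennreal (exp (c * (real ?N * d n k \<omega>)\<^sup>2)))"
        by (simp add: sum_ennreal del: of_nat_power flip: ennreal_mult')
    qed
    also have "\<dots> = (\<Sum>k<?N. ennreal (1 / real ?N) * (\<integral>\<^sup>+\<omega>. ennreal (exp (c * (real ?N * d n k \<omega>)\<^sup>2)) \<partial>M))"
      by (subst nn_integral_sum) (auto simp: nn_integral_cmult simp del: of_nat_power)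
    also have "\<dots> \<le> (\<Sum>k<?N. ennreal (1 / real ?N) * 2)"
    proof (intro sum_mono mult_left_mono)
      fix k assume "k \<in> {..<?N}"
      then have in_D: "dyadic a b n (Suc k) \<in> dyadics a b" "dyadic a b n k \<in> dyadics a b"
        by (auto intro: dyadic_in_dyadics)
      \<comment> \<open>Variances of increments are quadratic in the distance, so the factor 2^n
        cancels the mesh (b - a)/2^n and the bound does not depend on n.\<close>
      have "expectation (\<lambda>\<omega>. (real ?N * d n k \<omega>)\<^sup>2) = (real ?N)\<^sup>2 * expectation (\<lambda>\<omega>. (d n k \<omega>)\<^sup>2)"
        by (simp add: power_mult_distrib del: of_nat_power)
      also have "\<dots> \<le> (real ?N)\<^sup>2 * (K\<^sup>2 * ((b - a) / 2 ^ n)\<^sup>2)"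
        using K(2)[OF in_D] by (intro mult_left_mono) (auto simp: d_def dyadic_diff)
      also have "\<dots> = (K * (b - a))\<^sup>2"
        by (simp add: power_mult_distrib power_divide)
      finally have "expectation (\<lambda>\<omega>. (real ?N * d n k \<omega>)\<^sup>2) \<le> \<kappa>" using \<kappa> by linarith
      then show "(\<integral>\<^sup>+\<omega>. ennreal (exp (c * (real ?N * d n k \<omega>)\<^sup>2)) \<partial>M) \<le> 2"
        by (intro lin_span_exp_square_le lin_span_scale d c)
    qed simp
    also have "\<dots> = (\<Sum>k<?N. ennreal (1 / real ?N * 2))"
      by (subst ennreal_mult') auto
    also have "\<dots> = ennreal (\<Sum>k<?N. 1 / real ?N * 2)"
      by (rule sum_ennreal) simp
    also have "\<dots> = 2" by simp
    finally show ?thesis .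
  qed
  define G where "G = (\<lambda>n z. {\<omega>\<in>space M. \<exists>k\<in>{..2^n}. \<bar>Y (dyadic a b n k) \<omega>\<bar> > z})"
  have [measurable]: "G n z \<in> sets M" for n z
    unfolding G_def by measurable
  have G: "prob (G n (2 * z)) \<le> 4 * exp (- c * z\<^sup>2)" if z: "z \<ge> 0" for n z
  proof -
    have "G n (2 * z) \<subseteq> {\<omega>\<in>space M. \<bar>Y a \<omega>\<bar> > z} \<union> {\<omega>\<in>space M. \<bar>TV n \<omega>\<bar> > z}"
    proof
      fix \<omega> assume "\<omega> \<in> G n (2 * z)"
      then obtain k where k: "k \<le> 2 ^ n" "\<bar>Y (dyadic a b n k) \<omega>\<bar> > 2 * z" and \<omega>: "\<omega> \<in> space M"
        by (auto simp: G_def)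
      \<comment> \<open>Point 0 of every grid is \<open>a\<close>, so each value on the grid differs
        from Y_a by at most the variation.\<close>
      have "Y (dyadic a b n k) \<omega> - Y (dyadic a b n 0) \<omega> = (\<Sum>i<k. d n i \<omega>)"
        unfolding d_def by (rule sum_lessThan_telescope[symmetric])
      also have "\<bar>\<dots>\<bar> \<le> (\<Sum>i<k. \<bar>d n i \<omega>\<bar>)" by (rule sum_abs)
      also have "\<dots> \<le> TV n \<omega>"
        unfolding TV_def using k by (intro sum_mono2) auto
      finally have "\<bar>Y (dyadic a b n k) \<omega>\<bar> \<le> \<bar>Y a \<omega>\<bar> + \<bar>TV n \<omega>\<bar>"
        by (simp add: dyadic_def)
      then show "\<omega> \<in> {\<omega>\<in>space M. \<bar>Y a \<omega>\<bar> > z} \<union> {\<omega>\<in>space M. \<bar>TV n \<omega>\<bar> > z}"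
        using k \<omega> by auto
    qed
    then have "prob (G n (2 * z)) \<le> prob ({\<omega>\<in>space M. \<bar>Y a \<omega>\<bar> > z} \<union> {\<omega>\<in>space M. \<bar>TV n \<omega>\<bar> > z})"
      by (intro finite_measure_mono) measurable
    also have "\<dots> \<le> prob {\<omega>\<in>space M. \<bar>Y a \<omega>\<bar> > z} + prob {\<omega>\<in>space M. \<bar>TV n \<omega>\<bar> > z}"
      by (intro measure_Un_le) measurable
    also have "\<dots> \<le> 2 * exp (- c * z\<^sup>2) + 2 * exp (- c * z\<^sup>2)"
    proof (intro add_mono)
      have "(\<integral>\<^sup>+\<omega>. ennreal (exp (c * (Y a \<omega>)\<^sup>2)) \<partial>M) \<le> 2"
        using \<kappa> by (intro lin_span_exp_square_le Y c) (auto simp: v_def)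
      then show "prob {\<omega>\<in>space M. \<bar>Y a \<omega>\<bar> > z} \<le> 2 * exp (- c * z\<^sup>2)"
        using nn_exp_square_tail[of "Y a" M c z] z c(1)[OF order_refl] by (simp add: emeasure_eq_measure)
      show "prob {\<omega>\<in>space M. \<bar>TV n \<omega>\<bar> > z} \<le> 2 * exp (- c * z\<^sup>2)"
        using nn_exp_square_tail[of "TV n" M c z, OF _ TV_exp] z c(1)[OF order_refl] by (simp add: emeasure_eq_measure)
    qed
    finally show ?thesis by simp
  qed
  show thesis
  \<comment> \<open>A value above z needs Y_a or the variation above z/2, which turns
    \<open>c\<close> into c/4. The grids are nested, so continuity from below carries the uniform
    bound to all dyadic points.\<close>
  proof (rule that[of "c / 4"])
    show "c / 4 > 0" using c(1)[OF order_refl] by simp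
    fix z :: real assume z: "z \<ge> 0"
    have "incseq (\<lambda>n. G n z)"
    proof (rule incseq_SucI)
      fix n show "G n z \<subseteq> G (Suc n) z"
      proof
        fix \<omega> assume "\<omega> \<in> G n z"
        then obtain k where "k \<le> 2 ^ n" "\<bar>Y (dyadic a b n k) \<omega>\<bar> > z" and "\<omega> \<in> space M"
          by (auto simp: G_def)
        then show "\<omega> \<in> G (Suc n) z"
          unfolding G_def by (auto intro!: bexI[of _ "2 * k"] simp: dyadic_Suc)
      qed
    qed
    then have "(\<lambda>n. prob (G n z)) \<longlonglongrightarrow> prob (\<Union>n. G n z)"
      by (intro finite_Lim_measure_incseq) auto
    moreover have "(\<Union>n. G n z) = {\<omega>\<in>space M. \<exists>t\<in>dyadics a b. \<bar>Y t \<omega>\<bar> > z}"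
      by (auto simp: G_def dyadics_def)
    moreover have "prob (G n z) \<le> 4 * exp (- (c / 4) * z\<^sup>2)" for n
      using G[of "z / 2" n] z by (simp add: power_divide)
    ultimately show "prob {\<omega>\<in>space M. \<exists>t\<in>dyadics a b. \<bar>Y t \<omega>\<bar> > z} \<le> 4 * exp (- (c / 4) * z\<^sup>2)"
      by (metis LIMSEQ_le_const2)
  qed
qed

end

section \<open>The energy problem\<close>

lemma (in real_distribution) integral_finite_support:
  fixes f :: "real \<Rightarrow> real"
  assumes S: "finite S" "AE x in M. x \<in> S" and [measurable]: "f \<in> borel_measurable borel"
  shows "integral\<^sup>L M f = (\<Sum>s\<in>S. measure M {s} * f s)"
proof -
  have eq: "f x = (\<Sum>s\<in>S. indicator {s} x * f s)" if "x \<in> S" for x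
  proof -
    have "(\<Sum>s\<in>S. indicator {s} x * f s) = (\<Sum>s\<in>S. if x = s then f s else 0)"
      by (intro sum.cong) (auto simp: indicator_def)
    then show ?thesis using that S by simp
  qed
  have [simp]: "integrable M (indicator {s} :: real \<Rightarrow> real)" for s
    by (rule integrable_real_indicator) (auto simp: emeasure_eq_measure)
  have "integral\<^sup>L M f = (\<integral>x. (\<Sum>s\<in>S. indicator {s} x * f s) \<partial>M)"
  proof (rule integral_cong_AE)
    show "AE x in M. f x = (\<Sum>s\<in>S. indicator {s} x * f s)"
      using S(2) by eventually_elim (rule eq)
  qed simp_all
  also have "\<dots> = (\<Sum>s\<in>S. (\<integral>x. indicator {s} x * f s \<partial>M))"
    by (rule Bochner_Integration.integral_sum) simp
  also have "\<dots> = (\<Sum>s\<in>S. measure M {s} * f s)"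
    by simp
  finally show ?thesis .
qed

lemma energy_finite_support:
  assumes \<nu>: "real_distribution \<nu>" and S: "finite S" "S \<subseteq> {a..b}" "AE x in \<nu>. x \<in> S"
    and R: "\<And>s. R s \<in> borel_measurable borel" "\<And>s t. R s t = R t s"
  shows "energy R a b \<nu> = (\<Sum>s\<in>S. \<Sum>t\<in>S. measure \<nu> {s} * measure \<nu> {t} * R s t)"
proof -
  interpret real_distribution \<nu> by fact
  note [measurable] = R(1)
  have [measurable]: "(\<lambda>s. R s t) \<in> borel_measurable borel" for t
    using R(1)[of t] by (simp add: R(2)[of _ t])
  have ind: "indicator {a..b} s = (1::real)" if "s \<in> S" for s
    using that S by auto
  have "energy R a b \<nu> = (\<integral>s. indicator {a..b} s * (\<Sum>t\<in>S. measure \<nu> {t} * R s t) \<partial>\<nu>)"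
    unfolding energy_def set_lebesgue_integral_def
    by (subst integral_finite_support[OF S(1,3)]) (simp_all add: ind)
  also have "\<dots> = (\<Sum>s\<in>S. measure \<nu> {s} * (\<Sum>t\<in>S. measure \<nu> {t} * R s t))"
    by (subst integral_finite_support[OF S(1,3)]) (simp_all add: ind)
  finally show ?thesis by (simp add: sum_distrib_left mult.assoc)
qed

text \<open>Supplies the competitors of the minimizer and, in the entire case, the measures on which
  positivity of the energy is evaluated.\<close>

lemma ex_finite_support_distribution:
  fixes w :: "real \<Rightarrow> real"
  assumes T: "finite T" "T \<subseteq> {a..b}" and w: "\<And>x. x \<in> T \<Longrightarrow> w x \<ge> 0" "(\<Sum>x\<in>T. w x) = 1"
  obtains \<nu> where "\<nu> \<in> prob_on a b" "AE x in \<nu>. x \<in> T" "\<And>x. x \<in> T \<Longrightarrow> measure \<nu> {x} = w x"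
proof
  define \<nu> where "\<nu> = distr (point_measure T (\<lambda>x. ennreal (w x))) borel (\<lambda>x. x)"
  have em: "emeasure \<nu> B = ennreal (\<Sum>x\<in>B \<inter> T. w x)" if "B \<in> sets borel" for B
  proof -
    have "emeasure \<nu> B = (\<Sum>x\<in>B \<inter> T. ennreal (w x))"
      using that T unfolding \<nu>_def
      by (subst emeasure_distr) (auto simp: measurable_point_measure_eq1 space_point_measure
          intro!: emeasure_point_measure_finite)
    also have "\<dots> = ennreal (\<Sum>x\<in>B \<inter> T. w x)" using w by (intro sum_ennreal) auto
    finally show ?thesis .
  qed
  have ps: "prob_space \<nu>"
  proof
    show "emeasure \<nu> (space \<nu>) = 1" using em[of UNIV] w by (simp add: \<nu>_def)
  qed
  then have rd: "real_distribution \<nu>"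
    by (simp add: real_distribution_def real_distribution_axioms_def \<nu>_def)
  interpret real_distribution \<nu> by fact
  have "T \<in> sets borel" using T(1) by (intro borel_closed finite_imp_closed)
  show "AE x in \<nu>. x \<in> T"
  proof (rule AE_I')
    show "- T \<in> null_sets \<nu>"
      using em[of "- T"] \<open>T \<in> sets borel\<close> by (auto simp: null_sets_def borel_comp)
  qed auto
  have "{a..b} \<inter> T = T" using T by auto
  then have "measure \<nu> {a..b} = 1" using em[of "{a..b}"] w by (simp add: emeasure_eq_measure)
  then show "\<nu> \<in> prob_on a b" using rd by (simp add: prob_on_def)
  fix x assume x: "x \<in> T"
  then have "{x} \<inter> T = {x}" by auto
  then show "measure \<nu> {x} = w x" using em[of "{x}"] w x by (simp add: emeasure_eq_measure)
qed

text \<open>Each point off the support has a null open neighbourhood; by Lindelof countably many of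
  these cover the complement.\<close>

lemma AE_in_measure_support:
  assumes "real_distribution \<nu>"
  shows "AE x in \<nu>. x \<in> measure_support \<nu>"
proof -
  interpret real_distribution \<nu> by fact
  define F where "F = {U. open U \<and> emeasure \<nu> U = 0}"
  obtain F' where F': "F' \<subseteq> F" "countable F'" "\<Union>F' = \<Union>F"
    using Lindelof[of F] by (auto simp: F_def)
  have "(\<Union>U\<in>F'. U) \<in> null_sets \<nu>"
    by (rule null_sets_UN'[OF F'(2)]) (use F'(1) in \<open>auto simp: F_def null_sets_def\<close>)
  moreover have "- measure_support \<nu> \<subseteq> \<Union>F"
    by (auto simp: measure_support_def F_def not_gr_zero)
  ultimately show ?thesis
    using F'(3) by (intro AE_I'[where N = "\<Union>F"]) auto
qed

lemma measure_support_subset: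
  assumes "\<nu> \<in> prob_on a b"
  shows "measure_support \<nu> \<subseteq> {a..b}"
proof
  interpret real_distribution \<nu> using assms by (simp add: prob_on_def)
  fix x assume x: "x \<in> measure_support \<nu>"
  have "prob (- {a..b}) = 0"
    using assms prob_compl[of "{a..b}"] by (simp add: prob_on_def Compl_eq_Diff_UNIV)
  then have "emeasure \<nu> (- {a..b}) = 0" by (simp add: emeasure_eq_measure)
  moreover have "open (- {a..b})" by (simp add: open_Compl)
  ultimately show "x \<in> {a..b}" using x by (auto simp: measure_support_def)
qed

section \<open>Energies as second moments\<close>

context centered_gaussian
begin

lemma cov_fun_commute: "cov_fun M X s t = cov_fun M X t s"
  by (simp add: cov_fun_def mult.commute)

text \<open>Continuous paths make \<open>X\<close> jointly measurable, as the limit of its values at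
  times rounded down to multiples of 1/(n+1); integrating out \<omega> preserves measurability in t.
  The evaluation of \<open>energy\<close> rests on this.\<close>

lemma measurable_cov_fun:
  assumes "continuous_paths M X"
  shows "cov_fun M X s \<in> borel_measurable borel"
proof -
  have X: "(\<lambda>p. X (fst p) (snd p)) \<in> borel_measurable (borel \<Otimes>\<^sub>M M)"
  proof (rule borel_measurable_LIMSEQ_real)
    fix n :: nat
    show "(\<lambda>p. X (real_of_int \<lfloor>fst p * (real n + 1)\<rfloor> / (real n + 1)) (snd p)) \<in> borel_measurable (borel \<Otimes>\<^sub>M M)"
      by (rule measurable_compose_countable[where f = "\<lambda>i p. X (real_of_int i / (real n + 1)) (snd p)"])
        measurable
  next
    fix p :: "real \<times> 'w" assume "p \<in> space (borel \<Otimes>\<^sub>M M)"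
    then have "continuous_on UNIV (\<lambda>t. X t (snd p))"
      using assms by (auto simp: continuous_paths_def space_pair_measure)
    then have "isCont (\<lambda>t. X t (snd p)) (fst p)"
      by (simp add: continuous_on_eq_continuous_at)
    moreover have "(\<lambda>n. real_of_int \<lfloor>fst p * (real n + 1)\<rfloor> / (real n + 1)) \<longlonglongrightarrow> fst p"
      by real_asymp
    ultimately show "(\<lambda>n. X (real_of_int \<lfloor>fst p * (real n + 1)\<rfloor> / (real n + 1)) (snd p)) \<longlonglongrightarrow> X (fst p) (snd p)"
      by (rule isCont_tendsto_compose)
  qed
  have "(\<lambda>(t, \<omega>). X s \<omega> * X t \<omega>) \<in> borel_measurable (borel \<Otimes>\<^sub>M M)"
    using X by (simp add: case_prod_beta') measurable
  then have "(\<lambda>t. \<integral>\<omega>. X s \<omega> * X t \<omega> \<partial>M) \<in> borel_measurable borel"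
    by (rule borel_measurable_lebesgue_integral)
  then show ?thesis by (simp add: cov_fun_def[abs_def])
qed

lemma second_moment_sum:
  assumes "finite S"
  shows "expectation (\<lambda>\<omega>. (\<Sum>s\<in>S. w s * X s \<omega>)\<^sup>2) = (\<Sum>s\<in>S. \<Sum>t\<in>S. w s * w t * cov_fun M X s t)"
proof -
  have "(\<lambda>\<omega>. (\<Sum>s\<in>S. w s * X s \<omega>)\<^sup>2) = (\<lambda>\<omega>. \<Sum>s\<in>S. \<Sum>t\<in>S. w s * w t * (X s \<omega> * X t \<omega>))"
    by (auto simp: power2_eq_square sum_product mult_ac)
  then show ?thesis
    using lin_span_mult_integrable[OF X_in_lin_span X_in_lin_span] by (simp add: cov_fun_def)
qed

lemma energy_eq_second_moment:
  assumes "continuous_paths M X" "real_distribution \<nu>" "finite S" "S \<subseteq> {a..b}" "AE x in \<nu>. x \<in> S"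
  shows "energy (cov_fun M X) a b \<nu> = expectation (\<lambda>\<omega>. (\<Sum>s\<in>S. measure \<nu> {s} * X s \<omega>)\<^sup>2)"
  unfolding second_moment_sum[OF assms(3)]
  by (rule energy_finite_support[OF assms(2-5) measurable_cov_fun[OF assms(1)] cov_fun_commute])

text \<open>The energy does not decrease when mass is moved from \<open>\<nu>\<close> to \<open>t\<close>.\<close>
lemma energy_minimizer_first_order:
  assumes cont: "continuous_paths M X" and min: "is_energy_minimizer (cov_fun M X) a b \<nu>"
    and S: "finite S" "S \<subseteq> {a..b}" "AE x in \<nu>. x \<in> S" and t: "t \<in> {a..b}"
  shows "energy (cov_fun M X) a b \<nu> \<le> expectation (\<lambda>\<omega>. (\<Sum>s\<in>S. measure \<nu> {s} * X s \<omega>) * X t \<omega>)"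
proof (rule ccontr)
  have \<nu>: "\<nu> \<in> prob_on a b"
    and le: "\<And>\<nu>'. \<nu>' \<in> prob_on a b \<Longrightarrow> energy (cov_fun M X) a b \<nu> \<le> energy (cov_fun M X) a b \<nu>'"
    using min by (auto simp: is_energy_minimizer_def is_arg_min_def not_less)
  interpret \<nu>: real_distribution \<nu> using \<nu> by (simp add: prob_on_def)
  define V where "V = energy (cov_fun M X) a b \<nu>"
  define W where "W = (\<lambda>\<omega>. \<Sum>s\<in>S. measure \<nu> {s} * X s \<omega>)"
  have W: "W \<in> lin_span" unfolding W_def by (rule lin_span_sum[OF S(1)])
  have V: "V = expectation (\<lambda>\<omega>. (W \<omega>)\<^sup>2)"
    unfolding V_def W_def by (rule energy_eq_second_moment[OF cont \<nu>.real_distribution_axioms S])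
  define q where "q = expectation (\<lambda>\<omega>. W \<omega> * X t \<omega>)"
  assume "\<not> ?thesis"
  then have qV: "q < V" by (simp add: q_def V_def W_def)
  have mass: "(\<Sum>s\<in>S. measure \<nu> {s}) = 1"
    using \<nu>.integral_finite_support[OF S(1,3), of "\<lambda>_. 1"] \<nu>.prob_space by simp
  define r where "r = expectation (\<lambda>\<omega>. (X t \<omega>)\<^sup>2)"
  \<comment> \<open>The right-hand side is the energy of the mixture of \<nu> and the unit mass at
    \<open>t\<close> with weights 1 - \<epsilon> and \<epsilon>, that is, the second moment of (1 -
    \<epsilon>) W + \<epsilon> X_t.\<close>
  have perturbed: "V \<le> (1 - \<epsilon>)\<^sup>2 * V + 2 * (1 - \<epsilon>) * \<epsilon> * q + \<epsilon>\<^sup>2 * r" if \<epsilon>: "0 < \<epsilon>" "\<epsilon> < 1" for \<epsilon>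
  proof -
    \<comment> \<open>\<open>t\<close> may already lie in \<open>S\<close>, so the two contributions
      are added in one weight.\<close>
    define w where "w = (\<lambda>x. (1 - \<epsilon>) * (if x \<in> S then measure \<nu> {x} else 0) + \<epsilon> * (if x = t then 1 else 0))"
    define T where "T = insert t S"
    have T: "finite T" "T \<subseteq> {a..b}" using S t by (auto simp: T_def)
    have split: "(\<Sum>x\<in>T. w x * f x) = (1 - \<epsilon>) * (\<Sum>x\<in>S. measure \<nu> {x} * f x) + \<epsilon> * f t" for f :: "real \<Rightarrow> real"
    proof -
      have "(\<Sum>x\<in>T. w x * f x) = (1 - \<epsilon>) * (\<Sum>x\<in>T. (if x \<in> S then measure \<nu> {x} else 0) * f x)
          + \<epsilon> * (\<Sum>x\<in>T. (if x = t then 1 else 0) * f x)"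
        unfolding sum_distrib_left sum.distrib[symmetric]
        by (intro sum.cong refl) (simp only: w_def distrib_right mult.assoc)
      also have "(\<Sum>x\<in>T. (if x \<in> S then measure \<nu> {x} else 0) * f x) = (\<Sum>x\<in>S. measure \<nu> {x} * f x)"
        using T by (intro sum.mono_neutral_cong_right) (auto simp: T_def)
      also have "(\<Sum>x\<in>T. (if x = t then 1 else 0) * f x) = f t"
        using T by (simp add: if_distrib[of "\<lambda>z. z * _"] T_def cong: if_cong)
      finally show ?thesis .
    qed
    have "w x \<ge> 0" for x using \<epsilon> by (simp add: w_def)
    moreover have "(\<Sum>x\<in>T. w x) = 1" using split[of "\<lambda>_. 1"] mass by simp
    ultimately obtain \<nu>' where \<nu>': "\<nu>' \<in> prob_on a b" "AE x in \<nu>'. x \<in> T" "\<And>x. x \<in> T \<Longrightarrow> measure \<nu>' {x} = w x"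
      using ex_finite_support_distribution[OF T, of w] by metis
    have "V \<le> energy (cov_fun M X) a b \<nu>'" unfolding V_def by (rule le[OF \<nu>'(1)])
    also have "\<dots> = expectation (\<lambda>\<omega>. (\<Sum>s\<in>T. measure \<nu>' {s} * X s \<omega>)\<^sup>2)"
      using \<nu>' T by (intro energy_eq_second_moment cont) (auto simp: prob_on_def)
    also have "\<dots> = expectation (\<lambda>\<omega>. ((1 - \<epsilon>) * W \<omega> + \<epsilon> * X t \<omega>)\<^sup>2)"
      using \<nu>'(3) split[of "\<lambda>s. X s _"] by (simp add: W_def)
    also have "\<dots> = (1 - \<epsilon>)\<^sup>2 * V + 2 * (1 - \<epsilon>) * \<epsilon> * q + \<epsilon>\<^sup>2 * r"
      by (simp add: lin_span_second_moment[OF W X_in_lin_span] V q_def r_def)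
    finally show ?thesis .
  qed
  \<comment> \<open>The coefficient of \<epsilon>^2, nonnegative as the second moment of W -
    X_t.\<close>
  define C where "C = V - 2 * q + r"
  have "C = expectation (\<lambda>\<omega>. (1 * W \<omega> + (- 1) * X t \<omega>)\<^sup>2)"
    unfolding lin_span_second_moment[OF W X_in_lin_span] by (simp add: C_def V q_def r_def)
  then have C: "C \<ge> 0" by simp
  \<comment> \<open>Makes \<epsilon> C at most V - q, too small to offset the decrease 2 (V - q) of
    first order; the 1 guards against C = 0.\<close>
  define \<epsilon> where "\<epsilon> = min (1 / 2) ((V - q) / (C + 1))"
  have \<epsilon>: "0 < \<epsilon>" "\<epsilon> < 1" "\<epsilon> \<le> (V - q) / (C + 1)"
    using C qV by (auto simp: \<epsilon>_def)
  have "0 \<le> \<epsilon> * (\<epsilon> * C - 2 * (V - q))"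
    using perturbed[OF \<epsilon>(1,2)] by (simp add: C_def power2_eq_square algebra_simps)
  then have "2 * (V - q) \<le> \<epsilon> * C" using \<epsilon>(1) by (simp add: zero_le_mult_iff)
  also have "\<dots> \<le> V - q"
    using \<epsilon>(1,3) C by (simp add: pos_le_divide_eq algebra_simps)
  finally show False using qV by simp
qed

end

section \<open>The two cases and the conditional law\<close>

lemma smooth_paths_Lipschitz:
  assumes "smooth_paths M X" "\<omega> \<in> space M"
  shows "\<exists>L. \<forall>s\<in>{a..b}. \<forall>t\<in>{a..b}. \<bar>X s \<omega> - X t \<omega>\<bar> \<le> L * \<bar>s - t\<bar>"
proof -
  let ?f = "\<lambda>t. X t \<omega>"
  have d: "(deriv ^^ n) ?f differentiable_on UNIV" for n
    using assms by (simp add: smooth_paths_def)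
  have "continuous_on {a..b} (deriv ?f)"
    using differentiable_imp_continuous_on[OF d[of 1]] by (auto intro: continuous_on_subset)
  then have "compact (deriv ?f ` {a..b})" by (intro compact_continuous_image) auto
  then obtain B where B: "\<And>t. t \<in> {a..b} \<Longrightarrow> norm (deriv ?f t) \<le> B"
    using compact_imp_bounded bounded_iff by (metis imageI)
  have "(?f has_field_derivative deriv ?f t) (at t within {a..b})" for t
  proof -
    have "?f differentiable at t" using d[of 0] by (simp add: differentiable_on_def)
    then have "?f field_differentiable at t"
      using real_differentiable_def field_differentiable_def by blast
    then show ?thesis
      using field_differentiable_derivI has_field_derivative_at_within by blast
  qed
  then have "norm (?f s - ?f t) \<le> B * norm (s - t)" if "s \<in> {a..b}" "t \<in> {a..b}" for s t
    using field_differentiable_bound[of "{a..b}" ?f "deriv ?f" B s t] B that by auto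
  then show ?thesis unfolding real_norm_def by blast
qed

text \<open>The sum extends to an entire function of y. Zeros accumulating at \<open>x\<close> force
  it to vanish identically, and its value at 0 is the sum of the coefficients.\<close>

lemma exp_sum_zero_imp_sum_zero:
  fixes w :: "real \<Rightarrow> real"
  assumes S: "finite S" and x: "x islimpt Z"
    and zero: "\<And>y. y \<in> Z \<Longrightarrow> (\<Sum>s\<in>S. complex_of_real (w s) * exp (\<i> * complex_of_real (s * y))) = 0"
  shows "(\<Sum>s\<in>S. w s) = 0"
proof -
  define f where "f = (\<lambda>z. \<Sum>s\<in>S. complex_of_real (w s) * exp (\<i> * (complex_of_real s * z)))"
  have "f 0 = 0"
  proof (rule analytic_continuation[of f UNIV "complex_of_real ` Z" "complex_of_real x"])
    show "f holomorphic_on UNIV" unfolding f_def by (intro holomorphic_intros)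
    show "complex_of_real x islimpt complex_of_real ` Z"
      unfolding islimpt_sequential
    proof -
      obtain y where y: "\<forall>n. y n \<in> Z - {x}" "y \<longlonglongrightarrow> x"
        using x by (auto simp: islimpt_sequential)
      then show "\<exists>g. (\<forall>n. g n \<in> complex_of_real ` Z - {complex_of_real x}) \<and> g \<longlonglongrightarrow> complex_of_real x"
        by (intro exI[of _ "\<lambda>n. complex_of_real (y n)"]) (auto intro: tendsto_of_real)
    qed
    fix z assume "z \<in> complex_of_real ` Z"
    then show "f z = 0" using zero by (auto simp: f_def)
  qed auto
  then have "complex_of_real (\<Sum>s\<in>S. w s) = 0" by (simp add: f_def)
  then show ?thesis by (simp only: of_real_eq_0_iff)
qed

lemma cdf_exponential_measure:
  assumes "V > 0"
  shows "cdf (exponential_measure_of_mean V) x = (if x \<ge> 0 then 1 - exp (- x / V) else 0)"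
proof -
  have "emeasure (density lborel (\<lambda>x. ennreal (exponential_density (1 / V) x))) {..x} = ennreal (erlang_CDF 0 (1 / V) x)"
    using assms by (intro emeasure_erlang_density) simp
  then show ?thesis
    using assms by (simp add: cdf_def measure_def exponential_measure_of_mean_def erlang_CDF_0)
qed

context centered_gaussian
begin

text \<open>The spectral representation turns the second moment into the F-integral of
  \<bar>f\<bar>^2, where f(y) is the sum of w_s exp(i s y). Were it 0, then f would vanish almost
  everywhere, by continuity on the whole support, and the accumulation point would force the weights
  to sum to 0.\<close>

lemma spectral_second_moment_pos:
  assumes F: "is_spectral_measure M X F" and x: "x islimpt measure_support F"
    and S: "finite S" and w: "(\<Sum>s\<in>S. w s) \<noteq> 0"
  shows "expectation (\<lambda>\<omega>. (\<Sum>s\<in>S. w s * X s \<omega>)\<^sup>2) > 0"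
proof (rule ccontr)
  interpret F: finite_borel_measure F using F by (simp add: is_spectral_measure_def)
  have cov: "complex_of_real (cov_fun M X s t) = (\<integral>x. exp (\<i> * complex_of_real ((t - s) * x)) \<partial>F)" for s t
    using F by (simp add: is_spectral_measure_def)
  have sets_F: "sets F = sets borel" by (rule F.M_is_borel)
  have [measurable_cong]: "sets F = sets borel" by (rule sets_F)
  define f where "f = (\<lambda>y. \<Sum>s\<in>S. complex_of_real (w s) * exp (\<i> * complex_of_real (s * y)))"
  have cont_f: "continuous_on UNIV f" unfolding f_def by (intro continuous_intros)
  have [measurable]: "f \<in> borel_measurable borel" using cont_f by (rule borel_measurable_continuous_onI)
  have int_exp: "integrable F (\<lambda>y. exp (\<i> * complex_of_real (c * y)))" for c
    by (rule F.integrable_const_bound[where B = 1]) (auto simp del: of_real_mult)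
  have sq: "complex_of_real ((cmod (f y))\<^sup>2) =
      (\<Sum>s\<in>S. \<Sum>t\<in>S. complex_of_real (w s * w t) * exp (\<i> * complex_of_real ((t - s) * y)))" for y
  proof -
    have cnj: "cnj (f y) = (\<Sum>s\<in>S. complex_of_real (w s) * exp (- (\<i> * complex_of_real (s * y))))"
      by (simp add: f_def exp_cnj)
    have "complex_of_real ((cmod (f y))\<^sup>2) = cnj (f y) * f y"
      by (simp only: complex_norm_square mult.commute)
    also have "\<dots> = (\<Sum>s\<in>S. \<Sum>t\<in>S. (complex_of_real (w s) * exp (- (\<i> * complex_of_real (s * y)))) *
        (complex_of_real (w t) * exp (\<i> * complex_of_real (t * y))))"
      unfolding cnj unfolding f_def by (rule sum_product)
    also have "\<dots> = (\<Sum>s\<in>S. \<Sum>t\<in>S. complex_of_real (w s * w t) * exp (\<i> * complex_of_real ((t - s) * y)))"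
    proof (intro sum.cong refl)
      fix s t
      have "exp (\<i> * complex_of_real ((t - s) * y)) = exp (- (\<i> * complex_of_real (s * y))) * exp (\<i> * complex_of_real (t * y))"
        by (simp add: algebra_simps flip: exp_add)
      then show "(complex_of_real (w s) * exp (- (\<i> * complex_of_real (s * y)))) *
        (complex_of_real (w t) * exp (\<i> * complex_of_real (t * y))) =
        complex_of_real (w s * w t) * exp (\<i> * complex_of_real ((t - s) * y))"
        by simp
    qed
    finally show ?thesis .
  qed
  have "complex_of_real (\<integral>y. (cmod (f y))\<^sup>2 \<partial>F) = (\<integral>y. complex_of_real ((cmod (f y))\<^sup>2) \<partial>F)"
    by (rule integral_complex_of_real[symmetric])
  also have "\<dots> = (\<Sum>s\<in>S. \<Sum>t\<in>S. complex_of_real (w s * w t) * complex_of_real (cov_fun M X s t))"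
    unfolding sq using int_exp by (simp add: cov del: of_real_mult of_real_diff)
  also have "\<dots> = complex_of_real (expectation (\<lambda>\<omega>. (\<Sum>s\<in>S. w s * X s \<omega>)\<^sup>2))"
    by (simp add: second_moment_sum[OF S])
  finally have eq: "(\<integral>y. (cmod (f y))\<^sup>2 \<partial>F) = expectation (\<lambda>\<omega>. (\<Sum>s\<in>S. w s * X s \<omega>)\<^sup>2)"
    by (simp only: of_real_eq_iff)
  assume "\<not> ?thesis"
  moreover have "(\<integral>y. (cmod (f y))\<^sup>2 \<partial>F) \<ge> 0"
    by (rule Bochner_Integration.integral_nonneg) simp
  ultimately have "(\<integral>y. (cmod (f y))\<^sup>2 \<partial>F) = 0"
    using eq by linarith
  moreover have "integrable F (\<lambda>y. (cmod (f y))\<^sup>2)"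
  proof (rule F.integrable_const_bound[where B = "(\<Sum>s\<in>S. \<bar>w s\<bar>)\<^sup>2"])
    have "cmod (f y) \<le> (\<Sum>s\<in>S. \<bar>w s\<bar>)" for y
      unfolding f_def by (rule order_trans[OF norm_sum]) (simp add: norm_mult)
    then show "AE y in F. norm ((cmod (f y))\<^sup>2) \<le> (\<Sum>s\<in>S. \<bar>w s\<bar>)\<^sup>2"
      by (auto intro!: power_mono)
  qed measurable
  ultimately have AE0: "AE y in F. f y = 0"
    by (subst (asm) integral_nonneg_eq_0_iff_AE) auto
  have "f y = 0" if y: "y \<in> measure_support F" for y
  proof (rule ccontr)
    assume "f y \<noteq> 0"
    have "open (f -` (- {0}))"
      by (rule open_vimage) (use cont_f in auto)
    moreover have "y \<in> f -` (- {0})" using \<open>f y \<noteq> 0\<close> by simp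
    ultimately have "emeasure F (f -` (- {0})) > 0" using y by (simp add: measure_support_def)
    moreover have "emeasure F (f -` (- {0})) = 0"
    proof -
      have "f -` (- {0}) \<in> sets F" using \<open>open (f -` (- {0}))\<close> by (simp add: sets_F)
      moreover have "space F = UNIV" using sets_eq_imp_space_eq[OF sets_F] by simp
      ultimately show ?thesis
        using AE0 by (subst (asm) AE_iff_measurable[where N = "f -` (- {0})"]) auto
    qed
    ultimately show False by simp
  qed
  then have "(\<Sum>s\<in>S. w s) = 0"
    by (intro exp_sum_zero_imp_sum_zero[OF S x]) (simp add: f_def)
  then show False using w by simp
qed

text \<open>Used for a single point of the support, where it excludes a vanishing X_t, and for the
  weights of \<nu>, where it gives V > 0.\<close>

lemma second_moment_pos:
  assumes "entire_case M X a b \<or> stationary_case M X" and cont: "continuous_paths M X"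
    and S: "finite S" "S \<subseteq> {a..b}" and w: "\<And>s. s \<in> S \<Longrightarrow> w s \<ge> 0" "(\<Sum>s\<in>S. w s) = 1"
  shows "expectation (\<lambda>\<omega>. (\<Sum>s\<in>S. w s * X s \<omega>)\<^sup>2) > 0"
  using assms(1)
proof
  assume "entire_case M X a b"
  then have pos: "\<And>\<nu>. \<nu> \<in> prob_on a b \<Longrightarrow> energy (cov_fun M X) a b \<nu> > 0"
    unfolding entire_case_def by blast
  obtain \<nu> where \<nu>: "\<nu> \<in> prob_on a b" "AE x in \<nu>. x \<in> S" "\<And>x. x \<in> S \<Longrightarrow> measure \<nu> {x} = w x"
    using ex_finite_support_distribution[OF S, of w] w by metis
  have "energy (cov_fun M X) a b \<nu> = expectation (\<lambda>\<omega>. (\<Sum>s\<in>S. measure \<nu> {s} * X s \<omega>)\<^sup>2)"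
    using \<nu> S by (intro energy_eq_second_moment cont) (auto simp: prob_on_def)
  then show ?thesis using pos[OF \<nu>(1)] \<nu>(3) by simp
next
  assume "stationary_case M X"
  then obtain F x where "is_spectral_measure M X F" "x islimpt measure_support F"
    by (auto simp: stationary_case_def)
  then show ?thesis using spectral_second_moment_pos[OF _ _ S(1)] w by simp
qed

text \<open>A sum over an infinite set is 0, so for infinite \<open>S\<close> the hypothesis forces \<open>X\<^sub>t = 0\<close> for \<open>t \<in> S\<close>.\<close>
lemma cond_mean_imp_finite:
  assumes \<mu>: "is_cond_mean_at_one M X S \<mu>" and pos: "\<And>t. t \<in> S \<Longrightarrow> expectation (\<lambda>\<omega>. (X t \<omega>)\<^sup>2) > 0"
  shows "finite S"
proof (rule ccontr)
  assume inf: "infinite S"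
  then obtain t where t: "t \<in> S" by (metis finite.emptyI ex_in_conv)
  obtain \<alpha> where \<alpha>: "AE \<omega> in M. real_cond_exp M (sigma_of M X S) (X t) \<omega> = (\<Sum>s\<in>S. \<alpha> s * X s \<omega>)"
    using \<mu> by (auto simp: is_cond_mean_at_one_def)
  let ?g = "\<lambda>\<omega>. \<lambda>s\<in>S. X s \<omega>" and ?P = "\<Pi>\<^sub>M s\<in>S. borel :: real measure"
  have g: "?g \<in> measurable M ?P" by measurable
  have "subalgebra M (sigma_of M X S)"
    using g by (simp add: subalgebra_def sigma_of_def measurable_iff_sets)
  then interpret finite_measure_subalgebra M "sigma_of M X S"
    by unfold_locales
  have "?g \<in> measurable (sigma_of M X S) ?P"
    unfolding sigma_of_def using measurable_space[OF g] by (intro measurable_vimage_algebra1) auto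
  then have "(\<lambda>\<omega>. ?g \<omega> t) \<in> borel_measurable (sigma_of M X S)"
    using measurable_compose[OF _ measurable_component_singleton[OF t]] by blast
  \<comment> \<open>\<open>X t\<close> is one of the conditioning coordinates, hence its own
    conditional expectation.\<close>
  then have "X t \<in> borel_measurable (sigma_of M X S)" using t by simp
  then have "AE \<omega> in M. real_cond_exp M (sigma_of M X S) (X t) \<omega> = X t \<omega>"
    by (intro real_cond_exp_F_meas lin_span_integrable X_in_lin_span)
  with \<alpha> have "AE \<omega> in M. (X t \<omega>)\<^sup>2 = 0"
    by eventually_elim (use inf in simp)
  then have "expectation (\<lambda>\<omega>. (X t \<omega>)\<^sup>2) = expectation (\<lambda>_. 0)"
    by (intro integral_cong_AE) auto
  then show False using pos[OF t] by simp
qed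

end

section \<open>From the ratio of tails to the conditional law\<close>

context high_minimum
begin

theorem cond_law_converges:
  "weak_conv_along
     (\<lambda>u. cond_law M (\<lambda>\<omega>. path_min X a b \<omega> > u) (\<lambda>\<omega>. u * (path_min X a b \<omega> - u)))
     (exponential_measure_of_mean V) at_top"
  unfolding weak_conv_along_def
proof (intro allI impI)
  fix x :: real
  have [measurable]: "path_min X a b \<in> borel_measurable M"
    using pred_path_min by (subst borel_measurable_iff_greater) (simp add: pred_def)
  define A where "A = (\<lambda>u. {\<omega>\<in>space M. path_min X a b \<omega> > u})"
  have [measurable]: "A u \<in> sets M" for u
    unfolding A_def by measurable
  \<comment> \<open>Conditioning by \<open>uniform_measure\<close> is meaningful only on an event of
    positive probability; \<open>g_pos\<close> provides this for all large u.\<close>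
  have cdf_eq: "cdf (cond_law M (\<lambda>\<omega>. path_min X a b \<omega> > u) (\<lambda>\<omega>. u * (path_min X a b \<omega> - u))) x =
      prob (A u \<inter> {\<omega>\<in>space M. u * (path_min X a b \<omega> - u) \<le> x}) / g u" if "g u > 0" for u
  proof -
    let ?Y = "\<lambda>\<omega>. u * (path_min X a b \<omega> - u)"
    have "cdf (cond_law M (\<lambda>\<omega>. path_min X a b \<omega> > u) ?Y) x = measure (uniform_measure M (A u)) (?Y -` {..x} \<inter> space M)"
      unfolding cdf_def cond_law_def A_def[symmetric]
      by (subst measure_distr) (auto simp: A_def)
    also have "?Y -` {..x} \<inter> space M = {\<omega>\<in>space M. ?Y \<omega> \<le> x}" by auto
    also have "measure (uniform_measure M (A u)) {\<omega>\<in>space M. ?Y \<omega> \<le> x} =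
        prob (A u \<inter> {\<omega>\<in>space M. ?Y \<omega> \<le> x}) / prob (A u)"
      using that by (intro measure_uniform_measure) (auto simp: emeasure_eq_measure g_def A_def)
    finally show ?thesis by (simp add: g_def A_def)
  qed
  show "((\<lambda>u. cdf (cond_law M (\<lambda>\<omega>. path_min X a b \<omega> > u) (\<lambda>\<omega>. u * (path_min X a b \<omega> - u))) x) \<longlongrightarrow>
      cdf (exponential_measure_of_mean V) x) at_top"
  proof (cases "x \<ge> 0")
    case True
    have "((\<lambda>u. 1 - g (u + x / u) / g u) \<longlongrightarrow> 1 - exp (- x / V)) at_top"
      by (intro tendsto_intros g_ratio_tendsto True)
    moreover have "eventually (\<lambda>u. 1 - g (u + x / u) / g u =
        cdf (cond_law M (\<lambda>\<omega>. path_min X a b \<omega> > u) (\<lambda>\<omega>. u * (path_min X a b \<omega> - u))) x) at_top"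
      using g_pos eventually_gt_at_top[of 0]
    proof eventually_elim
      fix u :: real assume u: "g u > 0" "u > 0"
      \<comment> \<open>For u > 0 the bound on the scaled excess reads min X \<le> u + x/u, so the
        conditional distribution function is 1 - g(u + x/u)/g(u).\<close>
      have "A u \<inter> {\<omega>\<in>space M. u * (path_min X a b \<omega> - u) \<le> x} = A u - A (u + x / u)"
        using u by (auto simp: A_def not_less field_simps)
      moreover have "A (u + x / u) \<subseteq> A u"
        using u True by (auto simp: A_def intro: le_less_trans[rotated])
      ultimately have "prob (A u \<inter> {\<omega>\<in>space M. u * (path_min X a b \<omega> - u) \<le> x}) = g u - g (u + x / u)"
        by (simp add: finite_measure_Diff) (simp add: g_def A_def)
      then show "1 - g (u + x / u) / g u =
          cdf (cond_law M (\<lambda>\<omega>. path_min X a b \<omega> > u) (\<lambda>\<omega>. u * (path_min X a b \<omega> - u))) x"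
        using u by (simp add: cdf_eq diff_divide_distrib)
    qed
    ultimately show ?thesis
      using True V_pos by (simp add: cdf_exponential_measure Lim_transform_eventually)
  next
    case False
    have "eventually (\<lambda>u.
        cdf (cond_law M (\<lambda>\<omega>. path_min X a b \<omega> > u) (\<lambda>\<omega>. u * (path_min X a b \<omega> - u))) x = 0) at_top"
      using g_pos eventually_gt_at_top[of 0]
    proof eventually_elim
      fix u :: real assume u: "g u > 0" "u > 0"
      \<comment> \<open>On the conditioning event the scaled excess is positive, so a negative x has
        conditional probability 0.\<close>
      have "A u \<inter> {\<omega>\<in>space M. u * (path_min X a b \<omega> - u) \<le> x} = {}"
      proof -
        have "u * (path_min X a b \<omega> - u) > x" if "\<omega> \<in> A u" for \<omega>
        proof -
          have "u * (path_min X a b \<omega> - u) > 0" using that u by (simp add: A_def)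
          then show ?thesis using False by linarith
        qed
        then show ?thesis by fastforce
      qed
      then show "cdf (cond_law M (\<lambda>\<omega>. path_min X a b \<omega> > u) (\<lambda>\<omega>. u * (path_min X a b \<omega> - u))) x = 0"
        using u by (simp add: cdf_eq)
    qed
    from tendsto_eventually[OF this] show ?thesis
      using False V_pos by (simp add: cdf_exponential_measure)
  qed
qed

end

theorem theorem4p3:
  fixes M :: "'w measure" and X :: "real \<Rightarrow> 'w \<Rightarrow> real" and a b :: real
    and \<nu> :: "real measure" and \<mu> :: "real \<Rightarrow> real"
  assumes "a < b"
    and "gaussian_process M X" and "centered M X" and "continuous_paths M X"
    and "entire_case M X a b \<or> stationary_case M X"
    and "is_energy_minimizer (cov_fun M X) a b \<nu>"
    and "is_cond_mean_at_one M X (measure_support \<nu>) \<mu>"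
    and "\<forall>t \<in> measure_support \<nu> \<inter> {a<..<b}. (deriv ^^ 2) \<mu> t > 0"
  shows "weak_conv_along
           (\<lambda>u. cond_law M (\<lambda>\<omega>. path_min X a b \<omega> > u) (\<lambda>\<omega>. u * (path_min X a b \<omega> - u)))
           (exponential_measure_of_mean (energy (cov_fun M X) a b \<nu>))
           at_top"
proof -
  interpret centered_gaussian M X by unfold_locales fact+
  have \<nu>: "\<nu> \<in> prob_on a b"
    using assms(6) by (simp add: is_energy_minimizer_def is_arg_min_def)
  interpret \<nu>: real_distribution \<nu> using \<nu> by (simp add: prob_on_def)
  define S where "S = measure_support \<nu>"
  have S_sub: "S \<subseteq> {a..b}"
    unfolding S_def by (rule measure_support_subset[OF \<nu>])
  have S_AE: "AE x in \<nu>. x \<in> S"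
    unfolding S_def by (rule AE_in_measure_support[OF \<nu>.real_distribution_axioms])
  have "expectation (\<lambda>\<omega>. (X t \<omega>)\<^sup>2) > 0" if "t \<in> S" for t
    using second_moment_pos[OF assms(5,4), of "{t}" "\<lambda>_. 1"] that S_sub by auto
  then have S: "finite S"
    using assms(7) by (intro cond_mean_imp_finite) (auto simp: S_def)
  define V where "V = energy (cov_fun M X) a b \<nu>"
  define W where "W = (\<lambda>\<omega>. \<Sum>s\<in>S. measure \<nu> {s} * X s \<omega>)"
  have W: "W \<in> lin_span" unfolding W_def by (rule lin_span_sum[OF S])
  have mass: "(\<Sum>s\<in>S. measure \<nu> {s}) = 1"
    using \<nu>.integral_finite_support[OF S S_AE, of "\<lambda>_. 1"] \<nu>.prob_space by simp
  have V: "expectation (\<lambda>\<omega>. (W \<omega>)\<^sup>2) = V"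
    unfolding V_def W_def
    by (rule energy_eq_second_moment[OF assms(4) \<nu>.real_distribution_axioms S S_sub S_AE, symmetric])
  have V_pos: "V > 0"
    unfolding V[symmetric] W_def by (rule second_moment_pos[OF assms(5,4) S S_sub _ mass]) simp
  \<comment> \<open>The regression coefficient of X_t on \<open>W\<close>, which makes the residual
    orthogonal to \<open>W\<close>.\<close>
  define m where "m = (\<lambda>t. expectation (\<lambda>\<omega>. W \<omega> * X t \<omega>) / V)"
  have m: "m t \<ge> 1" if "t \<in> {a..b}" for t
    using energy_minimizer_first_order[OF assms(4,6) S S_sub S_AE that] V_pos
    by (simp add: m_def V_def W_def le_divide_eq)
  define Y where "Y = (\<lambda>t \<omega>. 1 * X t \<omega> + (- m t) * W \<omega>)"
  have Y: "Y t \<in> lin_span" for t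
    unfolding Y_def by (intro lin_span_combine X_in_lin_span W)
  have cov_W: "expectation (\<lambda>\<omega>. X t \<omega> * W \<omega>) = m t * V" for t
    using V_pos by (simp add: m_def mult.commute)
  have intXW: "integrable M (\<lambda>\<omega>. X t \<omega> * W \<omega>)" for t
    by (rule lin_span_mult_integrable[OF X_in_lin_span W])
  have intWW: "integrable M (\<lambda>\<omega>. W \<omega> * W \<omega>)"
    by (rule lin_span_mult_integrable[OF W W])
  have EWW: "expectation (\<lambda>\<omega>. W \<omega> * W \<omega>) = V"
    using V by (simp add: power2_eq_square)
  have smooth: "smooth_paths M X"
    using assms(5) by (auto simp: entire_case_def stationary_case_def)
  have "\<exists>L. \<forall>s\<in>dyadics a b. \<forall>t\<in>dyadics a b. \<bar>X s \<omega> - X t \<omega>\<bar> \<le> L * \<bar>s - t\<bar>" if "\<omega> \<in> space M" for \<omega>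
    using smooth_paths_Lipschitz[OF smooth that, of a b] dyadics_subset[of a b] assms(1) by (meson less_imp_le subsetD)
  then obtain K where K: "K \<ge> 0" "\<And>s t. s \<in> dyadics a b \<Longrightarrow> t \<in> dyadics a b \<Longrightarrow>
      expectation (\<lambda>\<omega>. (X s \<omega> - X t \<omega>)\<^sup>2) \<le> K\<^sup>2 * (s - t)\<^sup>2"
    using increments_L2_Lipschitz[OF countable_dyadics[of a b]] by blast
  \<comment> \<open>Pythagoras: passing to the residual subtracts (m(s) - m(t))^2 V from the second
    moment of an increment, so the constant \<open>K\<close> of \<open>X\<close> still
    serves.\<close>
  have KY: "expectation (\<lambda>\<omega>. (Y s \<omega> - Y t \<omega>)\<^sup>2) \<le> K\<^sup>2 * (s - t)\<^sup>2"
    if "s \<in> dyadics a b" "t \<in> dyadics a b" for s t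
  proof -
    have inc: "(\<lambda>\<omega>. X s \<omega> - X t \<omega>) \<in> lin_span" by (intro lin_span_diff X_in_lin_span)
    have "(\<lambda>\<omega>. (Y s \<omega> - Y t \<omega>)\<^sup>2) = (\<lambda>\<omega>. (1 * (X s \<omega> - X t \<omega>) + (- (m s - m t)) * W \<omega>)\<^sup>2)"
      by (simp add: Y_def algebra_simps)
    then have "expectation (\<lambda>\<omega>. (Y s \<omega> - Y t \<omega>)\<^sup>2) =
        expectation (\<lambda>\<omega>. (X s \<omega> - X t \<omega>)\<^sup>2) - 2 * (m s - m t) * expectation (\<lambda>\<omega>. (X s \<omega> - X t \<omega>) * W \<omega>)
          + (m s - m t)\<^sup>2 * V"
      unfolding V[symmetric] by (simp only: lin_span_second_moment[OF inc W]) (simp add: algebra_simps power2_eq_square)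
    also have "expectation (\<lambda>\<omega>. (X s \<omega> - X t \<omega>) * W \<omega>) = (m s - m t) * V"
      using intXW by (simp add: left_diff_distrib cov_W)
    finally have "expectation (\<lambda>\<omega>. (Y s \<omega> - Y t \<omega>)\<^sup>2) =
        expectation (\<lambda>\<omega>. (X s \<omega> - X t \<omega>)\<^sup>2) - (m s - m t)\<^sup>2 * V"
      by (simp add: power2_eq_square algebra_simps)
    moreover have "(m s - m t)\<^sup>2 * V \<ge> 0" using V_pos by simp
    ultimately show ?thesis using K(2)[OF that] by linarith
  qed
  obtain c where c: "c > 0"
    "\<And>z. z \<ge> 0 \<Longrightarrow> prob {\<omega>\<in>space M. \<exists>t\<in>dyadics a b. \<bar>Y t \<omega>\<bar> > z} \<le> 4 * exp (- c * z\<^sup>2)"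
    using dyadic_sup_tail[OF assms(1) Y K(1) KY] by blast
  have cont: "continuous_on UNIV (\<lambda>t. X t \<omega>)" if "\<omega> \<in> space M" for \<omega>
    using assms(4) that by (simp add: continuous_paths_def)
  interpret high_minimum M X a b V W "dyadics a b" m 4 c
  proof unfold_locales
    show "expectation (\<lambda>\<omega>. (X t \<omega> - m t * W \<omega>) * W \<omega>) = 0" for t
      using intXW intWW by (simp add: left_diff_distrib mult.assoc cov_W EWW)
    show "m t \<ge> 1" if "t \<in> dyadics a b" for t
      using m that dyadics_subset[of a b] assms(1) by auto
    show "prob {\<omega>\<in>space M. \<exists>t\<in>dyadics a b. \<bar>X t \<omega> - m t * W \<omega>\<bar> > z} \<le> 4 * exp (- c * z\<^sup>2)"
      if "z \<ge> 0" for z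
      using c(2)[OF that] by (simp add: Y_def)
    show "W \<omega> > u" if \<omega>: "\<omega> \<in> space M" and u: "path_min X a b \<omega> > u" for \<omega> u
    proof -
      have "compact ((\<lambda>t. X t \<omega>) ` {a..b})"
        using continuous_on_subset[OF cont[OF \<omega>]] by (intro compact_continuous_image) auto
      then have "bdd_below ((\<lambda>t. X t \<omega>) ` {a..b})"
        by (intro bounded_imp_bdd_below compact_imp_bounded)
      then have "path_min X a b \<omega> \<le> X s \<omega>" if "s \<in> S" for s
        unfolding path_min_def using that S_sub by (intro cINF_lower) auto
      \<comment> \<open>\<open>W\<close> is an average of path values over \<open>S\<close> with
        total weight 1, so it is at least the minimum.\<close>
      then have "(\<Sum>s\<in>S. measure \<nu> {s} * path_min X a b \<omega>) \<le> W \<omega>"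
        unfolding W_def by (intro sum_mono mult_left_mono) auto
      then have "path_min X a b \<omega> \<le> W \<omega>"
        by (simp add: mass flip: sum_distrib_right)
      then show ?thesis using u by simp
    qed
    show "path_min X a b \<omega> > u \<longleftrightarrow> (\<exists>n::nat. \<forall>t\<in>dyadics a b. X t \<omega> \<ge> u + 1 / (real n + 1))"
      if "\<omega> \<in> space M" for \<omega> u
      by (rule path_min_gt_iff[of a b X \<omega>, OF assms(1) cont[OF that]])
  qed (use W V V_pos c(1) countable_dyadics in auto)
  show ?thesis using cond_law_converges by (simp add: V_def)
qed

end
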